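(* Let $q$ be a prime with $q\equiv 1\pmod 3$, and write $4q=L^2+27M^2$ with $L,M\in\mathbb{Z}$ and $L\equiv 1\pmod 3$. Let $p$ be a prime with $p\neq 2,3,q$ and $p\nmid LM$. Then \begin{align*} \left(\frac{q}{p}\right)\sum_{k=0}^{p-1}S_k\frac{M^{2k}}{(16q)^k}&\equiv \begin{cases} 1/2 \pmod{p}, & \text{if } p^{\frac{q-1}{3}}\equiv 1\pmod{q};\\ \frac{\pm L-2M}{8M} \pmod{p}, & \text{if } p^{\frac{q-1}{3}}\equiv \frac{-1\pm L/(3M)}{2}\pmod{q}, \end{cases}\\ \left(\frac{3q}{p}\right)\sum_{k=0}^{p-1}S_k\frac{L^{2k}}{(432q)^k}&\equiv \begin{cases} 1/2 \pmod{p}, & \text{if } p^{\frac{q-1}{3}}\equiv 1\pmod{q};\\ \frac{\pm 27M-2L}{8L} \pmod{p}, & \text{if } p^{\frac{q-1}{3}}\equiv \frac{-1\pm 9M/L}{2}\pmod{q}, \end{cases}\\ \left(\frac{q}{p}\right)\sum_{k=0}^{p-1}(2k+1)S_k\frac{M^{2k}}{(16q)^k}&\equiv \begin{cases} 1/2 \pmod{p}, & \text{if } p^{\frac{q-1}{3}}\equiv 1\pmod{q};\\ \frac{\pm 6M-L}{4L} \pmod{p}, & \text{if } p^{\frac{q-1}{3}}\equiv \frac{-1\pm 9M/L}{2}\pmod{q}, \end{cases}\\ \left(\frac{3q}{p}\right)\sum_{k=0}^{p-1}(2k+1)S_k\frac{L^{2k}}{(432q)^k}&\equiv \begin{cases}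 1/2 \pmod{p}, & \text{if } p^{\frac{q-1}{3}}\equiv 1\pmod{q};\\ \frac{\pm 2L-9M}{36M} \pmod{p}, & \text{if } p^{\frac{q-1}{3}}\equiv \frac{-1\pm L/(3M)}{2}\pmod{q}. \end{cases} \end{align*}
   Context: $S_n=\frac{\binom{6n}{3n}\binom{3n}{n}}{2\binom{2n}{n}(2n+1)}$ for $n\ge 0$. $\left(\frac{\cdot}{p}\right)$ is the Legendre symbol. Congruences between rationals with denominators prime to the modulus are in the usual sense. In each case the signs $\pm$ correspond. *)

theory Defs
  imports Complex_Main "HOL-Number_Theory.Number_Theory"
begin

text \<open>
  Rational-valued, since the term at \<open>n = 0\<close> is \<open>1/2\<close>.
\<close>
definition S :: "nat \<Rightarrow> rat" where
  "S n = of_nat (((6 * n) choose (3 * n)) * ((3 * n) choose n))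
           / of_nat (2 * ((2 * n) choose n) * (2 * n + 1))"

text \<open>
  Congruence of rationals whose reduced denominators are prime to the modulus: the numerator of
  the reduced difference is divisible by the modulus.
\<close>
definition rat_cong :: "rat \<Rightarrow> rat \<Rightarrow> int \<Rightarrow> bool" where
  "rat_cong a b m \<longleftrightarrow>
     coprime (snd (quotient_of a)) m \<and> coprime (snd (quotient_of b)) m \<and>
     m dvd fst (quotient_of (a - b))"

end

theory Submission
  imports Defs "HOL-Computational_Algebra.Polynomial"
begin

text \<open>
  If \<open>108 z = (sin \<theta>)\<^sup>2\<close>, then \<open>\<Sum>n. S n * z ^ n\<close> equals \<open>3/4 * sin (2 \<theta> / 3) / sin \<theta>\<close>. Write
  \<open>r = exp (2 i \<theta>)\<close> and \<open>p = 6 h \<plusminus> 1\<close>. Modulo \<open>p\<close> the number \<open>2 / 3\<close> becomes an integer, so the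
  truncated series is a combination of two Chebyshev-type polynomials, one for each exponent at
  \<open>0\<close> of the hypergeometric equation, and its value is a rational expression in \<open>r\<close> and \<open>r ^ h\<close>.

  At the arguments of the theorem \<open>r = \<plusminus> J / cnj J\<close> with \<open>J = (L + 3 M sqrt (-3)) / 2\<close>, and \<open>J\<close> is
  the Jacobi sum of a cubic character \<open>\<chi>\<close> modulo \<open>q\<close>. The Gauss sum \<open>G\<close> of \<open>\<chi>\<close> satisfies
  \<open>G ^ 3 = q J\<close>, and comparing \<open>G ^ p\<close> with its Frobenius image modulo \<open>p\<close> shows that
  \<open>(J / cnj J) ^ h\<close> is \<open>(q / p) \<chi>(p)\<^sup>2\<close> if \<open>p = 6 h + 1\<close> and \<open>(q / p) \<chi>(p)\<close> if \<open>p = 6 h - 1\<close>.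
  Finally \<open>\<chi>(p)\<close> is determined by \<open>p ^ ((q - 1) / 3)\<close> modulo \<open>q\<close>.
\<close>

subsection \<open>Eisenstein integers and congruences\<close>

text \<open>The series is \<open>1/2\<close> times the hypergeometric function 2F1(1/6, 5/6; 3/2;
  108 z), with exponents \<open>0\<close> and \<open>-1/2\<close> at the origin. Modulo
  \<open>p\<close> the exponent \<open>-1/2\<close> is the integer \<open>(p - 1) / 2\<close>, so
  truncation does not isolate one solution: a second block starts in that degree and brings in
  \<open>z ^ ((p - 1) / 2)\<close>, a Legendre symbol.

  The arguments come from \<open>4 q = L^2 + 27 M^2\<close>. For \<open>z = M^2 / (16 q)\<close> one
  gets \<open>(sin \<theta>)^2 = 27 M^2 / (4 q)\<close>, so \<open>\<theta>\<close> is essentially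
  the argument of \<open>J\<close>. For \<open>z = L^2 / (432 q)\<close> sine and cosine trade
  places, which changes the sign of \<open>r\<close>; this sign contributes
  \<open>(-1) ^ h = (3 / p)\<close>.

  The obstacle is the exact value of \<open>r ^ h\<close>. Frobenius in the Eisenstein integers
  shows only that its sixth power is \<open>1\<close> modulo \<open>p\<close>. The sign is found
  from Euler's criterion and the cubic part from the Gauss sum. The same sign is the value of
  \<open>z ^ ((p - 1) / 2)\<close>, so it factors out of both blocks, and the remaining expression
  depends on \<open>p\<close> only through \<open>\<chi>(p)\<close>.\<close>

definition rng_cong :: "'a::comm_ring_1 \<Rightarrow> 'a \<Rightarrow> 'a \<Rightarrow> bool" where
  "rng_cong m x y \<longleftrightarrow> m dvd (x - y)"

lemma rng_cong_refl [simp]: "rng_cong m x x"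
  by (simp add: rng_cong_def)

lemma rng_cong_sym: "rng_cong m x y \<Longrightarrow> rng_cong m y x"
  unfolding rng_cong_def by (metis dvd_minus_iff minus_diff_eq)

lemma rng_cong_trans [trans]: "rng_cong m x y \<Longrightarrow> rng_cong m y z \<Longrightarrow> rng_cong m x z"
  unfolding rng_cong_def using dvd_add[of m "x - y" "y - z"] by simp

lemma rng_cong_add: "rng_cong m x y \<Longrightarrow> rng_cong m x' y' \<Longrightarrow> rng_cong m (x + x') (y + y')"
  unfolding rng_cong_def using dvd_add[of m "x - y" "x' - y'"] by (simp add: algebra_simps)

lemma rng_cong_diff: "rng_cong m x y \<Longrightarrow> rng_cong m x' y' \<Longrightarrow> rng_cong m (x - x') (y - y')"
  unfolding rng_cong_def using dvd_diff[of m "x - y" "x' - y'"] by (simp add: algebra_simps)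

lemma rng_cong_mult:
  assumes "rng_cong m x y" "rng_cong m x' y'"
  shows "rng_cong m (x * x') (y * y')"
proof -
  have "x * x' - y * y' = (x - y) * x' + y * (x' - y')" by (simp add: algebra_simps)
  then show ?thesis using assms by (simp add: rng_cong_def)
qed

lemma rng_cong_power: "rng_cong m x y \<Longrightarrow> rng_cong m (x ^ n) (y ^ n)"
  by (induction n) (auto intro: rng_cong_mult)

lemma rng_cong_sum: "(\<And>i. i \<in> I \<Longrightarrow> rng_cong m (f i) (g i)) \<Longrightarrow> rng_cong m (\<Sum>i\<in>I. f i) (\<Sum>i\<in>I. g i)"
  by (induction I rule: infinite_finite_induct) (auto intro: rng_cong_add)

text \<open>\<open>Eis a b\<close> stands for \<open>a + b \<omega>\<close> with \<open>\<omega>\<close> a primitive cube root of unity.\<close>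

datatype eis = Eis (eis_re: int) (eis_om: int)

instantiation eis :: comm_ring_1
begin

definition zero_eis :: eis where "0 = Eis 0 0"
definition one_eis :: eis where "1 = Eis 1 0"
definition plus_eis :: "eis \<Rightarrow> eis \<Rightarrow> eis" where
  "x + y = Eis (eis_re x + eis_re y) (eis_om x + eis_om y)"
definition minus_eis :: "eis \<Rightarrow> eis \<Rightarrow> eis" where
  "x - y = Eis (eis_re x - eis_re y) (eis_om x - eis_om y)"
definition uminus_eis :: "eis \<Rightarrow> eis" where
  "- x = Eis (- eis_re x) (- eis_om x)"
definition times_eis :: "eis \<Rightarrow> eis \<Rightarrow> eis" where
  "x * y = Eis (eis_re x * eis_re y - eis_om x * eis_om y)
               (eis_re x * eis_om y + eis_om x * eis_re y - eis_om x * eis_om y)"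

instance
  by standard
    (auto simp: zero_eis_def one_eis_def plus_eis_def minus_eis_def uminus_eis_def times_eis_def
      algebra_simps)

end

lemma eis_sel_simps [simp]:
  "eis_re 0 = 0" "eis_om 0 = 0" "eis_re 1 = 1" "eis_om 1 = 0"
  "eis_re (x + y) = eis_re x + eis_re y" "eis_om (x + y) = eis_om x + eis_om y"
  "eis_re (x - y) = eis_re x - eis_re y" "eis_om (x - y) = eis_om x - eis_om y"
  "eis_re (- x) = - eis_re x" "eis_om (- x) = - eis_om x"
  "eis_re (x * y) = eis_re x * eis_re y - eis_om x * eis_om y"
  "eis_om (x * y) = eis_re x * eis_om y + eis_om x * eis_re y - eis_om x * eis_om y"
  by (simp_all add: zero_eis_def one_eis_def plus_eis_def minus_eis_def uminus_eis_def
      times_eis_def)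

lemma eis_of_nat_sel [simp]: "eis_re (of_nat n) = int n" "eis_om (of_nat n) = 0"
  by (induction n) auto

lemma eis_of_int_sel [simp]: "eis_re (of_int n) = n" "eis_om (of_int n) = 0"
  by (cases n rule: int_diff_cases; simp)+

lemma eis_numeral_sel [simp]: "eis_re (numeral n) = numeral n" "eis_om (numeral n) = 0"
  using eis_of_nat_sel[of "numeral n"] by simp_all

lemma of_int_dvd_eis_iff: "(of_int n :: eis) dvd x \<longleftrightarrow> n dvd eis_re x \<and> n dvd eis_om x"
proof
  assume "n dvd eis_re x \<and> n dvd eis_om x"
  then obtain a b where "eis_re x = n * a" "eis_om x = n * b" by (auto elim!: dvdE)
  then have "x = of_int n * Eis a b" by (intro eis.expand) simp
  then show "of_int n dvd x" by simp
qed (auto elim!: dvdE)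

lemma of_nat_dvd_eis_iff: "(of_nat n :: eis) dvd x \<longleftrightarrow> int n dvd eis_re x \<and> int n dvd eis_om x"
  using of_int_dvd_eis_iff[of "int n" x] by simp

definition eis_w :: eis where "eis_w = Eis 0 1"

lemma eis_w_sel [simp]: "eis_re eis_w = 0" "eis_om eis_w = 1"
  by (simp_all add: eis_w_def)

lemma eis_eq_of_int_w: "x = of_int (eis_re x) + of_int (eis_om x) * eis_w"
  by (intro eis.expand) simp

lemma eis_w_power2: "eis_w\<^sup>2 = - 1 - eis_w"
  by (intro eis.expand) (simp add: power2_eq_square)

lemma eis_w_power3 [simp]: "eis_w ^ 3 = 1"
  by (intro eis.expand) (simp add: power3_eq_cube)

text \<open>For a primitive cube root of unity \<open>c\<close> the element \<open>1 - c\<close>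
  divides \<open>3\<close>. So \<open>(1 - c) * X = 0\<close> gives \<open>3 * X = 0\<close>, and
  \<open>X = 0\<close> can be read off the coordinates.\<close>

lemma two_plus_w_times_one_minus_w:
  "(2 + eis_w) * (1 - eis_w) = 3" "(2 + eis_w\<^sup>2) * (1 - eis_w\<^sup>2) = 3"
  by (rule eis.expand, simp add: power2_eq_square)+

definition eis_cnj :: "eis \<Rightarrow> eis" where
  "eis_cnj x = Eis (eis_re x - eis_om x) (- eis_om x)"

lemma eis_cnj_sel [simp]:
  "eis_re (eis_cnj x) = eis_re x - eis_om x" "eis_om (eis_cnj x) = - eis_om x"
  by (simp_all add: eis_cnj_def)

lemma eis_cnj_hom [simp]:
  "eis_cnj 0 = 0" "eis_cnj 1 = 1" "eis_cnj (of_nat n) = of_nat n" "eis_cnj (of_int k) = of_int k"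
  "eis_cnj (x + y) = eis_cnj x + eis_cnj y" "eis_cnj (x - y) = eis_cnj x - eis_cnj y"
  "eis_cnj (x * y) = eis_cnj x * eis_cnj y"
  by (auto intro!: eis.expand simp: algebra_simps)

lemma eis_cnj_power [simp]: "eis_cnj (x ^ n) = eis_cnj x ^ n"
  by (induction n) auto

lemma eis_cnj_cnj [simp]: "eis_cnj (eis_cnj x) = x"
  by (auto intro!: eis.expand)

lemma eis_cnj_sum: "eis_cnj (\<Sum>i\<in>I. f i) = (\<Sum>i\<in>I. eis_cnj (f i))"
  by (induction I rule: infinite_finite_induct) auto

lemma eis_cnj_w [simp]: "eis_cnj eis_w = eis_w\<^sup>2"
  by (auto intro!: eis.expand simp: power2_eq_square)

text \<open>Substitution of the integer \<open>t\<close> for \<open>\<omega>\<close>. Once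
  \<open>q\<close> divides \<open>t\<^sup>2 + t + 1\<close> it is, modulo \<open>q\<close>, the
  reduction at the prime above \<open>q\<close> that contains \<open>\<omega> - t\<close>.\<close>

definition eis_eval :: "int \<Rightarrow> eis \<Rightarrow> int" where
  "eis_eval t x = eis_re x + eis_om x * t"

lemma eis_eval_simps [simp]:
  "eis_eval t 0 = 0" "eis_eval t 1 = 1" "eis_eval t eis_w = t"
  "eis_eval t (x + y) = eis_eval t x + eis_eval t y"
  by (simp_all add: eis_eval_def algebra_simps)

lemma eis_eval_sum: "eis_eval t (\<Sum>i\<in>I. f i) = (\<Sum>i\<in>I. eis_eval t (f i))"
  by (induction I rule: infinite_finite_induct) auto

lemma eis_eval_mult:
  assumes "q dvd t\<^sup>2 + t + 1"
  shows "[eis_eval t (x * y) = eis_eval t x * eis_eval t y] (mod q)"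
proof -
  have "eis_eval t x * eis_eval t y - eis_eval t (x * y) = (t\<^sup>2 + t + 1) * (eis_om x * eis_om y)"
    by (simp add: eis_eval_def algebra_simps power2_eq_square)
  then show ?thesis using assms by (metis cong_iff_dvd_diff cong_sym dvd_mult2)
qed

section \<open>Frobenius, power sums and Fermat's theorem modulo a prime\<close>

lemma prime_dvd_power_add:
  fixes x y :: "'a::comm_ring_1"
  assumes "prime p"
  shows "of_nat p dvd (x + y) ^ p - (x ^ p + y ^ p)"
proof -
  have p: "p > 0" using assms prime_gt_0_nat by blast
  have "{..p} = insert 0 (insert p {1..<p})" using p by auto
  then have "(x + y) ^ p = x ^ p + y ^ p
      + (\<Sum>k\<in>{1..<p}. of_nat (p choose k) * x ^ k * y ^ (p - k))"
    using p by (simp add: binomial_ring algebra_simps)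
  moreover have "of_nat p dvd (\<Sum>k\<in>{1..<p}. of_nat (p choose k) * x ^ k * y ^ (p - k))"
  proof (intro dvd_sum dvd_mult2)
    fix k assume "k \<in> {1..<p}"
    then have "p dvd (p choose k)" using assms by (intro dvd_choose_prime) auto
    then show "(of_nat p :: 'a) dvd of_nat (p choose k)" by (metis dvd_def of_nat_mult)
  qed
  ultimately show ?thesis by simp
qed

lemma prime_dvd_power_sum:
  fixes f :: "'b \<Rightarrow> 'a::comm_ring_1"
  assumes "prime p"
  shows "of_nat p dvd (\<Sum>i\<in>A. f i) ^ p - (\<Sum>i\<in>A. f i ^ p)"
proof (induction A rule: infinite_finite_induct)
  case (insert a A)
  have "(\<Sum>i\<in>insert a A. f i) ^ p - (\<Sum>i\<in>insert a A. f i ^ p)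
    = ((f a + (\<Sum>i\<in>A. f i)) ^ p - (f a ^ p + (\<Sum>i\<in>A. f i) ^ p))
      + ((\<Sum>i\<in>A. f i) ^ p - (\<Sum>i\<in>A. f i ^ p))"
    using insert by simp
  then show ?case using prime_dvd_power_add[OF assms] insert.IH by (metis dvd_add)
qed (use assms prime_gt_0_nat[of p] in \<open>simp_all add: zero_power\<close>)

text \<open>The differences \<open>(a + 1) ^ (i + 1) - a ^ (i + 1)\<close> telescope to
  \<open>q ^ (i + 1)\<close>. Expanding them by the binomial theorem expresses \<open>i + 1\<close>
  times the wanted sum through the sums with lower exponents, and \<open>i + 1 < q\<close> is prime
  to \<open>q\<close>.\<close>

lemma prime_dvd_sum_power:
  assumes "prime (q::nat)" "i < q - 1"
  shows "int q dvd (\<Sum>a<q. int a ^ i)"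
  using assms(2)
proof (induction i rule: less_induct)
  case (less i)
  have "(\<Sum>j\<le>i. of_nat (Suc i choose j) * (\<Sum>a<q. int a ^ j))
     = (\<Sum>a<q. \<Sum>j\<le>i. of_nat (Suc i choose j) * int a ^ j)"
    by (simp add: sum_distrib_left sum.swap[of _ "{..i}"])
  also have "\<dots> = (\<Sum>a<q. int (Suc a) ^ Suc i - int a ^ Suc i)"
  proof (rule sum.cong)
    fix a
    have "int (Suc a) ^ Suc i = (\<Sum>j\<le>Suc i. of_nat (Suc i choose j) * int a ^ j)"
      using binomial_ring[of "int a" 1 "Suc i"] by (simp add: add.commute)
    then show "(\<Sum>j\<le>i. of_nat (Suc i choose j) * int a ^ j) = int (Suc a) ^ Suc i - int a ^ Suc i"
      by simp
  qed simp
  also have "\<dots> = int q ^ Suc i"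
    using sum_lessThan_telescope[of "\<lambda>a. int a ^ Suc i" q] by simp
  finally have "int q dvd (\<Sum>j\<le>i. of_nat (Suc i choose j) * (\<Sum>a<q. int a ^ j))" by simp
  also have "(\<Sum>j\<le>i. of_nat (Suc i choose j) * (\<Sum>a<q. int a ^ j))
     = (\<Sum>j<i. of_nat (Suc i choose j) * (\<Sum>a<q. int a ^ j)) + int (Suc i) * (\<Sum>a<q. int a ^ i)"
    by (simp add: lessThan_Suc_atMost[symmetric])
  finally have "int q dvd int (Suc i) * (\<Sum>a<q. int a ^ i)"
  proof (subst (asm) dvd_add_right_iff)
    show "int q dvd (\<Sum>j<i. of_nat (Suc i choose j) * (\<Sum>a<q. int a ^ j))"
    proof (rule dvd_sum)
      fix j assume "j \<in> {..<i}"
      then have "int q dvd (\<Sum>a<q. int a ^ j)" using less by auto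
      then show "int q dvd of_nat (Suc i choose j) * (\<Sum>a<q. int a ^ j)" by (rule dvd_mult)
    qed
  qed
  moreover have "\<not> int q dvd int (Suc i)"
    using less.prems by (metis int_dvd_int_iff less_diff_conv nat_dvd_not_less zero_less_Suc Suc_eq_plus1)
  ultimately show ?case using assms(1) by (metis prime_dvd_mult_iff prime_nat_int_transfer)
qed

lemma fermat_theorem_int:
  assumes "prime p" "\<not> int p dvd a"
  shows "[a ^ (p - 1) = 1] (mod int p)"
proof -
  define b where "b = nat (a mod int p)"
  have b: "int b = a mod int p"
    using prime_gt_0_nat[OF assms(1)] by (simp add: b_def)
  have "\<not> p dvd b"
    using assms(2) b by (metis dvd_mod_iff dvd_refl int_dvd_int_iff)
  then have "[int b ^ (p - 1) = 1] (mod int p)"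
    using fermat_theorem[OF assms(1)] by (metis cong_int_iff of_nat_1 of_nat_power)
  moreover have "[a ^ (p - 1) = int b ^ (p - 1)] (mod int p)"
    unfolding b by (intro cong_pow) (simp add: cong_def)
  ultimately show ?thesis by (rule cong_trans[rotated])
qed

subsection \<open>The cubic residue character\<close>

text \<open>
  \<open>t\<close> is a primitive cube root of unity modulo \<open>q\<close>. It fixes the cubic character: \<open>chi a\<close> reduces to
  \<open>a ^ ((q - 1) div 3)\<close> under \<open>\<omega> \<mapsto> t\<close>.
\<close>

locale cubic_character =
  fixes q :: nat and t :: int
  assumes prime_q: "prime q" and q_mod_3: "[q = 1] (mod 3)" and t_root: "int q dvd t\<^sup>2 + t + 1"
begin

lemma q_gt_3: "q > 3"
proof -
  have "q \<noteq> 0" "q \<noteq> 1" "q \<noteq> 2" "q \<noteq> 3"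
    using prime_q q_mod_3 by (auto simp: cong_def)
  then show ?thesis by simp
qed

lemma prime_int_q: "prime (int q)"
  using prime_q by simp

lemma three_dvd: "3 * ((q - 1) div 3) = q - 1"
proof -
  have "q mod 3 = 1" using q_mod_3 by (simp add: cong_def)
  then show ?thesis by presburger
qed

lemma not_q_dvd_3: "\<not> int q dvd 3"
  using q_gt_3 by (auto dest!: zdvd_imp_le)

definition chi :: "int \<Rightarrow> eis" where
  "chi a = (if int q dvd a then 0
            else if [a ^ ((q - 1) div 3) = 1] (mod int q) then 1
            else if [a ^ ((q - 1) div 3) = t] (mod int q) then eis_w
            else eis_w\<^sup>2)"

lemma chi_cases: "\<not> int q dvd a \<Longrightarrow> chi a = 1 \<or> chi a = eis_w \<or> chi a = eis_w\<^sup>2"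
  by (simp add: chi_def)

lemma chi_eq_0: "int q dvd a \<Longrightarrow> chi a = 0"
  by (simp add: chi_def)

lemma eis_eval_w2: "eis_eval t (eis_w\<^sup>2) = -1 - t"
  by (simp add: eis_w_power2 eis_eval_def)

lemma chi_eval: "[eis_eval t (chi a) = a ^ ((q - 1) div 3)] (mod int q)"
proof (cases "int q dvd a")
  case True
  have "(q - 1) div 3 > 0" using q_gt_3 by simp
  then have "int q dvd a ^ ((q - 1) div 3)" using True by (simp add: dvd_power_le dvd_trans)
  then show ?thesis using True by (simp add: chi_eq_0 cong_0_iff cong_sym)
next
  case False
  define y where "y = a ^ ((q - 1) div 3)"
  have "[a ^ (q - 1) = 1] (mod int q)"
    by (rule fermat_theorem_int[OF prime_q False])
  then have "[y ^ 3 = 1] (mod int q)"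
    unfolding y_def using three_dvd by (metis mult.commute power_mult)
  then have "int q dvd y ^ 3 - 1" by (simp add: cong_iff_dvd_diff)
  \<comment> \<open>The third cube root of unity modulo \<open>q\<close> is \<open>- 1 - t\<close>,
    so \<open>y ^ 3 - 1\<close> splits into these linear factors modulo
    \<open>t\<^sup>2 + t + 1\<close>.\<close>
  moreover have "(y - 1) * ((y - t) * (y + 1 + t)) = (y ^ 3 - 1) - (t\<^sup>2 + t + 1) * (y - 1)"
    by (simp add: algebra_simps power2_eq_square power3_eq_cube)
  ultimately have "int q dvd (y - 1) * ((y - t) * (y + 1 + t))"
    using t_root by (metis dvd_diff dvd_mult2)
  then consider "int q dvd y - 1" | "int q dvd y - t" | "int q dvd y + 1 + t"
    using prime_int_q by (metis prime_dvd_mult_iff)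
  then show ?thesis
  proof cases
    case 1
    then show ?thesis using False
      unfolding chi_def y_def[symmetric] cong_iff_dvd_diff by (simp add: dvd_diff_commute)
  next
    case 2
    then show ?thesis using False
      unfolding chi_def y_def[symmetric] cong_iff_dvd_diff by (simp add: dvd_diff_commute)
  next
    case 3
    have "int q dvd (-1 - t) - y"
      using 3 dvd_minus_iff[of "int q" "y + 1 + t"] by (simp add: algebra_simps)
    then show ?thesis using False
      unfolding chi_def y_def[symmetric] cong_iff_dvd_diff
      by (simp add: eis_eval_w2 dvd_diff_commute)
  qed
qed

text \<open>The roots \<open>1\<close>, \<open>t\<close> and \<open>- 1 - t\<close> are pairwise
  distinct modulo \<open>q\<close>: each of their differences divides \<open>3\<close> modulo
  \<open>t\<^sup>2 + t + 1\<close>, and \<open>q > 3\<close>.\<close>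

lemma root_separation: "\<not> int q dvd 1 - t" "\<not> int q dvd 2 + t" "\<not> int q dvd 2 * t + 1"
proof -
  have e: "t\<^sup>2 + t + 1 + (1 - t) * (t + 2) = 3" "t\<^sup>2 + t + 1 - (2 + t) * (t - 1) = 3"
    "4 * (t\<^sup>2 + t + 1) - (2 * t + 1) * (2 * t + 1) = 3"
    by (simp_all add: algebra_simps power2_eq_square)
  show "\<not> int q dvd 1 - t"
    using dvd_add[OF t_root dvd_mult2[of "int q" "1 - t" "t + 2"]] not_q_dvd_3 unfolding e by blast
  show "\<not> int q dvd 2 + t"
    using dvd_diff[OF t_root dvd_mult2[of "int q" "2 + t" "t - 1"]] not_q_dvd_3 unfolding e by blast
  show "\<not> int q dvd 2 * t + 1"
    using dvd_diff[OF dvd_mult[OF t_root, of 4] dvd_mult2[of "int q" "2 * t + 1" "2 * t + 1"]]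
      not_q_dvd_3 unfolding e by blast
qed

lemma eval_inj:
  assumes "x = 1 \<or> x = eis_w \<or> x = eis_w\<^sup>2" "y = 1 \<or> y = eis_w \<or> y = eis_w\<^sup>2"
    and "[eis_eval t x = eis_eval t y] (mod int q)"
  shows "x = y"
proof -
  have e: "1 - (-1 - t) = 2 + t" "(-1 - t) - 1 = - (2 + t)" "t - 1 = - (1 - t)"
    "t - (-1 - t) = 2 * t + 1" "(-1 - t) - t = - (2 * t + 1)" by simp_all
  have "\<not> int q dvd 1 - (-1 - t)" "\<not> int q dvd (-1 - t) - 1" "\<not> int q dvd t - 1"
    "\<not> int q dvd 1 - t" "\<not> int q dvd t - (-1 - t)" "\<not> int q dvd (-1 - t) - t"
    unfolding e dvd_minus_iff using root_separation by simp_all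
  then show ?thesis
    using assms unfolding cong_iff_dvd_diff by (metis eis_eval_simps(2,3) eis_eval_w2)
qed

lemma unit_root_mult:
  assumes "x = 1 \<or> x = eis_w \<or> x = eis_w\<^sup>2" "y = 1 \<or> y = eis_w \<or> y = eis_w\<^sup>2"
  shows "x * y = 1 \<or> x * y = eis_w \<or> x * y = eis_w\<^sup>2"
proof -
  have "eis_w * eis_w = eis_w\<^sup>2" "eis_w * eis_w\<^sup>2 = 1" "eis_w\<^sup>2 * eis_w = 1" "eis_w\<^sup>2 * eis_w\<^sup>2 = eis_w"
    by (auto intro!: eis.expand simp: power2_eq_square)
  then show ?thesis using assms by auto
qed

text \<open>A cube root of unity is determined by its residue under \<open>eis_eval t\<close>; this
  is how values of \<open>chi\<close> are identified from here on.\<close>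

lemma chi_eqI:
  assumes "\<not> int q dvd a" "x = 1 \<or> x = eis_w \<or> x = eis_w\<^sup>2"
    and "[eis_eval t x = a ^ ((q - 1) div 3)] (mod int q)"
  shows "chi a = x"
  by (rule eval_inj[OF chi_cases[OF assms(1)] assms(2) cong_trans[OF chi_eval cong_sym[OF assms(3)]]])

lemma chi_mult: "chi (a * b) = chi a * chi b"
proof (cases "int q dvd a * b")
  case True
  then show ?thesis
    using prime_int_q by (auto simp: chi_eq_0 prime_dvd_mult_iff)
next
  case False
  then have ab: "\<not> int q dvd a" "\<not> int q dvd b" by auto
  show ?thesis
  proof (rule chi_eqI[OF False])
    show "chi a * chi b = 1 \<or> chi a * chi b = eis_w \<or> chi a * chi b = eis_w\<^sup>2"
      by (intro unit_root_mult chi_cases ab)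
    show "[eis_eval t (chi a * chi b) = (a * b) ^ ((q - 1) div 3)] (mod int q)"
      unfolding power_mult_distrib
      by (rule cong_trans[OF eis_eval_mult[OF t_root] cong_mult[OF chi_eval chi_eval]])
  qed
qed

lemma chi_mod [simp]: "chi (a mod int q) = chi a"
proof (cases "int q dvd a")
  case True then show ?thesis by (simp add: chi_eq_0 dvd_mod)
next
  case False
  then show ?thesis
    by (intro chi_eqI chi_cases cong_trans[OF chi_eval] cong_pow) (auto simp: dvd_mod_iff cong_def)
qed

lemma chi_1 [simp]: "chi 1 = 1"
  using q_gt_3 by (simp add: chi_def)

lemma unit_root_cube: "x = 1 \<or> x = eis_w \<or> x = eis_w\<^sup>2 \<Longrightarrow> x ^ 3 = 1"
  by (metis eis_w_power3 power_mult mult.commute power_one)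

lemma chi_cube: "\<not> int q dvd a \<Longrightarrow> chi a ^ 3 = 1"
  using chi_cases unit_root_cube by blast

lemma chi_power4: "chi a ^ 4 = chi a"
proof (cases "int q dvd a")
  case False
  have "chi a ^ 4 = chi a ^ 3 * chi a" by (simp add: eval_nat_numeral algebra_simps)
  then show ?thesis using chi_cube False by simp
qed (simp add: chi_eq_0)

lemma chi_minus1 [simp]: "chi (-1) = 1"
proof -
  have "chi (-1) ^ 2 = 1" using chi_mult[of "-1" "-1"] by (simp add: power2_eq_square)
  moreover have "chi (-1) ^ 3 = 1" using q_gt_3 by (intro chi_cube) auto
  ultimately show ?thesis by (metis mult_1 power2_eq_square power3_eq_cube)
qed

lemma chi_minus [simp]: "chi (- a) = chi a"
  using chi_mult[of "-1" a] by (simp only: chi_minus1 mult_1 mult_minus1)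

text \<open>Conjugation and squaring agree on cube roots of unity, so sums over the squared
  character follow from those over \<open>chi\<close> by conjugation.\<close>

lemma eis_cnj_chi: "eis_cnj (chi a) = chi a ^ 2"
proof (cases "int q dvd a")
  case False
  show ?thesis using chi_cases[OF False] by (elim disjE) (simp_all only: eis_cnj_hom eis_cnj_w eis_cnj_power power_one)
qed (simp add: chi_eq_0)

section \<open>Sums over the residues modulo q\<close>

lemma bij_betw_affine_mod:
  assumes "\<not> int q dvd c"
  shows "bij_betw (\<lambda>b. nat ((c * int b + d) mod int q)) {..<q} {..<q}"
proof -
  let ?f = "\<lambda>b. nat ((c * int b + d) mod int q)"
  have q: "int q > 0" using q_gt_3 by simp
  have "inj_on ?f {..<q}"
  proof (rule inj_onI)
    fix x y assume xy: "x \<in> {..<q}" "y \<in> {..<q}" "?f x = ?f y"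
    then have "(c * int x + d) mod int q = (c * int y + d) mod int q"
      using q by (simp add: nat_eq_iff2)
    then have "int q dvd (c * int x + d) - (c * int y + d)" by (rule mod_eq_dvd_iff[THEN iffD1])
    also have "\<dots> = c * (int x - int y)" by (simp add: algebra_simps)
    finally have "int q dvd int x - int y"
      using assms prime_int_q by (simp add: prime_dvd_mult_iff)
    then have "[int x = int y] (mod int q)" by (simp add: cong_iff_dvd_diff)
    then show "x = y" using xy by (simp add: cong_int_iff cong_less_modulus_unique_nat)
  qed
  moreover have "?f ` {..<q} \<subseteq> {..<q}" using q by (auto simp: nat_less_iff)
  ultimately show ?thesis by (simp add: bij_betw_def endo_inj_surj)
qed

lemma sum_affine:
  assumes "\<not> int q dvd c" and "\<And>x. \<phi> (x mod int q) = \<phi> x"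
  shows "(\<Sum>b<q. \<phi> (c * int b + d)) = (\<Sum>b<q. \<phi> (int b))"
proof -
  have "(\<Sum>b<q. \<phi> (c * int b + d)) = (\<Sum>b<q. \<phi> (int (nat ((c * int b + d) mod int q))))"
    using q_gt_3 by (simp add: assms(2))
  also have "\<dots> = (\<Sum>b<q. \<phi> (int b))"
    by (rule sum.reindex_bij_betw[OF bij_betw_affine_mod[OF assms(1)]])
  finally show ?thesis .
qed

text \<open>Orthogonality without a primitive root. If \<open>chi\<close> were trivial, the sum of
  all \<open>a ^ ((q - 1) div 3)\<close> would be \<open>q - 1\<close> modulo \<open>q\<close>,
  against \<open>prime_dvd_sum_power\<close>. Given \<open>c\<close> with
  \<open>chi c \<noteq> 1\<close>, the substitution \<open>a \<mapsto> c * a\<close> multiplies the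
  sum by \<open>chi c\<close>.\<close>

lemma chi_sum: "(\<Sum>a<q. chi (int a)) = 0"
proof -
  have "\<exists>c. \<not> int q dvd c \<and> chi c \<noteq> 1"
  proof (rule ccontr)
    assume "\<not> ?thesis"
    then have chi1: "\<not> int q dvd c \<Longrightarrow> chi c = 1" for c by blast
    have "(\<Sum>a<q. int a ^ ((q - 1) div 3)) = (\<Sum>a\<in>{1..<q}. int a ^ ((q - 1) div 3))"
      using q_gt_3 by (intro sum.mono_neutral_right) auto
    moreover have "[(\<Sum>a\<in>{1..<q}. int a ^ ((q - 1) div 3)) = (\<Sum>a\<in>{1..<q}. 1)] (mod int q)"
    proof (rule cong_sum)
      fix a assume "a \<in> {1..<q}"
      then have "chi (int a) = 1" by (intro chi1) (auto dest: nat_dvd_not_less)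
      then show "[int a ^ ((q - 1) div 3) = 1] (mod int q)"
        using chi_eval[of "int a"] by (simp add: cong_sym)
    qed
    moreover have "int q dvd (\<Sum>a<q. int a ^ ((q - 1) div 3))"
      using q_gt_3 by (intro prime_dvd_sum_power[OF prime_q]) simp
    ultimately have "int q dvd (\<Sum>a\<in>{1..<q}. 1)"
      using cong_dvd_iff by metis
    then have "int q dvd int (q - 1)" by simp
    then have "q dvd q - 1" by (simp only: int_dvd_int_iff)
    then show False using q_gt_3 by (auto dest: dvd_imp_le)
  qed
  then obtain c where c: "\<not> int q dvd c" "chi c \<noteq> 1" by blast
  define X where "X = (\<Sum>a<q. chi (int a))"
  have "X = (\<Sum>a<q. chi (c * int a + 0))"
    unfolding X_def using c(1) by (intro sum_affine[symmetric]) auto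
  then have "X = chi c * X"
    by (simp add: chi_mult X_def[symmetric] sum_distrib_left[symmetric])
  then have "(1 - chi c) * X = 0" by (simp add: algebra_simps)
  moreover have "(2 + chi c) * (1 - chi c) = 3"
    using chi_cases[OF c(1)] c(2) two_plus_w_times_one_minus_w by metis
  ultimately have "3 * X = 0" by (metis mult.assoc mult_zero_right)
  then have "eis_re (3 * X) = 0" "eis_om (3 * X) = 0" by simp_all
  then show ?thesis unfolding X_def[symmetric] by (intro eis.expand) simp
qed

lemma chi_sum2: "(\<Sum>a<q. chi (int a) ^ 2) = 0"
  using arg_cong[OF chi_sum, of eis_cnj] by (simp add: eis_cnj_sum eis_cnj_chi)

end

subsection \<open>The group ring of the additive group modulo q\<close>

context cubic_character
begin

text \<open>
  Gauss sums live in the group ring, that is, in the polynomials modulo \<open>X ^ q - 1\<close>, instead of a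
  cyclotomic field: there congruences modulo \<open>p\<close> can be compared coefficient by coefficient.
\<close>

definition gr :: "(int \<Rightarrow> eis) \<Rightarrow> eis poly" where
  "gr \<phi> = (\<Sum>a<q. monom (\<phi> (int a)) a)"

abbreviation gcong :: "eis poly \<Rightarrow> eis poly \<Rightarrow> bool" where
  "gcong \<equiv> rng_cong (monom 1 q - 1)"

lemma gcong_monom: "gcong (monom c k) (monom c (k mod q))"
proof -
  have "gcong (monom 1 q) 1" by (simp add: rng_cong_def)
  then have "gcong (monom c (k mod q) * monom 1 q ^ (k div q)) (monom c (k mod q) * 1 ^ (k div q))"
    by (intro rng_cong_mult rng_cong_power) simp_all
  then show ?thesis by (simp add: monom_power mult_monom add.commute)
qed

lemma coeff_gr: "a < q \<Longrightarrow> coeff (gr \<phi>) a = \<phi> (int a)"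
  by (simp add: gr_def coeff_sum)

lemma degree_gr: "degree (gr \<phi>) < q"
proof -
  have "coeff (gr \<phi>) k = 0" if "k \<ge> q" for k
    using that by (auto simp: gr_def coeff_sum intro!: sum.neutral)
  then have "degree (gr \<phi>) \<le> q - 1" by (intro degree_le) simp
  then show ?thesis using q_gt_3 by simp
qed

lemma gr_diff: "gr \<phi> - gr \<psi> = gr (\<lambda>a. \<phi> a - \<psi> a)"
  by (simp add: gr_def diff_monom[symmetric] sum_subtractf)

lemma gr_const_mult: "[:c:] * gr \<phi> = gr (\<lambda>a. c * \<phi> a)"
  unfolding gr_def sum_distrib_left by (simp add: smult_monom)

text \<open>\<open>gr\<close> produces polynomials of degree below \<open>q\<close>, while a nonzero
  multiple of the monic polynomial \<open>X ^ q - 1\<close> has degree at least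
  \<open>q\<close>.\<close>

lemma gcong_gr_imp_eq:
  assumes "gcong (gr \<phi>) (gr \<psi>)" "a < q"
  shows "\<phi> (int a) = \<psi> (int a)"
proof -
  let ?D = "gr (\<lambda>a. \<phi> a - \<psi> a)" and ?X = "monom 1 q - 1 :: eis poly"
  have lc: "degree ?X = q" "lead_coeff ?X = 1"
  proof -
    show d: "degree ?X = q"
      using q_gt_3 by (subst diff_conv_add_uminus, subst degree_add_eq_left) (auto simp: degree_monom_eq)
    show "lead_coeff ?X = 1" unfolding d using q_gt_3 by (simp add: coeff_1)
  qed
  obtain W where W: "?D = ?X * W"
    using assms(1) unfolding rng_cong_def gr_diff by (auto elim: dvdE)
  have "W = 0"
  proof (rule ccontr)
    assume "W \<noteq> 0"
    then have "coeff (?X * W) (degree ?X + degree W) \<noteq> 0"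
      unfolding coeff_mult_degree_sum lc(2) by simp
    then have "degree ?X + degree W \<le> degree ?D" unfolding W by (rule le_degree)
    then show False using degree_gr[of "\<lambda>a. \<phi> a - \<psi> a"] lc by simp
  qed
  then have "coeff ?D a = 0" using W by simp
  then show ?thesis using coeff_gr[OF assms(2)] by simp
qed

lemma gcong_gr_ex: "\<exists>\<delta>. gcong V (gr \<delta>)"
proof -
  define \<delta> where "\<delta> x = (\<Sum>i\<le>degree V. if x = int (i mod q) then coeff V i else 0)" for x :: int
  have "gcong (\<Sum>i\<le>degree V. monom (coeff V i) i) (\<Sum>i\<le>degree V. monom (coeff V i) (i mod q))"
    by (intro rng_cong_sum gcong_monom)
  moreover have "(\<Sum>i\<le>degree V. monom (coeff V i) (i mod q)) = gr \<delta>"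
  proof -
    have "monom (coeff V i) (i mod q)
        = (\<Sum>a<q. monom (if int a = int (i mod q) then coeff V i else 0) a)" for i
    proof -
      have "(\<Sum>a<q. monom (if int a = int (i mod q) then coeff V i else 0) a)
        = (\<Sum>a<q. if a = i mod q then monom (coeff V i) a else 0)"
        by (intro sum.cong) auto
      then show ?thesis using q_gt_3 by simp
    qed
    then have "(\<Sum>i\<le>degree V. monom (coeff V i) (i mod q))
        = (\<Sum>a<q. \<Sum>i\<le>degree V. monom (if int a = int (i mod q) then coeff V i else 0) a)"
      using sum.swap by fastforce
    then show ?thesis by (simp add: gr_def \<delta>_def monom_sum)
  qed
  ultimately show ?thesis by (metis poly_as_sum_of_monoms)
qed

text \<open>Extracts a divisibility of Eisenstein integers from a Frobenius congruence: once the
  unknown cofactor \<open>V\<close> is folded into the form \<open>gr\<close>, coefficients can be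
  compared.\<close>

lemma gcong_gr_imp_dvd:
  assumes "gcong (gr \<phi>) (of_nat p * V)" "a < q"
  shows "of_nat p dvd \<phi> (int a)"
proof -
  obtain \<delta> where "gcong V (gr \<delta>)" using gcong_gr_ex by blast
  then have "gcong (of_nat p * V) ([:of_nat p:] * gr \<delta>)"
    by (intro rng_cong_mult) (simp_all add: of_nat_poly)
  then have "gcong (gr \<phi>) (gr (\<lambda>a. of_nat p * \<delta> a))"
    using assms(1) rng_cong_trans unfolding gr_const_mult by blast
  from gcong_gr_imp_eq[OF this assms(2)] show ?thesis by simp
qed

lemma gr_mult:
  assumes "\<And>x. \<phi> (x mod int q) = \<phi> x" "\<And>x. \<psi> (x mod int q) = \<psi> x"
  shows "gcong (gr \<phi> * gr \<psi>) (gr (\<lambda>c. \<Sum>a<q. \<phi> (int a) * \<psi> (c - int a)))"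
proof -
  have "gr \<phi> * gr \<psi> = (\<Sum>a<q. \<Sum>b<q. monom (\<phi> (int a) * \<psi> (int b)) (a + b))"
    by (simp add: gr_def sum_product mult_monom)
  moreover have "gcong (\<Sum>a<q. \<Sum>b<q. monom (\<phi> (int a) * \<psi> (int b)) (a + b))
     (\<Sum>a<q. \<Sum>b<q. monom (\<phi> (int a) * \<psi> (int b)) ((a + b) mod q))"
    by (intro rng_cong_sum gcong_monom)
  moreover have "(\<Sum>b<q. monom (\<phi> (int a) * \<psi> (int b)) ((a + b) mod q))
     = (\<Sum>c<q. monom (\<phi> (int a) * \<psi> (int c - int a)) c)" for a
  proof -
    \<comment> \<open>With the exponent read modulo \<open>q\<close> the summand is periodic in
      \<open>x = a + b\<close>, so \<open>sum_affine\<close> can shift the inner sum.\<close>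
    define h where "h x = monom (\<phi> (int a) * \<psi> (x - int a)) (nat (x mod int q))" for x
    have "h (x mod int q) = h x" for x
      using assms(2)[of "x mod int q - int a"] assms(2)[of "x - int a"]
      by (simp add: h_def mod_diff_left_eq)
    then have "(\<Sum>b<q. h (1 * int b + int a)) = (\<Sum>b<q. h (int b))"
      using q_gt_3 by (intro sum_affine) auto
    moreover have "(\<Sum>b<q. h (1 * int b + int a))
        = (\<Sum>b<q. monom (\<phi> (int a) * \<psi> (int b)) ((a + b) mod q))"
      by (intro sum.cong) (simp_all add: h_def nat_mod_distrib nat_add_distrib add.commute)
    moreover have "(\<Sum>b<q. h (int b)) = (\<Sum>c<q. monom (\<phi> (int a) * \<psi> (int c - int a)) c)"
      by (intro sum.cong) (simp_all add: h_def)
    ultimately show ?thesis by simp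
  qed
  ultimately have "gcong (gr \<phi> * gr \<psi>) (\<Sum>a<q. \<Sum>c<q. monom (\<phi> (int a) * \<psi> (int c - int a)) c)"
    by simp
  then show ?thesis by (subst (asm) sum.swap) (simp add: gr_def monom_sum)
qed

text \<open>Modulo \<open>p\<close>, the \<open>p\<close>-th power raises coefficients to the power
  \<open>p\<close> and multiplies exponents by \<open>p\<close>. The relabelling of exponents is a
  bijection because \<open>p \<noteq> q\<close>, and the condition on \<open>\<psi>\<close> absorbs
  it.\<close>

lemma gr_frobenius:
  assumes "prime p" "p \<noteq> q" "\<And>x. \<psi> (x mod int q) = \<psi> x"
    and "\<And>a. \<phi> a ^ p = \<psi> (int p * a)"
  obtains V where "gcong (gr \<phi> ^ p) (gr \<psi> + of_nat p * V)"
proof -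
  have "of_nat p dvd gr \<phi> ^ p - (\<Sum>a<q. monom (\<phi> (int a)) a ^ p)"
    unfolding gr_def by (rule prime_dvd_power_sum[OF assms(1)])
  then obtain V where V: "gr \<phi> ^ p - (\<Sum>a<q. monom (\<phi> (int a)) a ^ p) = of_nat p * V" by (elim dvdE)
  define h where "h x = monom (\<psi> x) (nat (x mod int q))" for x
  have "\<not> int q dvd int p"
    using assms(1,2) prime_q by (simp add: primes_dvd_imp_eq) (metis primes_dvd_imp_eq)
  then have "(\<Sum>b<q. h (int p * int b + 0)) = (\<Sum>b<q. h (int b))"
    using assms(3) by (intro sum_affine) (auto simp: h_def)
  then have h: "(\<Sum>a<q. h (int p * int a)) = gr \<psi>"
    by (simp add: gr_def) (simp add: h_def)
  have "gcong (\<Sum>a<q. monom (\<phi> (int a)) a ^ p) (\<Sum>a<q. h (int p * int a))"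
  proof (rule rng_cong_sum)
    fix a
    have "monom (\<phi> (int a)) a ^ p = monom (\<psi> (int p * int a)) (a * p)"
      by (simp add: monom_power assms(4))
    moreover have "h (int p * int a) = monom (\<psi> (int p * int a)) ((a * p) mod q)"
      unfolding h_def by (metis mult.commute nat_int of_nat_mod of_nat_mult)
    ultimately show "gcong (monom (\<phi> (int a)) a ^ p) (h (int p * int a))"
      using gcong_monom by simp
  qed
  then have "gcong ((\<Sum>a<q. monom (\<phi> (int a)) a ^ p) + of_nat p * V) (gr \<psi> + of_nat p * V)"
    unfolding h by (intro rng_cong_add) simp_all
  moreover have "(\<Sum>a<q. monom (\<phi> (int a)) a ^ p) + of_nat p * V = gr \<phi> ^ p"
    using V by (simp add: algebra_simps)
  ultimately show ?thesis using that by simp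
qed

end

subsection \<open>Gauss and Jacobi sums\<close>

context cubic_character
begin

definition jac :: eis where "jac = (\<Sum>a<q. chi (int a) * chi (1 - int a))"

lemma chi_cong: "[a = b] (mod int q) \<Longrightarrow> chi a = chi b"
  unfolding cong_def by (metis chi_mod)

lemma chi_diff_mod [simp]: "chi (c - x mod int q) = chi (c - x)"
  by (rule chi_cong) (simp add: cong_def mod_diff_right_eq)

lemma chi_diff_dvd: "int q dvd c \<Longrightarrow> chi (c - a) = chi a"
  using chi_cong[of "c - a" "- a"] by (simp add: cong_iff_dvd_diff)

text \<open>The substitution \<open>a \<mapsto> c * a\<close> pulls out \<open>chi c ^ 2\<close> and
  leaves the Jacobi sum. If \<open>q\<close> divides \<open>c\<close>, the sum collapses to that of
  \<open>chi a ^ 2\<close>, since \<open>chi (- 1) = 1\<close>.\<close>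

lemma chi_convolution: "(\<Sum>a<q. chi (int a) * chi (c - int a)) = jac * chi c ^ 2"
proof (cases "int q dvd c")
  case True
  then show ?thesis using chi_sum2 by (simp add: chi_diff_dvd chi_eq_0 power2_eq_square)
next
  case False
  have "(\<Sum>a<q. chi (int a) * chi (c - int a)) = (\<Sum>a<q. chi (c * int a + 0) * chi (c - (c * int a + 0)))"
    by (rule sum_affine[symmetric, OF False]) simp
  also have "\<dots> = (\<Sum>a<q. (chi c * chi (int a)) * (chi c * chi (1 - int a)))"
    by (intro sum.cong refl) (simp add: chi_mult[symmetric] algebra_simps)
  also have "\<dots> = jac * chi c ^ 2"
    by (simp add: jac_def sum_distrib_left sum_distrib_right power2_eq_square algebra_simps)
  finally show ?thesis .
qed

lemma chi2_convolution: "(\<Sum>a<q. chi (int a) ^ 2 * chi (c - int a) ^ 2) = eis_cnj jac * chi c"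
  using arg_cong[OF chi_convolution[of c], of eis_cnj]
  by (simp add: eis_cnj_sum eis_cnj_chi flip: power_mult) (simp add: chi_power4)

text \<open>The coefficients of \<open>q - (1 + X + \<dots> + X ^ (q - 1))\<close>, the product of the two Gauss sums.\<close>

definition kap :: "int \<Rightarrow> eis" where
  "kap c = (if int q dvd c then of_nat q else 0) - 1"

lemma sum_dvd_only_0:
  fixes f :: "nat \<Rightarrow> eis"
  shows "(\<Sum>a<q. (if q dvd a then f a else 0)) = f 0"
proof -
  have "(\<Sum>a<q. (if q dvd a then f a else 0)) = (\<Sum>a<q. if a = 0 then f a else 0)"
    by (intro sum.cong) (auto dest: nat_dvd_not_less)
  then show ?thesis using q_gt_3 by simp
qed

lemma chi_chi2_convolution: "(\<Sum>a<q. chi (int a) * chi (c - int a) ^ 2) = kap c"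
proof -
  define F where "F c = (\<Sum>a<q. chi (int a) * chi (c - int a) ^ 2)" for c
  define E where "E = F 1"
  have F0: "F c = of_nat q - 1" if "int q dvd c" for c
  proof -
    have "F c = (\<Sum>a<q. 1 - (if int q dvd int a then 1 else 0))"
      unfolding F_def chi_diff_dvd[OF that]
    proof (intro sum.cong refl)
      fix a
      show "chi (int a) * chi (int a) ^ 2 = 1 - (if int q dvd int a then 1 else 0)"
        using chi_cube[of "int a"] by (auto simp: chi_eq_0 power3_eq_cube power2_eq_square mult.assoc)
    qed
    then show ?thesis by (simp add: sum_subtractf sum_dvd_only_0)
  qed
  have F1: "F c = E" if c: "\<not> int q dvd c" for c
  proof -
    have "F c = (\<Sum>a<q. chi (c * int a + 0) * chi (c - (c * int a + 0)) ^ 2)"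
      unfolding F_def by (rule sum_affine[symmetric, OF c]) simp
    also have "\<dots> = (\<Sum>a<q. (chi c * chi (int a)) * (chi c * chi (1 - int a)) ^ 2)"
      by (intro sum.cong refl) (simp add: chi_mult[symmetric] algebra_simps)
    also have "\<dots> = (\<Sum>a<q. chi c ^ 3 * (chi (int a) * chi (1 - int a) ^ 2))"
      by (intro sum.cong refl) (simp add: power3_eq_cube power2_eq_square algebra_simps)
    finally show ?thesis by (simp add: chi_cube[OF c] E_def F_def)
  qed
  \<comment> \<open>The constant \<open>E\<close> is found by summing \<open>F\<close> over all residues.\<close>
  have "(\<Sum>c<q. F (int c)) = (\<Sum>a<q. chi (int a) * (\<Sum>c<q. chi (1 * int c + (- int a)) ^ 2))"
    unfolding F_def by (subst sum.swap) (simp add: sum_distrib_left)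
  also have "\<dots> = (\<Sum>a<q. chi (int a) * (\<Sum>c<q. chi (int c) ^ 2))"
    using q_gt_3 by (intro sum.cong refl arg_cong2[where f = "(*)"] sum_affine) auto
  also have "\<dots> = 0" by (simp add: chi_sum2)
  finally have "0 = (\<Sum>c<q. F (int c))" ..
  also have "\<dots> = (\<Sum>c<q. E + (if int q dvd int c then of_nat q - 1 - E else 0))"
    by (intro sum.cong refl) (simp add: F0 F1)
  also have "\<dots> = of_nat q * E + (of_nat q - 1 - E)"
    by (simp add: sum.distrib sum_dvd_only_0)
  finally have eq: "of_nat q * E + (of_nat q - 1 - E) = 0" ..
  have "(int q - 1) * (eis_re E + 1) = 0" "(int q - 1) * eis_om E = 0"
    using arg_cong[OF eq, of eis_re] arg_cong[OF eq, of eis_om] by (simp_all add: algebra_simps)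
  then have "E = - 1" using q_gt_3 by (intro eis.expand) auto
  then show ?thesis using F0 F1 by (auto simp: kap_def F_def[symmetric])
qed

lemma kap_mod [simp]: "kap (x mod int q) = kap x"
  by (simp add: kap_def dvd_mod_iff)

lemma kap_sum: "(\<Sum>a<q. kap (int a)) = 0"
  unfolding kap_def by (simp add: sum_subtractf sum_dvd_only_0)

text \<open>The element \<open>1 + X + ... + X ^ (q - 1)\<close> annihilates everything with
  coefficient sum \<open>0\<close>, so there \<open>kap\<close> acts as the scalar
  \<open>q\<close>.\<close>

lemma gr_kap_mult:
  assumes "\<And>x. \<psi> (x mod int q) = \<psi> x" "(\<Sum>a<q. \<psi> (int a)) = 0"
  shows "gcong (gr kap * gr \<psi>) ([:of_nat q:] * gr \<psi>)"
proof -
  have "(\<Sum>a<q. kap (int a) * \<psi> (c - int a)) = of_nat q * \<psi> c" for c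
  proof -
    have "(\<Sum>a<q. \<psi> ((-1) * int a + c)) = 0"
      using q_gt_3 assms by (subst sum_affine) auto
    then have "(\<Sum>a<q. \<psi> (c - int a)) = 0" by simp
    moreover have "(\<Sum>a<q. kap (int a) * \<psi> (c - int a))
      = (\<Sum>a<q. (if int q dvd int a then of_nat q * \<psi> (c - int a) else 0)) - (\<Sum>a<q. \<psi> (c - int a))"
      unfolding sum_subtractf[symmetric] by (intro sum.cong refl) (simp add: kap_def algebra_simps)
    ultimately show ?thesis by (simp add: sum_dvd_only_0)
  qed
  then show ?thesis using gr_mult[of kap \<psi>] assms(1) by (simp add: gr_const_mult del: mult_pCons_left)
qed

lemma gr_chi_mult_chi: "gcong (gr chi * gr chi) ([:jac:] * gr (\<lambda>a. chi a ^ 2))"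
  using gr_mult[of chi chi] by (simp add: gr_const_mult chi_convolution del: mult_pCons_left)

lemma gr_chi2_mult_chi2:
  "gcong (gr (\<lambda>a. chi a ^ 2) * gr (\<lambda>a. chi a ^ 2)) ([:eis_cnj jac:] * gr chi)"
  using gr_mult[of "\<lambda>a. chi a ^ 2" "\<lambda>a. chi a ^ 2"]
  by (simp add: gr_const_mult chi2_convolution del: mult_pCons_left)

lemma gr_chi_mult_chi2: "gcong (gr chi * gr (\<lambda>a. chi a ^ 2)) (gr kap)"
  using gr_mult[of chi "\<lambda>a. chi a ^ 2"] by (simp add: chi_chi2_convolution)

lemma kap_1 [simp]: "kap 1 = - 1"
  using q_gt_3 by (simp add: kap_def)

text \<open>Two groupings of \<open>g\<^sup>2 h\<^sup>2\<close>, where \<open>g\<close> and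
  \<open>h\<close> are the Gauss sums of \<open>chi\<close> and of its square:
  \<open>(g g) (h h)\<close> gives \<open>jac * eis_cnj jac\<close> times \<open>kap\<close>, and
  \<open>(g h) (g h)\<close> gives \<open>q\<close> times \<open>kap\<close>. The coefficient at
  \<open>1\<close> is then compared.\<close>

lemma jac_norm: "jac * eis_cnj jac = of_nat q"
proof -
  let ?g = "gr chi" and ?h = "gr (\<lambda>a. chi a ^ 2)"
  have "gcong ((?g * ?g) * (?h * ?h)) (([:jac:] * ?h) * ([:eis_cnj jac:] * ?g))"
    by (intro rng_cong_mult gr_chi_mult_chi gr_chi2_mult_chi2)
  also have "([:jac:] * ?h) * ([:eis_cnj jac:] * ?g) = [:jac * eis_cnj jac:] * (?g * ?h)"
    by (simp add: mult_ac)
  also have "gcong \<dots> ([:jac * eis_cnj jac:] * gr kap)"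
    by (intro rng_cong_mult gr_chi_mult_chi2) simp
  finally have 1: "gcong ((?g * ?g) * (?h * ?h)) ([:jac * eis_cnj jac:] * gr kap)" .
  have "gcong ((?g * ?h) * (?g * ?h)) (gr kap * gr kap)"
    by (intro rng_cong_mult gr_chi_mult_chi2)
  then have "gcong ((?g * ?h) * (?g * ?h)) ([:of_nat q:] * gr kap)"
    by (rule rng_cong_trans[OF _ gr_kap_mult[OF kap_mod kap_sum]])
  moreover have "(?g * ?h) * (?g * ?h) = (?g * ?g) * (?h * ?h)" by (simp add: mult_ac)
  ultimately have "gcong ((?g * ?g) * (?h * ?h)) ([:of_nat q:] * gr kap)" by simp
  from rng_cong_trans[OF rng_cong_sym[OF 1] this]
  have "gcong (gr (\<lambda>a. jac * eis_cnj jac * kap a)) (gr (\<lambda>a. of_nat q * kap a))"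
    unfolding gr_const_mult .
  from gcong_gr_imp_eq[OF this, of 1] q_gt_3 show ?thesis by simp
qed

lemma gr_chi_power3: "gcong (gr chi ^ 3) ([:jac:] * gr kap)"
proof -
  have "gcong (gr chi * (gr chi * gr chi)) (gr chi * ([:jac:] * gr (\<lambda>a. chi a ^ 2)))"
    by (intro rng_cong_mult gr_chi_mult_chi) simp
  also have "gr chi * ([:jac:] * gr (\<lambda>a. chi a ^ 2)) = [:jac:] * (gr chi * gr (\<lambda>a. chi a ^ 2))"
    by (simp only: mult_ac)
  also have "gcong \<dots> ([:jac:] * gr kap)"
    by (intro rng_cong_mult gr_chi_mult_chi2) simp
  finally show ?thesis by (simp add: power3_eq_cube mult.assoc)
qed

text \<open>The exponent is \<open>3 * j + 1\<close> because \<open>kap\<close> becomes the scalar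
  \<open>q\<close> only next to a factor with coefficient sum \<open>0\<close>; the last
  \<open>gr chi\<close> is that factor.\<close>

lemma gr_chi_power: "gcong (gr chi ^ (3 * j + 1)) ([:(of_nat q * jac) ^ j:] * gr chi)"
proof (induction j)
  case (Suc j)
  have "gr chi ^ (3 * Suc j + 1) = gr chi ^ (3 * j + 1) * gr chi ^ 3"
    by (simp add: power_add[symmetric] del: power_Suc)
  also have "gcong \<dots> (([:(of_nat q * jac) ^ j:] * gr chi) * ([:jac:] * gr kap))"
    by (intro rng_cong_mult Suc gr_chi_power3)
  also have "([:(of_nat q * jac) ^ j:] * gr chi) * ([:jac:] * gr kap)
      = ([:(of_nat q * jac) ^ j:] * [:jac:]) * (gr kap * gr chi)"
    by (simp only: mult_ac)
  also have "gcong \<dots> (([:(of_nat q * jac) ^ j:] * [:jac:]) * ([:of_nat q:] * gr chi))"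
    by (intro rng_cong_mult gr_kap_mult chi_sum) simp_all
  also have "\<dots> = [:(of_nat q * jac) ^ Suc j:] * gr chi"
    by (simp add: mult_ac)
  finally show ?case .
qed simp

text \<open>This is the Frobenius comparison at the prime \<open>3\<close>.\<close>

lemma jac_mod_3: "3 dvd jac + 1"
proof -
  define \<psi> where "\<psi> x = (if int q dvd x then 0 else (1::eis))" for x
  have q3: "\<not> int q dvd 3 * a \<longleftrightarrow> \<not> int q dvd a" for a
    using prime_int_q not_q_dvd_3 by (auto simp: prime_dvd_mult_iff)
  obtain V where "gcong (gr chi ^ 3) (gr \<psi> + of_nat 3 * V)"
  proof (rule gr_frobenius[of 3 \<psi> chi])
    show "3 \<noteq> q" using q_gt_3 by simp
    show "chi a ^ 3 = \<psi> (int 3 * a)" for a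
      using q3[of a] chi_cube[of a] by (auto simp: \<psi>_def chi_eq_0)
  qed (auto simp: \<psi>_def dvd_mod_iff)
  from rng_cong_diff[OF rng_cong_trans[OF rng_cong_sym[OF gr_chi_power3] this] rng_cong_refl[of _ "gr \<psi>"]]
  have "gcong (gr (\<lambda>a. jac * kap a - \<psi> a)) (of_nat 3 * V)"
    by (simp only: gr_const_mult gr_diff add_diff_cancel_left')
  \<comment> \<open>The coefficient at \<open>1\<close> is \<open>jac * kap 1 - 1\<close> with
    \<open>kap 1 = - 1\<close>.\<close>
  from gcong_gr_imp_dvd[OF this, of 1] have "3 dvd - jac - 1"
    using q_gt_3 by (simp add: \<psi>_def)
  then show ?thesis using dvd_minus_iff[of 3 "jac + 1"] by simp
qed

text \<open>Modulo \<open>q\<close> the Jacobi sum is a combination of power sums with exponents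
  from \<open>(q - 1) / 3\<close> to \<open>2 (q - 1) / 3\<close>, all below \<open>q - 1\<close>.
  So \<open>jac\<close> lies in the prime above \<open>q\<close> selected by \<open>t\<close>, which
  tells it from its conjugate.\<close>

lemma jac_eval: "int q dvd eis_eval t jac"
proof -
  let ?f = "(q - 1) div 3"
  have "[eis_eval t jac = (\<Sum>a<q. int a ^ ?f * (1 - int a) ^ ?f)] (mod int q)"
    unfolding jac_def eis_eval_sum
    by (intro cong_sum cong_trans[OF eis_eval_mult[OF t_root] cong_mult[OF chi_eval chi_eval]])
  also have "(\<Sum>a<q. int a ^ ?f * (1 - int a) ^ ?f)
     = (\<Sum>a<q. \<Sum>k\<le>?f. of_nat (?f choose k) * (-1) ^ k * int a ^ (?f + k))"
  proof (intro sum.cong refl)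
    fix a
    have "(1 - int a) ^ ?f = (\<Sum>k\<le>?f. of_nat (?f choose k) * (- int a) ^ k)"
      using binomial_ring[of "- int a" 1 ?f] by simp
    then show "int a ^ ?f * (1 - int a) ^ ?f
       = (\<Sum>k\<le>?f. of_nat (?f choose k) * (-1) ^ k * int a ^ (?f + k))"
      by (simp only: sum_distrib_left power_add) (intro sum.cong refl, simp add: power_minus[of "int a"])
  qed
  also have "\<dots> = (\<Sum>k\<le>?f. of_nat (?f choose k) * (-1) ^ k * (\<Sum>a<q. int a ^ (?f + k)))"
    by (subst sum.swap) (simp add: sum_distrib_left)
  finally have c: "[eis_eval t jac
      = (\<Sum>k\<le>?f. of_nat (?f choose k) * (-1) ^ k * (\<Sum>a<q. int a ^ (?f + k)))] (mod int q)" .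
  have "int q dvd (\<Sum>k\<le>?f. of_nat (?f choose k) * (-1) ^ k * (\<Sum>a<q. int a ^ (?f + k)))"
  proof (rule dvd_sum)
    fix k assume "k \<in> {..?f}"
    then have "?f + k < q - 1" using three_dvd q_gt_3 by simp
    then show "int q dvd of_nat (?f choose k) * (-1) ^ k * (\<Sum>a<q. int a ^ (?f + k))"
      by (intro dvd_mult prime_dvd_sum_power[OF prime_q])
  qed
  then show ?thesis using c cong_dvd_iff by blast
qed

text \<open>Here \<open>chi a ^ p = chi a\<close>, and the rescaling of exponents by
  \<open>p\<close> costs the inverse of \<open>chi p\<close>, which is \<open>chi p ^ 2\<close>. The
  same power of the Gauss sum is evaluated by \<open>gr_chi_power\<close>.\<close>

lemma jac_frobenius1:
  assumes "prime p" "p \<noteq> q" "p = 3 * j + 1"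
  shows "of_nat p dvd (of_nat q * jac) ^ j - chi (int p) ^ 2"
proof -
  have qp: "\<not> int q dvd int p" using assms prime_q by (metis int_dvd_int_iff primes_dvd_imp_eq)
  obtain V where V: "gcong (gr chi ^ p) (gr (\<lambda>x. chi (int p) ^ 2 * chi x) + of_nat p * V)"
  proof (rule gr_frobenius[of p "\<lambda>x. chi (int p) ^ 2 * chi x" chi])
    fix a
    have "chi a ^ p = chi a"
    proof (cases "int q dvd a")
      case False
      then show ?thesis using chi_cube[OF False] by (simp add: assms(3) power_mult)
    qed (simp add: chi_eq_0 assms(3))
    moreover have "chi (int p) ^ 2 * chi (int p * a) = chi (int p) ^ 3 * chi a"
      by (simp add: chi_mult power2_eq_square power3_eq_cube mult_ac)
    ultimately show "chi a ^ p = chi (int p) ^ 2 * chi (int p * a)"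
      using chi_cube[OF qp] by simp
  qed (use assms in auto)
  have "gcong (gr chi ^ p) ([:(of_nat q * jac) ^ j:] * gr chi)"
    unfolding assms(3) by (rule gr_chi_power)
  from rng_cong_diff[OF rng_cong_trans[OF rng_cong_sym[OF this] V] rng_cong_refl[of _ "gr (\<lambda>x. chi (int p) ^ 2 * chi x)"]]
  have "gcong (gr (\<lambda>a. (of_nat q * jac) ^ j * chi a - chi (int p) ^ 2 * chi a)) (of_nat p * V)"
    by (simp only: gr_const_mult gr_diff add_diff_cancel_left')
  from gcong_gr_imp_dvd[OF this, of 1] show ?thesis using q_gt_3 by simp
qed

text \<open>Now \<open>chi a ^ p = chi a ^ 2\<close>, so Frobenius carries the Gauss sum to
  \<open>chi p\<close> times that of the squared character. The power has one more factor
  \<open>gr chi\<close> than in \<open>gr_chi_power\<close>, and it supplies the extra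
  \<open>jac\<close>.\<close>

lemma jac_frobenius2:
  assumes "prime p" "p \<noteq> q" "p = 3 * j + 2"
  shows "of_nat p dvd (of_nat q * jac) ^ j * jac - chi (int p)"
proof -
  have qp: "\<not> int q dvd int p" using assms prime_q by (metis int_dvd_int_iff primes_dvd_imp_eq)
  obtain V where V: "gcong (gr chi ^ p) (gr (\<lambda>x. chi (int p) * chi x ^ 2) + of_nat p * V)"
  proof (rule gr_frobenius[of p "\<lambda>x. chi (int p) * chi x ^ 2" chi])
    fix a
    have "chi a ^ p = chi a ^ 2"
    proof (cases "int q dvd a")
      case False
      then show ?thesis using chi_cube[OF False]
        by (simp add: assms(3) power_mult power_add del: power_Suc power_Suc2 add_2_eq_Suc' add_2_eq_Suc)
    qed (simp add: chi_eq_0 assms(3))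
    moreover have "chi (int p) * chi (int p * a) ^ 2 = chi (int p) ^ 3 * chi a ^ 2"
      by (simp add: chi_mult power2_eq_square power3_eq_cube mult_ac)
    ultimately show "chi a ^ p = chi (int p) * chi (int p * a) ^ 2"
      using chi_cube[OF qp] by simp
  qed (use assms in auto)
  have "gr chi ^ p = gr chi ^ (3 * j + 1) * gr chi"
    by (simp add: assms(3))
  also have "gcong \<dots> (([:(of_nat q * jac) ^ j:] * gr chi) * gr chi)"
    by (intro rng_cong_mult gr_chi_power rng_cong_refl)
  also have "([:(of_nat q * jac) ^ j:] * gr chi) * gr chi = [:(of_nat q * jac) ^ j:] * (gr chi * gr chi)"
    by (simp only: mult_ac)
  also have "gcong \<dots> ([:(of_nat q * jac) ^ j:] * ([:jac:] * gr (\<lambda>a. chi a ^ 2)))"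
    by (intro rng_cong_mult gr_chi_mult_chi rng_cong_refl)
  finally have "gcong (gr chi ^ p) ([:(of_nat q * jac) ^ j:] * ([:jac:] * gr (\<lambda>a. chi a ^ 2)))" .
  from rng_cong_diff[OF rng_cong_trans[OF rng_cong_sym[OF this] V] rng_cong_refl[of _ "gr (\<lambda>x. chi (int p) * chi x ^ 2)"]]
  have "gcong (gr (\<lambda>a. (of_nat q * jac) ^ j * (jac * chi a ^ 2) - chi (int p) * chi a ^ 2)) (of_nat p * V)"
    by (simp only: gr_const_mult gr_diff add_diff_cancel_left')
  from gcong_gr_imp_dvd[OF this, of 1] show ?thesis using q_gt_3 by simp
qed

end

subsection \<open>Cubic reciprocity for rational primes\<close>

lemma eis_power_prime:
  assumes "prime p"
  shows "rng_cong (of_nat p) (x ^ p :: eis) (of_int (eis_re x) + of_int (eis_om x) * eis_w ^ p)"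
proof -
  have fermat: "rng_cong (of_nat p) (of_int a ^ p) (of_int a :: eis)" for a
  proof -
    have "int p dvd a ^ p - a"
    proof (cases "int p dvd a")
      case True
      then show ?thesis using prime_gt_0_nat[OF assms] by (simp add: dvd_power dvd_trans[of _ a] dvd_diff)
    next
      case False
      have "a ^ p - a = a * (a ^ (p - 1) - 1)"
        using prime_gt_0_nat[OF assms] by (simp add: algebra_simps power_eq_if)
      then show ?thesis
        using fermat_theorem_int[OF assms False] by (simp add: cong_iff_dvd_diff)
    qed
    then have "(of_int (int p) :: eis) dvd of_int (a ^ p - a)" by (metis dvd_def of_int_mult)
    then show ?thesis by (simp add: rng_cong_def)
  qed
  let ?a = "of_int (eis_re x) :: eis" and ?b = "of_int (eis_om x) :: eis"
  have "rng_cong (of_nat p) ((?a + ?b * eis_w) ^ p) (?a ^ p + (?b * eis_w) ^ p)"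
    unfolding rng_cong_def by (rule prime_dvd_power_add[OF assms])
  also have "rng_cong (of_nat p) (?a ^ p + (?b * eis_w) ^ p) (?a + ?b * eis_w ^ p)"
    unfolding power_mult_distrib by (intro rng_cong_add rng_cong_mult fermat) simp
  finally show ?thesis using eis_eq_of_int_w[of x] by simp
qed

lemma eis_power_prime_split:
  assumes "prime p" "p = 3 * j + 1"
  shows "rng_cong (of_nat p) (x ^ p) (x :: eis)"
proof -
  have "eis_w ^ p = eis_w" by (simp add: assms(2) power_mult)
  then show ?thesis using eis_power_prime[OF assms(1), of x] eis_eq_of_int_w[of x] by simp
qed

lemma eis_power_prime_inert:
  assumes "prime p" "p = 3 * j + 2"
  shows "rng_cong (of_nat p) (x ^ p) (eis_cnj x)"
proof -
  have "eis_w ^ p = eis_w\<^sup>2" by (simp add: assms(2) power_mult power2_eq_square)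
  then show ?thesis
    using eis_power_prime[OF assms(1), of x] arg_cong[OF eis_eq_of_int_w[of x], of eis_cnj] by simp
qed

lemma rng_cong_cancel_of_int:
  assumes "prime p" "\<not> int p dvd n" "rng_cong (of_nat p) (of_int n * x) (of_int n * y :: eis)"
  shows "rng_cong (of_nat p) x y"
proof -
  have "(of_nat p :: eis) dvd of_int n * (x - y)"
    using assms(3) by (simp add: rng_cong_def algebra_simps)
  then show ?thesis
    unfolding rng_cong_def of_nat_dvd_eis_iff using assms(1,2) by (simp add: prime_dvd_mult_iff)
qed

lemma rng_cong_of_int: "[a = b] (mod int p) \<Longrightarrow> rng_cong (of_nat p) (of_int a) (of_int b :: eis)"
  by (simp add: rng_cong_def of_nat_dvd_eis_iff cong_iff_dvd_diff)

lemma rng_cong_cnj: "rng_cong (of_nat p) x y \<Longrightarrow> rng_cong (of_nat p) (eis_cnj x) (eis_cnj y)"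
  unfolding rng_cong_def eis_cnj_hom(6)[symmetric] dvd_def
  by (metis eis_cnj_hom(3,7))

lemma euler_criterion_int:
  assumes "prime p" "p = 2 * N + 1"
  shows "[Legendre a (int p) = a ^ N] (mod int p)"
proof -
  have "2 < p" using assms prime_ge_2_nat[OF assms(1)] by presburger
  then show ?thesis using euler_criterion[OF assms(1), of a] assms(2) by simp
qed

text \<open>The value of \<open>(3 / p)\<close>, by Frobenius on \<open>1 + 2 \<omega>\<close>, a
  square root of \<open>-3\<close>: its \<open>p\<close>-th power is \<open>(-3) ^ N\<close> times
  itself, and Frobenius fixes or negates it according to \<open>p\<close> modulo
  \<open>3\<close>.\<close>

lemma three_power_half:
  assumes "prime p" "p = 2 * N + 1" "p = 6 * h + 1 \<or> p + 1 = 6 * h"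
  shows "[3 ^ N = (-1) ^ h] (mod int p)"
proof -
  define \<theta> :: eis where "\<theta> = Eis 1 2"
  have sq: "\<theta>\<^sup>2 = - 3" by (rule eis.expand) (simp add: \<theta>_def power2_eq_square)
  have "\<theta> ^ p = \<theta> * of_int ((-3) ^ N)"
    by (simp add: assms(2) power_mult sq)
  moreover have "rng_cong (of_nat p) (\<theta> ^ p) (of_int ((-1) ^ (h + N)) * \<theta>)"
    using assms(3)
  proof
    assume p: "p = 6 * h + 1"
    then have "N = 3 * h" using assms(2) by simp
    then have e: "even (h + N)" by simp
    have "rng_cong (of_nat p) (\<theta> ^ p) \<theta>"
      using p by (intro eis_power_prime_split[OF assms(1), of "2 * h"]) simp
    then show ?thesis using e by simp
  next
    assume p: "p + 1 = 6 * h"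
    then have "N + 1 = 3 * h" using assms(2) by simp
    then have "odd (h + N)" by presburger
    moreover have "eis_cnj \<theta> = - \<theta>" by (rule eis.expand) (simp add: \<theta>_def)
    moreover have "rng_cong (of_nat p) (\<theta> ^ p) (eis_cnj \<theta>)"
      using p by (intro eis_power_prime_inert[OF assms(1), of "2 * h - 1"]) simp
    ultimately show ?thesis by simp
  qed
  ultimately have *: "rng_cong (of_nat p) (\<theta> * of_int ((-3) ^ N)) (of_int ((-1) ^ (h + N)) * \<theta>)"
    by simp
  have "int p dvd u - v" if "rng_cong (of_nat p) (\<theta> * of_int u) (of_int v * \<theta>)" for u v
    using that by (simp add: rng_cong_def of_nat_dvd_eis_iff \<theta>_def)
  from this[OF *] have "int p dvd (-3) ^ N - (-1) ^ (h + N)" .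
  moreover have "(-3 :: int) ^ N - (-1) ^ (h + N) = (-1) ^ N * (3 ^ N - (-1) ^ h)"
    by (simp add: power_minus[of 3] power_add algebra_simps)
  ultimately have "int p dvd (-1) ^ N * (3 ^ N - (-1) ^ h)" by simp
  then have "int p dvd 3 ^ N - (-1) ^ h" by (cases "even N") (simp_all add: dvd_diff_commute)
  then show ?thesis by (simp add: cong_iff_dvd_diff)
qed

context cubic_character
begin

text \<open>The last assumption selects \<open>J\<close> among the conjugate elements of norm \<open>q\<close>.\<close>

lemma jac_eq:
  assumes LM: "4 * int q = L\<^sup>2 + 27 * M\<^sup>2" and L: "[L = 1] (mod 3)" "L \<noteq> 0"
    and t: "int q dvd 6 * M * t + L + 3 * M"
  shows "eis_om jac = 3 * M" "2 * eis_re jac - eis_om jac = L"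
proof -
  define A B where "A = eis_re jac" and "B = eis_om jac"
  have "of_int 3 dvd jac + 1" using jac_mod_3 by simp
  then have AB3: "3 dvd A + 1" "3 dvd B"
    unfolding of_int_dvd_eis_iff by (simp_all add: A_def B_def)
  then obtain M' where M': "B = 3 * M'" by (elim dvdE)
  define L' where "L' = 2 * A - B"
  have L'3: "[L' = 1] (mod 3)"
    unfolding cong_iff_dvd_diff L'_def using AB3 by presburger
  have "A\<^sup>2 - A * B + B\<^sup>2 = int q"
    using arg_cong[OF jac_norm, of eis_re]
    by (simp add: A_def B_def power2_eq_square algebra_simps)
  then have LM': "4 * int q = L'\<^sup>2 + 27 * M'\<^sup>2"
    by (simp add: L'_def M' power2_eq_square algebra_simps)
  have "int q dvd 2 * (A + B * t)"
    by (rule dvd_mult) (use jac_eval in \<open>simp add: eis_eval_def A_def B_def\<close>)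
  then have t': "int q dvd L' + 3 * M' * (2 * t + 1)"
    by (simp add: L'_def M' algebra_simps)
  have "int q dvd M * (L' + 3 * M' * (2 * t + 1)) - M' * (6 * M * t + L + 3 * M)"
    by (intro dvd_diff dvd_mult t t')
  then have "int q dvd L' * M - L * M'" by (simp add: algebra_simps)
  then obtain k where k: "L' * M - L * M' = int q * k" by (elim dvdE)
  define Y where "Y = L * L' + 27 * M * M'"
  \<comment> \<open>Brahmagupta's identity for the form \<open>x\<^sup>2 + 27 y\<^sup>2\<close>. The
    cross term is \<open>q k\<close>, and \<open>27 > 16\<close> forces \<open>k = 0\<close>, so
    \<open>(L', M')\<close> is proportional to \<open>(L, M)\<close>.\<close>
  have "Y\<^sup>2 + 27 * (L' * M - L * M')\<^sup>2 = (L\<^sup>2 + 27 * M\<^sup>2) * (L'\<^sup>2 + 27 * M'\<^sup>2)"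
    by (simp add: Y_def power2_eq_square algebra_simps)
  then have Y: "Y\<^sup>2 + 27 * (int q * k)\<^sup>2 = 16 * (int q)\<^sup>2"
    unfolding k LM[symmetric] LM'[symmetric] by (simp add: power2_eq_square)
  have q0: "(int q)\<^sup>2 > 0" using q_gt_3 by simp
  have "k = 0"
  proof (rule ccontr)
    assume "k \<noteq> 0"
    then have "k\<^sup>2 \<ge> 1" by (metis power2_eq_square zero_less_mult_pos zero_less_power2 int_one_le_iff_zero_less)
    then have "(int q)\<^sup>2 * k\<^sup>2 \<ge> (int q)\<^sup>2 * 1" using q0 by (intro mult_left_mono) auto
    moreover have "27 * ((int q)\<^sup>2 * k\<^sup>2) \<le> 16 * (int q)\<^sup>2"
      using Y zero_le_power2[of Y] unfolding power_mult_distrib by linarith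
    ultimately show False using q0 by linarith
  qed
  then have X0: "L' * M = L * M'" and Y2: "Y\<^sup>2 = (4 * int q)\<^sup>2"
    using k Y by (auto simp: power_mult_distrib)
  have "L' * (4 * int q) = L * Y"
  proof -
    have "L' * (4 * int q) = L' * L\<^sup>2 + 27 * M * (L' * M)"
      unfolding LM by (simp add: power2_eq_square algebra_simps)
    also have "\<dots> = L * Y" unfolding X0 by (simp add: Y_def power2_eq_square algebra_simps)
    finally show ?thesis .
  qed
  moreover have "Y = 4 * int q \<or> Y = - (4 * int q)" using Y2 power2_eq_iff by blast
  ultimately have "L' * (4 * int q) = L * (4 * int q) \<or> L' * (4 * int q) = (- L) * (4 * int q)" by auto
  then have "L' = L \<or> L' = - L" using q_gt_3 by (metis mult_cancel_right of_nat_eq_0_iff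
        less_nat_zero_code mult_eq_0_iff zero_neq_numeral)
  \<comment> \<open>The sign is fixed because both numbers are \<open>1\<close> modulo
    \<open>3\<close>.\<close>
  moreover have "L' \<noteq> - L"
    using L(1) L'3 unfolding cong_iff_dvd_diff by presburger
  ultimately have "L' = L" by blast
  then show "eis_om jac = 3 * M" "2 * eis_re jac - eis_om jac = L"
    using X0 L(2) by (simp_all add: L'_def A_def B_def[symmetric] M')
qed

text \<open>Put \<open>a = jac ^ h\<close> and \<open>b = eis_cnj jac ^ h\<close>. Then
  \<open>a ^ 3 * b ^ 3\<close> is a power of \<open>q\<close>, read by Euler's criterion, and
  \<open>a ^ 4 * b ^ 2 = (q * jac) ^ (2 * h)\<close> is read by the Gauss sum. Multiplied together
  and by \<open>b\<close> they give \<open>a * a ^ 6 * b ^ 6\<close>, whose sixth powers are known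
  from Frobenius.\<close>

lemma jac_power_mod:
  assumes p: "prime p" "p \<noteq> q" and h: "p = 6 * h + 1 \<or> p + 1 = 6 * h"
  shows "rng_cong (of_nat p) (jac ^ h)
    (of_int (Legendre (int q) (int p)) * (if p = 6 * h + 1 then chi (int p) ^ 2 else chi (int p))
      * eis_cnj jac ^ h)"
proof -
  let ?r = "rng_cong (of_nat p :: eis)" and ?e = "of_int (Legendre (int q) (int p)) :: eis"
  let ?Q = "of_int (int q) :: eis"
  define a b where "a = jac ^ h" and "b = eis_cnj jac ^ h"
  have pq: "\<not> int p dvd int q" using p prime_q by (metis int_dvd_int_iff primes_dvd_imp_eq)
  have Q: "?Q = jac * eis_cnj jac" using jac_norm by simp
  have cnj: "eis_cnj a = b" "eis_cnj b = a" by (simp_all add: a_def b_def)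
  have c6: "(?Q * jac) ^ (2 * h) = a ^ 4 * b ^ 2"
    unfolding Q a_def b_def
    by (simp add: power_mult_distrib mult_ac flip: power_mult power_add)
      (simp add: mult.assoc[symmetric] mult.commute[of h] flip: power_add)
  have ab: "a ^ 3 * b ^ 3 = of_int (int q ^ (3 * h))"
    unfolding a_def b_def of_int_power Q
    by (simp add: power_mult_distrib mult.commute flip: power_mult)
  have eq7: "(a ^ 3 * b ^ 3) * (a ^ 4 * b ^ 2) * b = a * a ^ 6 * b ^ 6"
    by (simp add: eval_nat_numeral mult_ac)
  show ?thesis
  proof (cases "p = 6 * h + 1")
    case True
    \<comment> \<open>Only integers prime to \<open>p\<close> can be cancelled here, so the claim is
      first multiplied by \<open>q = jac * eis_cnj jac\<close>.\<close>
    have "rng_cong (of_nat p) (?Q * a ^ 6) (?Q * 1)"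
    proof -
      have "?Q * a ^ 6 = eis_cnj jac * jac ^ p"
        unfolding Q a_def True by (simp add: mult_ac flip: power_mult)
      moreover have "?r (eis_cnj jac * jac ^ p) (eis_cnj jac * jac)"
        using True by (intro rng_cong_mult eis_power_prime_split[OF p(1), of "2 * h"]) simp_all
      ultimately show ?thesis by (simp add: jac_norm mult.commute[of "eis_cnj jac" jac])
    qed
    then have a6: "?r (a ^ 6) 1" by (rule rng_cong_cancel_of_int[OF p(1) pq])
    from rng_cong_cnj[OF this] have b6: "?r (b ^ 6) 1" by (simp add: cnj)
    have e: "?r ?e (a ^ 3 * b ^ 3)"
      unfolding ab using True by (intro rng_cong_of_int euler_criterion_int[OF p(1)]) simp
    have "?r ((?Q * jac) ^ (2 * h)) (chi (int p) ^ 2)"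
      unfolding rng_cong_def using jac_frobenius1[OF p(1,2), of "2 * h"] True by simp
    then have c: "?r (chi (int p) ^ 2) (a ^ 4 * b ^ 2)" unfolding c6 by (rule rng_cong_sym)
    have "?r (?e * chi (int p) ^ 2 * b) ((a ^ 3 * b ^ 3) * (a ^ 4 * b ^ 2) * b)"
      by (intro rng_cong_mult e c rng_cong_refl)
    also have "?r ((a ^ 3 * b ^ 3) * (a ^ 4 * b ^ 2) * b) (a * 1 * 1)"
      unfolding eq7 by (intro rng_cong_mult a6 b6 rng_cong_refl)
    finally show ?thesis using True by (simp add: rng_cong_sym a_def b_def)
  next
    case False
    then have p6: "p + 1 = 6 * h" using h by simp
    have h0: "h > 0" using p6 by (cases h) auto
    have pj: "p = 3 * (2 * h - 1) + 2" using p6 h0 by simp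
    have a6: "?r (a ^ 6) ?Q"
    proof -
      have "a ^ 6 = jac ^ (p + 1)"
        unfolding a_def p6 by (simp add: mult.commute flip: power_mult)
      then have "a ^ 6 = jac ^ p * jac" by simp
      moreover have "?r (jac ^ p * jac) (eis_cnj jac * jac)"
        using p6 by (intro rng_cong_mult eis_power_prime_inert[OF p(1), of "2 * h - 1"]) simp_all
      ultimately show ?thesis by (simp add: jac_norm mult.commute[of "eis_cnj jac" jac])
    qed
    from rng_cong_cnj[OF this] have b6: "?r (b ^ 6) ?Q" by (simp add: cnj)
    \<comment> \<open>In this case \<open>3 * h\<close> exceeds Euler's exponent
      \<open>(p - 1) / 2\<close> by one, hence the additional factor \<open>q\<close>.\<close>
    have e: "?r (?e * ?Q) (a ^ 3 * b ^ 3)"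
    proof -
      have "a ^ 3 * b ^ 3 = of_int (int q ^ (3 * h - 1)) * ?Q"
        unfolding ab of_int_mult[symmetric] using power_minus_mult[of "3 * h" "int q"] h0 by simp
      moreover have "?r ?e (of_int (int q ^ (3 * h - 1)))"
        using p6 by (intro rng_cong_of_int euler_criterion_int[OF p(1)]) simp
      ultimately show ?thesis using rng_cong_mult[OF _ rng_cong_refl] by metis
    qed
    have "?r ((?Q * jac) ^ (2 * h - 1) * jac) (chi (int p))"
      unfolding rng_cong_def using jac_frobenius2[OF p(1,2) pj] by simp
    then have "?r (?Q * ((?Q * jac) ^ (2 * h - 1) * jac)) (?Q * chi (int p))"
      by (intro rng_cong_mult rng_cong_refl)
    moreover have "?Q * ((?Q * jac) ^ (2 * h - 1) * jac) = (?Q * jac) ^ (2 * h)"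
      using h0 by (cases h) (simp_all add: mult_ac)
    ultimately have c: "?r (?Q * chi (int p)) (a ^ 4 * b ^ 2)"
      unfolding c6 by (metis rng_cong_sym)
    have "?r ((?e * ?Q) * (?Q * chi (int p)) * b) ((a ^ 3 * b ^ 3) * (a ^ 4 * b ^ 2) * b)"
      by (intro rng_cong_mult e c rng_cong_refl)
    also have "?r ((a ^ 3 * b ^ 3) * (a ^ 4 * b ^ 2) * b) (a * ?Q * ?Q)"
      unfolding eq7 by (intro rng_cong_mult a6 b6 rng_cong_refl)
    finally have "?r ((?e * ?Q) * (?Q * chi (int p)) * b) (a * ?Q * ?Q)" .
    moreover have "(?e * ?Q) * (?Q * chi (int p)) * b = ?Q * (?Q * (?e * chi (int p) * b))"
      "a * ?Q * ?Q = ?Q * (?Q * a)" by (simp_all only: mult_ac)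
    ultimately have "?r (?Q * (?Q * (?e * chi (int p) * b))) (?Q * (?Q * a))" by (simp only:)
    then have "?r (?e * chi (int p) * b) a"
      by (rule rng_cong_cancel_of_int[OF p(1) pq rng_cong_cancel_of_int[OF p(1) pq]])
    then show ?thesis using False by (simp add: rng_cong_sym a_def b_def)
  qed
qed

end

subsection \<open>Localization of the Eisenstein integers at p\<close>

definition omega :: complex where "omega = Complex (-1/2) (sqrt 3 / 2)"

lemma omega_square: "omega\<^sup>2 = - 1 - omega"
  by (simp add: omega_def complex_eq_iff power2_eq_square)

definition eis_complex :: "eis \<Rightarrow> complex" where
  "eis_complex x = of_int (eis_re x) + of_int (eis_om x) * omega"

lemma eis_complex_simps [simp]:
  "eis_complex 0 = 0" "eis_complex 1 = 1" "eis_complex (of_int n) = of_int n"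
  "eis_complex (of_nat k) = of_nat k"
  "eis_complex (x + y) = eis_complex x + eis_complex y"
  "eis_complex (x - y) = eis_complex x - eis_complex y"
  "eis_complex (- x) = - eis_complex x"
  by (simp_all add: eis_complex_def algebra_simps)

lemma eis_complex_mult [simp]: "eis_complex (x * y) = eis_complex x * eis_complex y"
proof -
  have "eis_complex x * eis_complex y = of_int (eis_re x * eis_re y)
    + of_int (eis_re x * eis_om y + eis_om x * eis_re y) * omega
    + of_int (eis_om x * eis_om y) * omega\<^sup>2"
    by (simp add: eis_complex_def power2_eq_square algebra_simps)
  then show ?thesis by (simp add: omega_square eis_complex_def algebra_simps)
qed

lemma eis_complex_power [simp]: "eis_complex (x ^ n) = eis_complex x ^ n"
  by (induction n) simp_all

lemma eis_complex_real_imp_om_0: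
  assumes "eis_complex x \<in> \<real>"
  shows "eis_om x = 0"
  using assms by (simp add: eis_complex_def omega_def complex_is_Real_iff)

locale prime_localization =
  fixes p :: nat
  assumes prime_p: "prime p"
begin

lemma prime_int_p: "prime (int p)"
  using prime_p by simp

text \<open>
  \<open>loc\<close> is the ring of \<open>p\<close>-integral elements of \<open>\<rat>(\<omega>)\<close>, embedded in the complex numbers, and \<open>lcong\<close> is
  congruence modulo \<open>p\<close> in it.
\<close>

definition loc :: "complex set" where
  "loc = {x. \<exists>n y. \<not> int p dvd n \<and> of_int n * x = eis_complex y}"

definition lcong :: "complex \<Rightarrow> complex \<Rightarrow> bool" where
  "lcong x y \<longleftrightarrow> (\<exists>u\<in>loc. x - y = of_nat p * u)"

lemma locI: "\<not> int p dvd n \<Longrightarrow> of_int n * x = eis_complex y \<Longrightarrow> x \<in> loc"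
  by (auto simp: loc_def)

lemma loc_eis_complex [simp, intro]: "eis_complex x \<in> loc"
  using prime_p by (intro locI[of 1 _ x]) auto

lemma loc_of_int [simp, intro]: "of_int n \<in> loc"
  using loc_eis_complex[of "of_int n"] by simp

lemma loc_of_nat [simp, intro]: "of_nat n \<in> loc"
  using loc_eis_complex[of "of_nat n"] by simp

lemma loc_numeral [simp, intro]: "numeral n \<in> loc" "0 \<in> loc" "1 \<in> loc"
  using loc_of_nat[of "numeral n"] loc_of_nat[of 0] loc_of_nat[of 1] by simp_all

lemma loc_add [intro]:
  assumes "x \<in> loc" "y \<in> loc"
  shows "x + y \<in> loc"
proof -
  obtain n u m v where nm: "\<not> int p dvd n" "of_int n * x = eis_complex u"
    "\<not> int p dvd m" "of_int m * y = eis_complex v"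
    using assms by (auto simp: loc_def)
  show ?thesis
  proof (rule locI)
    show "\<not> int p dvd n * m" using nm prime_int_p by (simp add: prime_dvd_mult_iff)
    have "of_int (n * m) * (x + y) = of_int m * (of_int n * x) + of_int n * (of_int m * y)"
      by (simp add: algebra_simps)
    then show "of_int (n * m) * (x + y) = eis_complex (of_int m * u + of_int n * v)"
      by (simp add: nm)
  qed
qed

lemma loc_mult [intro]:
  assumes "x \<in> loc" "y \<in> loc"
  shows "x * y \<in> loc"
proof -
  obtain n u m v where nm: "\<not> int p dvd n" "of_int n * x = eis_complex u"
    "\<not> int p dvd m" "of_int m * y = eis_complex v"
    using assms by (auto simp: loc_def)
  show ?thesis
  proof (rule locI)
    show "\<not> int p dvd n * m" using nm prime_int_p by (simp add: prime_dvd_mult_iff)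
    have "of_int (n * m) * (x * y) = (of_int n * x) * (of_int m * y)"
      by (simp add: algebra_simps)
    then show "of_int (n * m) * (x * y) = eis_complex (u * v)"
      by (simp add: nm)
  qed
qed

lemma loc_uminus [intro]: "x \<in> loc \<Longrightarrow> - x \<in> loc"
  using loc_mult[of "of_int (-1)" x] loc_of_int[of "-1"] by simp

lemma loc_diff [intro]: "x \<in> loc \<Longrightarrow> y \<in> loc \<Longrightarrow> x - y \<in> loc"
  using loc_add[of x "- y"] by auto

lemma loc_power [intro]: "x \<in> loc \<Longrightarrow> x ^ n \<in> loc"
  by (induction n) auto

lemma loc_sum [intro]: "(\<And>i. i \<in> I \<Longrightarrow> f i \<in> loc) \<Longrightarrow> (\<Sum>i\<in>I. f i) \<in> loc"
  by (induction I rule: infinite_finite_induct) auto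

lemma loc_inverse_of_int:
  assumes "\<not> int p dvd n"
  shows "inverse (of_int n) \<in> loc"
proof (rule locI[OF assms])
  have "n \<noteq> 0" using assms by auto
  then show "of_int n * inverse (of_int n) = eis_complex 1" by simp
qed

lemma loc_divide_of_int: "x \<in> loc \<Longrightarrow> \<not> int p dvd n \<Longrightarrow> x / of_int n \<in> loc"
  unfolding divide_inverse by (intro loc_mult loc_inverse_of_int)

lemma lcong_refl [simp, intro]: "lcong x x"
  by (auto simp: lcong_def intro!: bexI[of _ 0])

lemma lcong_add: "lcong x y \<Longrightarrow> lcong x' y' \<Longrightarrow> lcong (x + x') (y + y')"
  unfolding lcong_def by (metis add_diff_add distrib_left loc_add)

lemma lcong_trans [trans]: "lcong x y \<Longrightarrow> lcong y z \<Longrightarrow> lcong x z"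
  using lcong_add[of x y y z] by (simp add: lcong_def)

lemma lcong_diff:
  assumes "lcong x y" "lcong x' y'"
  shows "lcong (x - x') (y - y')"
proof -
  obtain u v where uv: "u \<in> loc" "x - y = of_nat p * u" "v \<in> loc" "x' - y' = of_nat p * v"
    using assms by (auto simp: lcong_def)
  have "(x - x') - (y - y') = (x - y) - (x' - y')" by simp
  also have "\<dots> = of_nat p * (u - v)" by (simp add: uv(2,4) algebra_simps)
  finally show ?thesis unfolding lcong_def using uv by blast
qed

lemma lcong_loc: "lcong x y \<Longrightarrow> y \<in> loc \<Longrightarrow> x \<in> loc"
  unfolding lcong_def by (metis diff_add_cancel loc_add loc_mult loc_of_nat)

lemma lcong_mult_left:
  assumes "lcong x y" "c \<in> loc"
  shows "lcong (c * x) (c * y)"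
proof -
  obtain u where u: "u \<in> loc" "x - y = of_nat p * u"
    using assms by (auto simp: lcong_def)
  have "c * x - c * y = c * (x - y)" by (simp add: algebra_simps)
  also have "\<dots> = of_nat p * (c * u)" using u by simp
  finally show ?thesis unfolding lcong_def using u assms by blast
qed

lemma lcong_mult:
  assumes "lcong x y" "lcong x' y'" "y \<in> loc" "y' \<in> loc"
  shows "lcong (x * x') (y * y')"
proof -
  have "lcong (x' * x) (x' * y)" using assms lcong_loc by (intro lcong_mult_left) auto
  moreover have "lcong (y * x') (y * y')" using assms by (intro lcong_mult_left) auto
  ultimately show ?thesis using lcong_trans by (simp add: mult.commute[of x'])
qed

lemma lcong_power: "lcong x y \<Longrightarrow> y \<in> loc \<Longrightarrow> lcong (x ^ n) (y ^ n)"
  by (induction n) (auto intro: lcong_mult)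

lemma lcong_sum: "(\<And>i. i \<in> I \<Longrightarrow> lcong (f i) (g i)) \<Longrightarrow> lcong (\<Sum>i\<in>I. f i) (\<Sum>i\<in>I. g i)"
  by (induction I rule: infinite_finite_induct) (auto intro: lcong_add)

lemma lcong_cancel:
  assumes "lcong (c * x) (c * y)" "inverse c \<in> loc" "c \<noteq> 0"
  shows "lcong x y"
  using lcong_mult_left[OF assms(1,2)] assms(3) by (simp add: mult.assoc[symmetric])

lemma lcong_cancel_of_int:
  assumes "lcong (of_int n * x) (of_int n * y)" "\<not> int p dvd n"
  shows "lcong x y"
  using assms by (intro lcong_cancel[OF assms(1)] loc_inverse_of_int) auto

lemma lcong_eis_complex:
  assumes "rng_cong (of_nat p) x y"
  shows "lcong (eis_complex x) (eis_complex y)"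
proof -
  obtain z where "x - y = of_nat p * z" using assms unfolding rng_cong_def by (elim dvdE)
  then have "eis_complex x - eis_complex y = of_nat p * eis_complex z"
    by (metis eis_complex_mult eis_complex_simps(4,6))
  then show ?thesis unfolding lcong_def by blast
qed

lemma lcong_of_int: "[a = b] (mod int p) \<Longrightarrow> lcong (of_int a) (of_int b)"
  using lcong_eis_complex[OF rng_cong_of_int] by simp

text \<open>If a rational number lies in \<open>loc\<close>, the Eisenstein numerator that witnesses
  this is real, hence an ordinary integer; so the reduced denominator is prime to \<open>p\<close>.
  The same argument for \<open>(a - b) / p\<close> gives the divisibility of the numerator.\<close>

lemma rat_cong_if_lcong:
  assumes "lcong (of_rat a) (of_rat b)" "of_rat b \<in> loc"
  shows "rat_cong a b (int p)"
proof -
  have real: "\<exists>n k. \<not> int p dvd n \<and> of_int n * x = (of_int k :: rat)" if x: "of_rat x \<in> loc" for x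
  proof -
    obtain n y where n: "\<not> int p dvd n" "of_int n * of_rat x = eis_complex y"
      using x by (auto simp: loc_def)
    have "(of_rat x :: complex) \<in> \<real>" by (cases x) (simp add: of_rat_rat)
    then have "eis_complex y \<in> \<real>" unfolding n(2)[symmetric] by simp
    then have "eis_om y = 0" by (rule eis_complex_real_imp_om_0)
    then have "(of_rat (of_int n * x) :: complex) = of_rat (of_int (eis_re y))"
      using n(2) by (simp add: eis_complex_def of_rat_mult)
    then show ?thesis using n(1) of_rat_eq_iff by blast
  qed
  have quot: "of_int (snd (quotient_of x)) * x = of_int (fst (quotient_of x))" for x
  proof -
    have "x = of_int (fst (quotient_of x)) / of_int (snd (quotient_of x))"
      by (rule quotient_of_div) simp
    then show ?thesis using quotient_of_denom_pos'[of x] by (simp add: field_simps)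
  qed
  have cop: "coprime (snd (quotient_of x)) (int p)" if x: "of_rat x \<in> loc" for x
  proof (rule ccontr)
    assume "\<not> ?thesis"
    then have d: "int p dvd snd (quotient_of x)"
      using prime_int_p by (metis coprime_commute prime_imp_coprime)
    obtain n k where n: "\<not> int p dvd n" "of_int n * x = (of_int k :: rat)" using real[OF x] by blast
    have "(of_int (n * fst (quotient_of x)) :: rat) = of_int n * (of_int (snd (quotient_of x)) * x)"
      by (simp add: quot)
    also have "\<dots> = of_int (snd (quotient_of x) * k)" by (simp add: n(2)[symmetric] mult_ac)
    finally have "n * fst (quotient_of x) = snd (quotient_of x) * k" by (simp only: of_int_eq_iff)
    then have "int p dvd n * fst (quotient_of x)" using d by simp
    then have "int p dvd fst (quotient_of x)" using n(1) prime_int_p by (simp add: prime_dvd_mult_iff)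
    moreover have "coprime (fst (quotient_of x)) (snd (quotient_of x))"
      using quotient_of_coprime by (metis prod.collapse)
    ultimately show False using d prime_int_p by (metis coprime_common_divisor not_prime_unit)
  qed
  obtain u where u: "u \<in> loc" "of_rat a - of_rat b = of_nat p * u"
    using assms(1) by (auto simp: lcong_def)
  define x where "x = (a - b) / of_nat p"
  have p0: "(of_nat p :: complex) \<noteq> 0" using prime_gt_0_nat[OF prime_p] by simp
  have "of_rat x = u" using u(2) p0
    by (simp add: x_def of_rat_divide of_rat_diff)
  then have "of_rat x \<in> loc" using u(1) by simp
  then obtain n k where n: "\<not> int p dvd n" "of_int n * x = (of_int k :: rat)" using real by blast
  have ab: "a - b = of_nat p * x" using prime_gt_0_nat[OF prime_p] by (simp add: x_def)
  have "(of_int (n * fst (quotient_of (a - b))) :: rat)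
      = of_int n * (of_int (snd (quotient_of (a - b))) * (a - b))"
    by (simp add: quot)
  also have "\<dots> = of_int (int p * (snd (quotient_of (a - b)) * k))"
    unfolding n(2)[symmetric] of_int_mult by (simp add: ab n(2)[symmetric] mult_ac)
  finally have "n * fst (quotient_of (a - b)) = int p * (snd (quotient_of (a - b)) * k)"
    by (simp only: of_int_eq_iff)
  then have "int p dvd n * fst (quotient_of (a - b))" by simp
  then have "int p dvd fst (quotient_of (a - b))" using n(1) prime_int_p by (simp add: prime_dvd_mult_iff)
  moreover have "of_rat a \<in> loc" using assms lcong_loc by blast
  ultimately show ?thesis unfolding rat_cong_def using cop assms(2) by blast
qed

end

subsection \<open>Recurrences for S and Chebyshev-type expansions\<close>

lemma S_fact:
  "S n = fact (6 * n) * fact n / (2 * fact (3 * n) * fact (2 * n) * fact (2 * n + 1))"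
proof -
  have c: "(of_nat ((6 * n) choose (3 * n)) :: rat) = fact (6 * n) / (fact (3 * n) * fact (3 * n))"
    "(of_nat ((3 * n) choose n) :: rat) = fact (3 * n) / (fact n * fact (2 * n))"
    "(of_nat ((2 * n) choose n) :: rat) = fact (2 * n) / (fact n * fact n)"
    using binomial_fact[of "3 * n" "6 * n", where 'a = rat] binomial_fact[of n "3 * n", where 'a = rat]
      binomial_fact[of n "2 * n", where 'a = rat] by simp_all
  have f: "(fact (2 * n + 1) :: rat) = of_nat (2 * n + 1) * fact (2 * n)" by simp
  have nz: "(fact (2 * n) :: rat) \<noteq> 0" "(fact (3 * n) :: rat) \<noteq> 0" "(fact n :: rat) \<noteq> 0"
    "(of_nat (2 * n + 1) :: rat) \<noteq> 0"
    by (simp_all del: of_nat_add of_nat_mult)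
  show ?thesis
    unfolding S_def of_nat_mult c f using nz by (simp add: divide_simps del: of_nat_add of_nat_Suc)
qed

text \<open>The coefficient recurrence of 2F1(1/6, 5/6; 3/2; 108 z). Its factor
  \<open>2 * k + 3\<close> equals \<open>p\<close> at \<open>k = (p - 3) / 2\<close>.\<close>

lemma S_Suc:
  "of_nat (k + 1) * of_nat (2 * k + 3) * S (Suc k) = 6 * of_nat (6 * k + 1) * of_nat (6 * k + 5) * S k"
proof -
  have 6: "(fact (6 * Suc k) :: rat) = of_nat (6 * k + 6) * of_nat (6 * k + 5) * of_nat (6 * k + 4)
      * of_nat (6 * k + 3) * of_nat (6 * k + 2) * of_nat (6 * k + 1) * fact (6 * k)"
    and 3: "(fact (3 * Suc k) :: rat) = of_nat (3 * k + 3) * of_nat (3 * k + 2) * of_nat (3 * k + 1) * fact (3 * k)"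
    and 2: "(fact (2 * Suc k) :: rat) = of_nat (2 * k + 2) * of_nat (2 * k + 1) * fact (2 * k)"
    and 21: "(fact (2 * Suc k + 1) :: rat) = of_nat (2 * k + 3) * of_nat (2 * k + 2) * fact (2 * k + 1)"
    and 1: "(fact (Suc k) :: rat) = of_nat (k + 1) * fact k"
    by (simp_all add: fact_reduce algebra_simps eval_nat_numeral)
  define x :: rat where "x = of_nat k"
  have x6: "(fact (6 * Suc k) :: rat)
      = (6 * x + 6) * (6 * x + 5) * (6 * x + 4) * (6 * x + 3) * (6 * x + 2) * (6 * x + 1) * fact (6 * k)"
    and x3: "(fact (3 * Suc k) :: rat) = (3 * x + 3) * (3 * x + 2) * (3 * x + 1) * fact (3 * k)"
    and x2: "(fact (2 * Suc k) :: rat) = (2 * x + 2) * (2 * x + 1) * fact (2 * k)"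
    and x21: "(fact (2 * Suc k + 1) :: rat) = (2 * x + 3) * (2 * x + 2) * fact (2 * k + 1)"
    and x1: "(fact (Suc k) :: rat) = (x + 1) * fact k"
    unfolding 6 3 2 21 1 x_def of_nat_add of_nat_mult by (simp_all only: of_nat_numeral of_nat_1)
  have nz: "x + 1 \<noteq> 0" "2 * x + 1 \<noteq> 0" "2 * x + 3 \<noteq> 0" "3 * x + 1 \<noteq> 0" "3 * x + 2 \<noteq> 0"
    "(fact (2 * k) :: rat) \<noteq> 0" "(fact (3 * k) :: rat) \<noteq> 0" "(fact (2 * k + 1) :: rat) \<noteq> 0"
    "2 * x + 2 \<noteq> 0" "3 * x + 3 \<noteq> 0"
    using of_nat_0_le_iff[of k, where 'a = rat] unfolding x_def[symmetric] by (linarith | simp del: fact_Suc)+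
  define A B where "A = (6 * x + 6) * (6 * x + 5) * (6 * x + 4) * (6 * x + 3) * (6 * x + 2) * (6 * x + 1) * (x + 1)"
    and "B = 2 * ((3 * x + 3) * (3 * x + 2) * (3 * x + 1)) * ((2 * x + 2) * (2 * x + 1)) * ((2 * x + 3) * (2 * x + 2))"
  have B: "B \<noteq> 0" unfolding B_def using nz by simp
  have "2 * ((x + 1) * (2 * x + 3)) * A = (6 * (6 * x + 1) * (6 * x + 5)) * B"
    unfolding A_def B_def by (simp add: algebra_simps)
  moreover have "S (Suc k) = A / B * (2 * S k)"
  proof -
    define F G :: rat where "F = fact (6 * k) * fact k" and "G = fact (3 * k) * fact (2 * k) * fact (2 * k + 1)"
    have "S (Suc k) = (A * F) / (B * G)"
      unfolding S_fact x6 x3 x2 x21 x1 A_def B_def F_def G_def by (simp only: mult_ac)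
    moreover have "2 * S k = F / G"
      unfolding S_fact F_def G_def by (simp add: mult_ac del: fact_Suc)
    ultimately show ?thesis by simp
  qed
  ultimately have "(x + 1) * (2 * x + 3) * S (Suc k) * B = 6 * (6 * x + 1) * (6 * x + 5) * S k * B"
    using B by (simp add: mult_ac)
  then have "(x + 1) * (2 * x + 3) * S (Suc k) = 6 * (6 * x + 1) * (6 * x + 5) * S k"
    using B by (simp only: mult_cancel_right) blast
  then show ?thesis unfolding x_def by (simp only: of_nat_add of_nat_mult of_nat_numeral of_nat_1)
qed

section \<open>Binomial recurrences and expansions of Chebyshev polynomials\<close>

lemma of_nat_Suc_choose_Suc:
  "of_nat (Suc j) * (of_nat (Suc y choose Suc j) :: 'a::field_char_0) = (of_nat y + 1) * of_nat (y choose j)"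
  using arg_cong[OF Suc_times_binomial[of j y], of "of_nat :: nat \<Rightarrow> 'a"]
  by (simp only: of_nat_mult of_nat_Suc add.commute)

lemma of_nat_choose_Suc:
  "of_nat (Suc j) * (of_nat (y choose Suc j) :: 'a::field_char_0)
    = (of_nat y - of_nat j) * of_nat (y choose j)"
  using gbinomial_mult_1[of "of_nat y :: 'a" j]
  unfolding binomial_gbinomial by (simp add: left_diff_distrib)

lemma choose_plus_two_rec:
  "of_nat ((j + 1) * (j + 2)) * of_nat (Suc y choose (j + 2))
    = (of_nat y + 1) * (of_nat y - of_nat j) * (of_nat (y choose j) :: complex)"
proof -
  have "of_nat (j + 2) * (of_nat (Suc y choose (j + 2)) :: complex)
      = (of_nat y + 1) * of_nat (y choose (j + 1))"
    using of_nat_Suc_choose_Suc[of "Suc j" y] by (simp del: binomial_Suc_Suc)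
  moreover have "of_nat (j + 1) * (of_nat (y choose (j + 1)) :: complex)
      = (of_nat y - of_nat j) * of_nat (y choose j)"
    using of_nat_choose_Suc[of j y] by simp
  ultimately show ?thesis by (simp only: of_nat_mult) (metis mult.assoc mult.left_commute)
qed

lemma choose_pascal2: "(Suc (Suc y) choose (j + 2)) + (y choose (j + 2)) = 2 * (Suc y choose (j + 2)) + (y choose j)"
  by simp

text \<open>For \<open>x * y = 1\<close>, the coefficients of
  \<open>(x ^ m - y ^ m) / (x - y)\<close> in powers of \<open>v = x + y - 2\<close>, that is, of
  the Chebyshev polynomial of the second kind of degree \<open>m - 1\<close> at
  \<open>1 + v / 2\<close>.\<close>

definition Useq :: "nat \<Rightarrow> nat \<Rightarrow> nat" where "Useq m k = ((m + k) choose (2 * k + 1))"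

lemma Useq_eq_0: "m \<le> k \<Longrightarrow> Useq m k = 0"
  by (simp add: Useq_def)

text \<open>\<open>choose_pascal2\<close> yields the recurrence
  \<open>U (m + 2) + U m = (x + y) * U (m + 1)\<close>. The range \<open>K\<close> may exceed
  \<open>m\<close>, so that polynomials of different degrees can later share one range of
  summation.\<close>

lemma Useq_sum:
  fixes x y :: complex
  assumes xy: "x * y = 1" and "m \<le> K"
  shows "(\<Sum>k<K. of_nat (Useq m k) * (x + y - 2) ^ k) * (x - y) = x ^ m - y ^ m"
proof -
  define v where "v = x + y - 2"
  define U where "U m = (\<Sum>k<m. of_nat (Useq m k) * v ^ k)" for m
  have ext: "(\<Sum>k<K. of_nat (Useq m k) * v ^ k) = U m" if "m \<le> K" for m K
    unfolding U_def using that by (intro sum.mono_neutral_right) (auto simp: Useq_eq_0)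
  have rec: "U (Suc (Suc m)) + U m = (v + 2) * U (Suc m)" for m
  proof -
    let ?K = "Suc (Suc m)"
    have "U ?K + U m = (\<Sum>k<Suc ?K. of_nat (Useq ?K k + Useq m k) * v ^ k)"
      using ext[of "?K" "Suc ?K"] ext[of m "Suc ?K"] by (simp only: of_nat_add distrib_right sum.distrib)
    also have "\<dots> = of_nat (Useq ?K 0 + Useq m 0) + (\<Sum>k<?K. of_nat (Useq ?K (Suc k) + Useq m (Suc k)) * v ^ Suc k)"
      by (subst sum.lessThan_Suc_shift) simp
    also have "\<dots> = of_nat (2 * Useq (Suc m) 0)
        + (\<Sum>k<?K. of_nat (2 * Useq (Suc m) (Suc k) + Useq (Suc m) k) * v ^ Suc k)"
    proof -
      have "Useq ?K (Suc k) + Useq m (Suc k) = 2 * Useq (Suc m) (Suc k) + Useq (Suc m) k" for k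
        using choose_pascal2[of "Suc m + k" "2 * k + 1"] by (simp add: Useq_def)
      moreover have "Useq ?K 0 + Useq m 0 = 2 * Useq (Suc m) 0" by (simp add: Useq_def)
      ultimately show ?thesis by simp
    qed
    also have "\<dots> = 2 * (of_nat (Useq (Suc m) 0) + (\<Sum>k<?K. of_nat (Useq (Suc m) (Suc k)) * v ^ Suc k))
        + v * (\<Sum>k<?K. of_nat (Useq (Suc m) k) * v ^ k)"
      by (simp only: of_nat_add of_nat_mult distrib_right sum.distrib sum_distrib_left distrib_left)
        (simp add: mult_ac)
    also have "of_nat (Useq (Suc m) 0) + (\<Sum>k<?K. of_nat (Useq (Suc m) (Suc k)) * v ^ Suc k)
        = (\<Sum>k<Suc ?K. of_nat (Useq (Suc m) k) * v ^ k)"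
      by (subst sum.lessThan_Suc_shift) simp
    also have "\<dots> = U (Suc m)" by (rule ext) simp
    also have "(\<Sum>k<?K. of_nat (Useq (Suc m) k) * v ^ k) = U (Suc m)" by (rule ext) simp
    finally show ?thesis by (simp add: algebra_simps)
  qed
  have "U m * (x - y) = x ^ m - y ^ m \<and> U (Suc m) * (x - y) = x ^ Suc m - y ^ Suc m"
  proof (induction m)
    case 0
    then show ?case by (simp add: U_def Useq_def)
  next
    case (Suc m)
    have "U (Suc (Suc m)) = (x + y) * U (Suc m) - U m"
      using rec[of m] unfolding v_def by (simp add: eq_diff_eq)
    then have "U (Suc (Suc m)) * (x - y) = (x + y) * (U (Suc m) * (x - y)) - U m * (x - y)"
      by (simp add: left_diff_distrib mult.assoc)
    also have "\<dots> = (x + y) * (x ^ Suc m - y ^ Suc m) - (x ^ m - y ^ m)" using Suc by simp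
    also have "\<dots> = x ^ Suc (Suc m) - y ^ Suc (Suc m) + (x * y) * (x ^ m - y ^ m) - (x ^ m - y ^ m)"
      by (simp add: algebra_simps)
    also have "\<dots> = x ^ Suc (Suc m) - y ^ Suc (Suc m)" by (simp add: xy)
    finally show ?case using Suc by blast
  qed
  then show ?thesis using ext[OF assms(2)] by (simp add: v_def[symmetric])
qed

text \<open>For \<open>m > 0\<close> these are the coefficients of \<open>x ^ m + y ^ m\<close>,
  twice the Chebyshev polynomial of the first kind at \<open>1 + v / 2\<close>.\<close>

definition Vseq :: "nat \<Rightarrow> nat \<Rightarrow> complex" where
  "Vseq m j = of_nat (Useq (m + 1) j) - of_nat (Useq (m - 1) j)"

lemma Vseq_0: "m > 0 \<Longrightarrow> Vseq m 0 = 2"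
  by (simp add: Vseq_def Useq_def of_nat_diff)

text \<open>The coefficient form of \<open>T_m' = m U_(m-1)\<close> for Chebyshev
  polynomials.\<close>

lemma Vseq_Suc:
  assumes "m > 0"
  shows "of_nat (Suc j) * Vseq m (Suc j) = of_nat m * of_nat (Useq m j)"
proof -
  obtain m' where m: "m = Suc m'" using assms by (cases m) auto
  let ?y = "m + j"
  have "Vseq m (Suc j) = of_nat (Suc ?y choose (2 * j + 2)) + of_nat (?y choose (2 * j + 2))"
    by (simp add: Vseq_def Useq_def m)
  moreover have "of_nat (2 * j + 2) * (of_nat (Suc ?y choose (2 * j + 2)) :: complex)
      = (of_nat ?y + 1) * of_nat (?y choose (2 * j + 1))"
    using of_nat_Suc_choose_Suc[of "2 * j + 1" ?y] by (simp del: binomial_Suc_Suc)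
  moreover have "of_nat (2 * j + 2) * (of_nat (?y choose (2 * j + 2)) :: complex)
      = (of_nat ?y - of_nat (2 * j + 1)) * of_nat (?y choose (2 * j + 1))"
    using of_nat_choose_Suc[of "2 * j + 1" ?y] by simp
  ultimately have "of_nat (2 * j + 2) * Vseq m (Suc j)
      = ((of_nat ?y + 1) + (of_nat ?y - of_nat (2 * j + 1))) * of_nat (?y choose (2 * j + 1))"
    by (simp only: distrib_left distrib_right)
  also have "\<dots> = 2 * (of_nat m * of_nat (Useq m j))"
    by (simp add: Useq_def)
  also have "of_nat (2 * j + 2) * Vseq m (Suc j) = 2 * (of_nat (Suc j) * Vseq m (Suc j))"
    by (simp add: algebra_simps)
  finally show ?thesis by simp
qed

text \<open>Chebyshev's differential equation expanded at the point \<open>1\<close>. In this shape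
  it can be matched with the recurrence of \<open>S\<close>.\<close>

lemma Vseq_rec:
  assumes "m > 0"
  shows "of_nat ((2 * j + 1) * (2 * j + 2)) * Vseq m (Suc j) = (of_nat m ^ 2 - of_nat j ^ 2) * Vseq m j"
proof (cases j)
  case 0
  then show ?thesis using Vseq_Suc[OF assms, of 0] Vseq_0[OF assms]
    by (simp add: Useq_def power2_eq_square)
next
  case (Suc i)
  have u: "of_nat ((2 * i + 2) * (2 * i + 3)) * of_nat (Useq m (Suc i))
      = (of_nat m ^ 2 - of_nat (Suc i) ^ 2) * (of_nat (Useq m i) :: complex)"
    using choose_plus_two_rec[of "2 * i + 1" "m + i"]
    by (simp add: Useq_def power2_eq_square algebra_simps)
  have "of_nat (Suc i) * (of_nat ((2 * j + 1) * (2 * j + 2)) * Vseq m (Suc j))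
      = of_nat (Suc i) * of_nat (2 * i + 3) * 2 * (of_nat (Suc j) * Vseq m (Suc j))"
    by (simp add: Suc algebra_simps)
  also have "\<dots> = of_nat m * (of_nat ((2 * i + 2) * (2 * i + 3)) * of_nat (Useq m j))"
    unfolding Vseq_Suc[OF assms] by (simp add: algebra_simps)
  also have "\<dots> = (of_nat m ^ 2 - of_nat j ^ 2) * (of_nat m * of_nat (Useq m i))"
    unfolding Suc u by (simp only: mult_ac)
  also have "\<dots> = of_nat (Suc i) * ((of_nat m ^ 2 - of_nat j ^ 2) * Vseq m j)"
    unfolding Suc Vseq_Suc[OF assms, symmetric] by (simp only: mult_ac)
  finally show ?thesis
    by (subst (asm) mult_left_cancel) (simp_all only: of_nat_eq_0_iff nat.distinct simp_thms)
qed

text \<open>Links the coefficients of \<open>(x ^ (n + 1) - y ^ n) / (x - 1)\<close> with those of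
  \<open>(x ^ (n + 1) + y ^ n) / (x + 1)\<close>. It moves the weight \<open>2 * k + 1\<close>
  between the two kinds of sums.\<close>

lemma Useq_add:
  "of_nat (2 * k + 1) * (of_nat (Useq (n + 1) k) + of_nat (Useq n k) :: complex)
    = of_nat (2 * n + 1) * of_nat ((n + k) choose (2 * k))"
proof -
  have "of_nat (2 * k + 1) * (of_nat (Useq (n + 1) k) :: complex)
      = (of_nat (n + k) + 1) * of_nat ((n + k) choose (2 * k))"
    using of_nat_Suc_choose_Suc[of "2 * k" "n + k"] by (simp add: Useq_def del: binomial_Suc_Suc)
  moreover have "of_nat (2 * k + 1) * (of_nat (Useq n k) :: complex)
      = (of_nat (n + k) - of_nat (2 * k)) * of_nat ((n + k) choose (2 * k))"
    using of_nat_choose_Suc[of "2 * k" "n + k"] by (simp add: Useq_def)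
  ultimately have "of_nat (2 * k + 1) * (of_nat (Useq (n + 1) k) + of_nat (Useq n k) :: complex)
      = ((of_nat (n + k) + 1) + (of_nat (n + k) - of_nat (2 * k))) * of_nat ((n + k) choose (2 * k))"
    by (simp only: distrib_left distrib_right)
  then show ?thesis by simp
qed

lemma Useq_diff: "(of_nat ((n + k) choose (2 * k)) :: complex) = of_nat (Useq (n + 1) k) - of_nat (Useq n k)"
  by (simp add: Useq_def)

subsection \<open>The numbers S modulo p\<close>

lemma fact_add_prod: "(fact (c + m) :: int) = fact c * (\<Prod>i=1..m. int (c + i))"
  by (induction m) (simp_all add: algebra_simps)

lemma prod_add_cong:
  assumes "int p dvd int c"
  shows "[(\<Prod>i=1..m. int (c + i)) = fact m] (mod int p)"
proof -
  have "[(\<Prod>i=1..m. int (c + i)) = (\<Prod>i=1..m. int i)] (mod int p)"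
    using assms by (intro cong_prod) (simp add: cong_iff_dvd_diff)
  then show ?thesis by (simp add: fact_prod)
qed

locale prime_six = prime_localization +
  fixes N h :: nat
  assumes p_N: "p = 2 * N + 1" and p_h: "p = 6 * h + 1 \<or> p + 1 = 6 * h"
begin

lemma h_pos: "h > 0"
  using p_h prime_p by (cases h) auto

lemma p_ge_5: "p \<ge> 5"
  using p_h h_pos by presburger

lemma not_p_dvd_small: "0 < k \<Longrightarrow> k < int p \<Longrightarrow> \<not> int p dvd k"
  using zdvd_not_zless by blast

lemma not_p_dvd_nat: "0 < k \<Longrightarrow> k < p \<Longrightarrow> \<not> int p dvd int k"
  by (intro not_p_dvd_small) auto

lemma not_p_dvd_mult: "\<not> int p dvd a \<Longrightarrow> \<not> int p dvd b \<Longrightarrow> \<not> int p dvd a * b"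
  using prime_int_p by (simp add: prime_dvd_mult_iff)

lemma not_p_dvd_power: "\<not> int p dvd a \<Longrightarrow> \<not> int p dvd a ^ n"
  using prime_int_p prime_dvd_power by blast

lemma not_p_dvd_2: "\<not> int p dvd 2" and not_p_dvd_3: "\<not> int p dvd 3" and not_p_dvd_4: "\<not> int p dvd 4"
  using p_ge_5 by (auto dest: zdvd_imp_le)

lemma not_p_dvd_8: "\<not> int p dvd 8" and not_p_dvd_12: "\<not> int p dvd 12"
  using not_p_dvd_mult[OF not_p_dvd_2 not_p_dvd_4] not_p_dvd_mult[OF not_p_dvd_3 not_p_dvd_4]
  by simp_all

lemma half_quarter_loc: "1 / 2 \<in> loc" "1 / 4 \<in> loc" "1 / 8 \<in> loc" "3 / 4 \<in> loc" "1 / 12 \<in> loc"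
  using loc_divide_of_int[of 1 2] loc_divide_of_int[of 1 4] loc_divide_of_int[of 1 8]
    loc_divide_of_int[of 3 4] loc_divide_of_int[of 1 12]
    not_p_dvd_2 not_p_dvd_4 not_p_dvd_8 not_p_dvd_12 by simp_all

lemma lcong_of_int_mult:
  assumes "[a = b] (mod int p)" "lcong x y" "y \<in> loc"
  shows "lcong (of_int a * x) (of_int b * y)"
  using assms by (intro lcong_mult lcong_of_int) auto

text \<open>The starting value of the upper block. The factors \<open>p\<close> and
  \<open>2 * p\<close> of \<open>fact (6 * N)\<close> cancel against one factor \<open>p\<close>
  each in \<open>fact (3 * N)\<close> and \<open>fact (2 * N + 1)\<close>. What is left is
  \<open>N / ((p - 1) * (p - 2))\<close> modulo \<open>p\<close>, and \<open>N\<close> is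
  \<open>- 1 / 2\<close>.\<close>

lemma S_half: "lcong (of_rat (S N)) (- 1 / 4)"
proof -
  have N2: "N \<ge> 2" using p_N p_ge_5 by simp
  define P1 P2 P3 :: int where "P1 = (\<Prod>i=1..N-1. int (p + i))" and "P2 = (\<Prod>i=1..p-1. int (p + i))"
    and "P3 = (\<Prod>i=1..p-3. int (2 * p + i))"
  define f :: int where "f = fact (p - 1)"
  have c: "[P1 = fact (N - 1)] (mod int p)" "[P2 = f] (mod int p)" "[P3 = fact (p - 3)] (mod int p)"
    unfolding P1_def P2_def P3_def f_def by (intro prod_add_cong; simp)+
  have fp: "fact p = int p * f" unfolding f_def using p_ge_5 by (subst fact_reduce) auto
  have f3: "fact (3 * N) = int p * f * P1"
  proof -
    have "3 * N = p + (N - 1)" using p_N N2 by simp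
    then show ?thesis using fact_add_prod[of p "N - 1"] by (simp add: P1_def fp)
  qed
  have f6: "fact (6 * N) = 2 * int p * int p * f * P2 * P3"
  proof -
    have "6 * N = 2 * p + (p - 3)" using p_N N2 by simp
    then have "fact (6 * N) = fact (2 * p) * P3" using fact_add_prod[of "2 * p" "p - 3"] by (simp add: P3_def)
    also have "(fact (2 * p) :: int) = 2 * int p * fact (2 * p - 1)"
      using p_ge_5 by (subst fact_reduce) auto
    also have "2 * p - 1 = p + (p - 1)" using p_ge_5 by simp
    also have "(fact (p + (p - 1)) :: int) = fact p * P2" using fact_add_prod[of p "p - 1"] by (simp add: P2_def)
    finally show ?thesis by (simp add: fp mult_ac)
  qed
  have f2: "fact (2 * N) = f" "fact (2 * N + 1) = int p * f"
    using fp by (simp_all add: f_def p_N)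
  have fl: "(fact n :: rat) = of_int (fact n)" for n by simp
  have pf: "int p \<noteq> 0" "f \<noteq> 0" using p_ge_5 by (auto simp: f_def)
  have P1nz: "\<not> int p dvd P1"
  proof -
    have "\<not> int p dvd fact (N - 1)"
      using prime_dvd_fact_iff[OF prime_p, of "N - 1"] p_N by (metis of_nat_dvd_iff of_nat_fact
          diff_le_self le_add1 mult_2 not_less_eq_eq order_trans Suc_eq_plus1)
    then show ?thesis using c(1) cong_dvd_iff by blast
  qed
  have fnz: "\<not> int p dvd f"
    unfolding f_def using prime_dvd_fact_iff[OF prime_p, of "p - 1"] p_ge_5
    by (metis One_nat_def diff_less le_zero_eq less_le_trans of_nat_dvd_iff of_nat_fact
        linorder_not_less prime_gt_0_nat prime_p zero_less_one)
  have "S N = of_int (2 * int p * int p * f * P2 * P3 * fact N) / of_int (2 * (int p * f * P1) * f * (int p * f))"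
    unfolding S_fact fl f3 f6 f2 by simp
  also have "\<dots> = of_int (P2 * P3 * fact N) / of_int (P1 * f * f)"
    using pf by (simp add: field_simps)
  finally have "S N = of_int (P2 * P3 * fact N) / of_int (P1 * f * f)" .
  moreover have "P1 * f * f \<noteq> 0" using P1nz pf by auto
  ultimately have "of_int (4 * (P1 * f * f)) * S N = of_int (4 * (P2 * P3 * fact N))" by simp
  then have SN: "of_int (4 * (P1 * f * f)) * of_rat (S N) = (of_int (4 * (P2 * P3 * fact N)) :: complex)"
    by (metis of_rat_mult of_rat_of_int_eq)
  have "[4 * (P2 * P3 * fact N) = 4 * (f * fact (p - 3) * fact N)] (mod int p)"
    by (intro cong_mult c cong_refl)
  also have "4 * (f * fact (p - 3) * fact N) = (4 * int N) * (f * fact (p - 3) * fact (N - 1))"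
    using N2 by (simp add: fact_reduce[of N])
  also have "[\<dots> = - ((int p - 1) * (int p - 2)) * (f * fact (p - 3) * fact (N - 1))] (mod int p)"
  proof (intro cong_mult cong_refl)
    have "4 * int N - (- ((int p - 1) * (int p - 2))) = int p * (int p - 1)"
      by (simp add: p_N algebra_simps)
    then show "[4 * int N = - ((int p - 1) * (int p - 2))] (mod int p)" by (simp add: cong_iff_dvd_diff)
  qed
  also have "- ((int p - 1) * (int p - 2)) * (f * fact (p - 3) * fact (N - 1)) = - (fact (N - 1) * f * f)"
  proof -
    have feq: "(int p - 1) * ((int p - 2) * fact (p - 3)) = f"
    proof -
      have "p - 1 = Suc (Suc (p - 3))" using p_ge_5 by simp
      then have "f = int (Suc (Suc (p - 3))) * (int (Suc (p - 3)) * fact (p - 3))"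
        unfolding f_def by (simp only: fact_Suc of_nat_id)
      moreover have "int (Suc (Suc (p - 3))) = int p - 1" "int (Suc (p - 3)) = int p - 2" using p_ge_5 by auto
      ultimately show ?thesis by simp
    qed
    have "- ((int p - 1) * (int p - 2)) * (f * fact (p - 3) * fact (N - 1))
        = - (fact (N - 1) * f * ((int p - 1) * ((int p - 2) * fact (p - 3))))"
      by (simp add: mult_ac)
    then show ?thesis unfolding feq .
  qed
  also have "[- (fact (N - 1) * f * f) = - (P1 * f * f)] (mod int p)"
    using c(1) by (intro cong_minus_minus_iff[THEN iffD2] cong_mult cong_refl) (rule cong_sym)
  finally have "lcong (of_int (4 * (P2 * P3 * fact N))) (of_int (- (P1 * f * f)))" by (rule lcong_of_int)
  then have "lcong (of_int (4 * (P1 * f * f)) * of_rat (S N)) (of_int (4 * (P1 * f * f)) * (- 1 / 4))"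
    unfolding SN by simp
  then show ?thesis
    by (rule lcong_cancel_of_int) (intro not_p_dvd_mult not_p_dvd_4 P1nz fnz)
qed

text \<open>
  The recurrence for \<open>S\<close> degenerates modulo \<open>p\<close> at \<open>N = (p - 1) / 2\<close>. So the residues of \<open>S\<close> fall into
  two blocks, one governed by \<open>S 0\<close> and one by \<open>S N\<close>. The first one is described by a polynomial of degree \<open>low_index\<close>, where
  \<open>2 * low_index + 1\<close> is the odd integer congruent to \<open>res_sign * 2 / 3\<close>.
\<close>

definition low_index :: nat where "low_index = (if p = 6 * h + 1 then h else h - 1)"

definition res_sign :: int where "res_sign = (if p = 6 * h + 1 then 1 else -1)"

lemma low_index_sg_eq:
  "p = 6 * h + 1 \<Longrightarrow> low_index = h" "p = 6 * h + 1 \<Longrightarrow> res_sign = 1"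
  "p \<noteq> 6 * h + 1 \<Longrightarrow> low_index = h - 1" "p \<noteq> 6 * h + 1 \<Longrightarrow> res_sign = - 1"
  unfolding low_index_def res_sign_def by (rule if_P if_not_P, assumption)+

lemma res_sign_nn: "3 * (2 * int low_index + 1) = int p + 2 * res_sign"
  using p_h h_pos by (auto simp: low_index_def res_sign_def)

lemma S_Suc_complex:
  "of_int (int (k + 1) * int (2 * k + 3)) * of_rat (S (Suc k))
    = (of_int (6 * int (6 * k + 1) * int (6 * k + 5)) * of_rat (S k) :: complex)"
  using arg_cong[OF S_Suc[of k], of "of_rat :: rat \<Rightarrow> complex"]
  by (simp only: of_rat_mult of_rat_of_nat_eq of_int_mult of_int_of_nat_eq of_rat_numeral_eq of_int_numeral)

text \<open>Both sides obey first-order recurrences with the same ratio modulo \<open>p\<close>. The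
  weight \<open>2 * k + 1\<close> turns the divisor \<open>2 * k + 3\<close> of \<open>S_Suc\<close>
  into \<open>2 * k + 1\<close>, which stays prime to \<open>p\<close> up to the last step.\<close>

lemma S_low:
  "k \<le> N \<Longrightarrow> lcong (of_nat (2 * k + 1) * of_rat (S k))
     (1 / 2 * (- 432) ^ k * of_nat ((low_index + k) choose (2 * k)))"
proof (induction k)
  case 0
  then show ?case by (simp add: S_def of_rat_divide)
next
  case (Suc k)
  define g where "g k = (of_nat ((low_index + k) choose (2 * k)) :: complex)" for k
  define T where "T k = of_nat (2 * k + 1) * (of_rat (S k) :: complex)" for k
  let ?u = "int (k + 1) * int (2 * k + 1)" and ?a = "2 * int low_index + 1"
  let ?R = "1 / 2 * (- 432) ^ k * g k"
  have Rloc: "?R \<in> loc" unfolding g_def by (intro loc_mult loc_power half_quarter_loc loc_uminus) auto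
  have T: "of_int ?u * T (Suc k) = of_int (6 * int (6 * k + 1) * int (6 * k + 5)) * T k"
  proof -
    have "of_int ?u * T (Suc k) = of_nat (2 * k + 1) * (of_int (int (k + 1) * int (2 * k + 3)) * of_rat (S (Suc k)))"
      by (simp add: T_def mult_ac numeral_3_eq_3 del: of_nat_Suc of_nat_add)
    also have "\<dots> = of_int (6 * int (6 * k + 1) * int (6 * k + 5)) * T k"
      unfolding S_Suc_complex T_def by (simp only: mult_ac)
    finally show ?thesis .
  qed
  have G: "of_int ?u * (1 / 2 * (- 432) ^ Suc k * g (Suc k)) = of_int (-54 * (?a\<^sup>2 - (2 * int k + 1)\<^sup>2)) * ?R"
  proof -
    have "of_nat ((2 * k + 1) * (2 * k + 2)) * g (Suc k)
        = (of_nat (low_index + k) + 1) * (of_nat (low_index + k) - of_nat (2 * k)) * g k"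
      unfolding g_def using choose_plus_two_rec[of "2 * k" "low_index + k"] by (simp del: binomial_Suc_Suc)
    then have e: "(- 216) * (- 432) ^ k * (1 / 2) * (of_nat ((2 * k + 1) * (2 * k + 2)) * g (Suc k))
        = (- 216) * (- 432) ^ k * (1 / 2) * ((of_nat (low_index + k) + 1) * (of_nat (low_index + k) - of_nat (2 * k)) * g k)"
      by (rule arg_cong)
    have l: "(- 216) * (- 432) ^ k * (1 / 2) * (of_nat ((2 * k + 1) * (2 * k + 2)) * g (Suc k))
        = of_int ?u * (1 / 2 * (- 432) ^ Suc k * g (Suc k))"
      by (simp add: algebra_simps)
    have r: "(- 216) * (- 432) ^ k * (1 / 2) * ((of_nat (low_index + k) + 1) * (of_nat (low_index + k) - of_nat (2 * k)) * g k)
        = of_int (-54 * (?a\<^sup>2 - (2 * int k + 1)\<^sup>2)) * ?R"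
      by (simp add: algebra_simps power2_eq_square)
    show ?thesis unfolding l[symmetric] r[symmetric] by (rule e)
  qed
  have "6 * int (6 * k + 1) * int (6 * k + 5) - (-54 * (?a\<^sup>2 - (2 * int k + 1)\<^sup>2)) = 6 * ((3 * ?a)\<^sup>2 - 4)"
    by (simp add: algebra_simps power2_eq_square)
  \<comment> \<open>Here \<open>3 * ?a = p + 2 * res_sign\<close>, so its square is \<open>4\<close>
    modulo \<open>p\<close>.\<close>
  also have "(3 * ?a)\<^sup>2 - 4 = int p * (int p + 4 * res_sign)"
    unfolding res_sign_nn by (simp add: res_sign_def algebra_simps power2_eq_square)
  finally have cg: "[6 * int (6 * k + 1) * int (6 * k + 5) = -54 * (?a\<^sup>2 - (2 * int k + 1)\<^sup>2)] (mod int p)"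
    by (simp add: cong_iff_dvd_diff)
  have "lcong (of_int ?u * T (Suc k)) (of_int ?u * (1 / 2 * (- 432) ^ Suc k * g (Suc k)))"
    unfolding T G using Suc by (intro lcong_of_int_mult[OF cg _ Rloc]) (simp add: T_def g_def)
  then have "lcong (T (Suc k)) (1 / 2 * (- 432) ^ Suc k * g (Suc k))"
    using Suc.prems p_N by (elim lcong_cancel_of_int) (intro not_p_dvd_mult not_p_dvd_nat; simp)
  then show ?case by (simp add: T_def g_def)
qed

text \<open>Dividing \<open>S_low\<close> by \<open>2 * k + 1\<close> through
  \<open>Useq_add\<close> leaves \<open>1 / (2 * low_index + 1)\<close>, which is
  \<open>3 / 2 * res_sign\<close> modulo \<open>p\<close>; together with the \<open>1 / 2\<close> of
  \<open>S_low\<close> this makes \<open>3 / 4\<close>.\<close>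

lemma S_low':
  assumes "k < N"
  shows "lcong (of_rat (S k))
     (3 / 4 * of_int res_sign * (- 432) ^ k * (of_nat (Useq (low_index + 1) k) + of_nat (Useq low_index k)))"
proof -
  let ?e = "of_nat (Useq (low_index + 1) k) + of_nat (Useq low_index k) :: complex"
  let ?g = "of_nat ((low_index + k) choose (2 * k)) :: complex"
  have gl: "1 / 2 * (- 432) ^ k * ?g \<in> loc"
    by (intro loc_mult loc_power half_quarter_loc loc_uminus) auto
  have "res_sign * (3 * (2 * int low_index + 1)) * 2 - 4 = 2 * res_sign * int p"
    unfolding res_sign_nn by (simp add: res_sign_def algebra_simps)
  then have cg: "[4 = res_sign * (3 * (2 * int low_index + 1)) * 2] (mod int p)"
    by (metis cong_iff_dvd_diff cong_sym dvd_triv_right)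
  have "lcong (of_int 4 * (of_nat (2 * k + 1) * of_rat (S k)))
      (of_int (res_sign * (3 * (2 * int low_index + 1)) * 2) * (1 / 2 * (- 432) ^ k * ?g))"
    using assms by (intro lcong_of_int_mult[OF cg _ gl] S_low) simp
  also have "of_int (res_sign * (3 * (2 * int low_index + 1)) * 2) * (1 / 2 * (- 432) ^ k * ?g)
      = 3 * of_int res_sign * (- 432) ^ k * (of_nat (2 * low_index + 1) * ?g)"
    by (simp add: mult_ac)
  also have "\<dots> = of_int (4 * int (2 * k + 1)) * (3 / 4 * of_int res_sign * (- 432) ^ k * ?e)"
    unfolding Useq_add[symmetric] by (simp del: of_nat_add of_nat_mult of_nat_Suc)
  also have "of_int 4 * (of_nat (2 * k + 1) * of_rat (S k))
      = of_int (4 * int (2 * k + 1)) * (of_rat (S k) :: complex)"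
    by simp
  finally show ?thesis
    using assms p_N by (elim lcong_cancel_of_int) (intro not_p_dvd_mult not_p_dvd_4 not_p_dvd_nat; simp)
qed

lemma Vseq_loc: "Vseq m j \<in> loc"
  unfolding Vseq_def by (intro loc_diff) auto

text \<open>At \<open>k = N + j\<close> the ratio in \<open>S_Suc\<close> becomes modulo
  \<open>p\<close> that of \<open>Vseq m\<close> with \<open>m\<^sup>2 = 1 / 9\<close>, scaled by
  \<open>- 432\<close>. The choice \<open>m = 2 * h\<close> fits because \<open>6 * h\<close> is
  \<open>1\<close> or \<open>- 1\<close> modulo \<open>p\<close>, and \<open>- 1 / 8\<close> comes
  from \<open>S_half\<close> and \<open>Vseq m 0 = 2\<close>.\<close>

lemma S_high:
  "j \<le> N \<Longrightarrow> lcong (of_rat (S (N + j))) (- 1 / 8 * (- 432) ^ j * Vseq (2 * h) j)"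
proof (induction j)
  case 0
  then show ?case using S_half Vseq_0[of "2 * h"] h_pos by simp
next
  case (Suc j)
  let ?f = "Vseq (2 * h)" and ?k = "N + j" and ?P = "int p"
  let ?R = "\<lambda>j. - 1 / 8 * (- 432) ^ j * ?f j"
  have Rloc: "?R j \<in> loc" for j
  proof -
    have "1 / 8 * (- ((- 432) ^ j * ?f j)) \<in> loc"
      by (intro loc_mult loc_uminus loc_power half_quarter_loc Vseq_loc loc_numeral)
    then show ?thesis by simp
  qed
  let ?u = "2 * (int (?k + 1) * int (2 * ?k + 3))"
  have Sk: "of_int ?u * (of_rat (S (Suc ?k)) :: complex)
      = of_int (2 * (6 * int (6 * ?k + 1) * int (6 * ?k + 5))) * of_rat (S ?k)"
    using S_Suc_complex[of ?k] by (simp only: of_int_mult mult.assoc)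
  have N2: "2 * int N = ?P - 1" using p_N by simp
  have "2 * int (?k + 1) = ?P + (2 * int j + 1)" "int (2 * ?k + 3) = ?P + (2 * int j + 2)"
    "int (6 * ?k + 1) = 3 * ?P + (6 * int j - 2)" "int (6 * ?k + 5) = 3 * ?P + (6 * int j + 2)"
    using N2 by simp_all
  then have c1: "[?u = (2 * int j + 1) * (2 * int j + 2)] (mod ?P)"
    and c2: "[2 * (6 * int (6 * ?k + 1) * int (6 * ?k + 5)) = 12 * ((6 * int j - 2) * (6 * int j + 2))] (mod ?P)"
  proof -
    assume e: "2 * int (?k + 1) = ?P + (2 * int j + 1)" "int (2 * ?k + 3) = ?P + (2 * int j + 2)"
      "int (6 * ?k + 1) = 3 * ?P + (6 * int j - 2)" "int (6 * ?k + 5) = 3 * ?P + (6 * int j + 2)"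
    have "?u = (?P + (2 * int j + 1)) * (?P + (2 * int j + 2))"
      unfolding e[symmetric] by (simp only: mult.assoc)
    moreover have "[\<dots> = (2 * int j + 1) * (2 * int j + 2)] (mod ?P)"
      by (intro cong_mult) (simp_all add: cong_iff_dvd_diff)
    ultimately show "[?u = (2 * int j + 1) * (2 * int j + 2)] (mod ?P)" by simp
    have "2 * (6 * int (6 * ?k + 1) * int (6 * ?k + 5)) = 12 * ((3 * ?P + (6 * int j - 2)) * (3 * ?P + (6 * int j + 2)))"
      unfolding e by simp
    moreover have "[\<dots> = 12 * ((6 * int j - 2) * (6 * int j + 2))] (mod ?P)"
      by (intro cong_mult cong_refl) (simp_all add: cong_iff_dvd_diff)
    ultimately show "[2 * (6 * int (6 * ?k + 1) * int (6 * ?k + 5)) = 12 * ((6 * int j - 2) * (6 * int j + 2))] (mod ?P)"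
      by (simp only:)
  qed
  have "12 * ((6 * int j - 2) * (6 * int j + 2)) - (- 432) * ((int (2 * h))\<^sup>2 - (int j)\<^sup>2) = 48 * ((6 * int h)\<^sup>2 - 1)"
    by (simp add: algebra_simps power2_eq_square)
  also have "6 * int h = ?P - res_sign" using p_h by (auto simp: res_sign_def)
  also have "(?P - res_sign)\<^sup>2 - 1 = ?P * (?P - 2 * res_sign)" by (simp add: res_sign_def algebra_simps power2_eq_square)
  finally have c3: "[12 * ((6 * int j - 2) * (6 * int j + 2)) = (- 432) * ((int (2 * h))\<^sup>2 - (int j)\<^sup>2)] (mod ?P)"
    by (simp add: cong_iff_dvd_diff)
  have F: "of_int ((2 * int j + 1) * (2 * int j + 2)) * ?R (Suc j)
      = of_int ((- 432) * ((int (2 * h))\<^sup>2 - (int j)\<^sup>2)) * ?R j"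
  proof -
    have "of_nat ((2 * j + 1) * (2 * j + 2)) * ?f (Suc j) = (of_nat (2 * h) ^ 2 - of_nat j ^ 2) * ?f j"
      using h_pos by (intro Vseq_rec) simp
    then have e: "(- 1 / 8 * (- 432) ^ Suc j) * (of_nat ((2 * j + 1) * (2 * j + 2)) * ?f (Suc j))
      = (- 1 / 8 * (- 432) ^ Suc j) * ((of_nat (2 * h) ^ 2 - of_nat j ^ 2) * ?f j)" by (rule arg_cong)
    have l: "of_int ((2 * int j + 1) * (2 * int j + 2)) * ?R (Suc j)
        = (- 1 / 8 * (- 432) ^ Suc j) * (of_nat ((2 * j + 1) * (2 * j + 2)) * ?f (Suc j))"
      by (simp add: algebra_simps)
    have r: "of_int ((- 432) * ((int (2 * h))\<^sup>2 - (int j)\<^sup>2)) * ?R j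
        = (- 1 / 8 * (- 432) ^ Suc j) * ((of_nat (2 * h) ^ 2 - of_nat j ^ 2) * ?f j)"
      by (simp add: algebra_simps)
    show ?thesis unfolding l r by (rule e)
  qed
  have "lcong (of_int ?u * of_rat (S (Suc ?k))) (of_int ((- 432) * ((int (2 * h))\<^sup>2 - (int j)\<^sup>2)) * ?R j)"
    unfolding Sk using Suc by (intro lcong_of_int_mult[OF cong_trans[OF c2 c3] _ Rloc]) simp
  also have "lcong (of_int ((- 432) * ((int (2 * h))\<^sup>2 - (int j)\<^sup>2)) * ?R j) (of_int ?u * ?R (Suc j))"
    unfolding F[symmetric] by (intro lcong_of_int_mult[OF cong_sym[OF c1] _ Rloc] lcong_refl)
  finally have *: "lcong (of_int ?u * of_rat (S (Suc ?k))) (of_int ?u * ?R (Suc j))" .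
  have "\<not> ?P dvd int (2 * ?k + 3)"
  proof
    assume "?P dvd int (2 * ?k + 3)"
    moreover have "int (2 * ?k + 3) = ?P + int (2 * j + 2)" using N2 by simp
    ultimately have "?P dvd int (2 * j + 2)" by (simp only: dvd_add_triv_left_iff)
    then show False using Suc.prems p_N not_p_dvd_nat[of "2 * j + 2"] by simp
  qed
  moreover have "\<not> ?P dvd int (?k + 1)" using Suc.prems p_N by (intro not_p_dvd_nat) simp_all
  ultimately have "\<not> ?P dvd ?u" by (intro not_p_dvd_mult not_p_dvd_2)
  from lcong_cancel_of_int[OF * this] show ?case by simp
qed

end

subsection \<open>The truncated generating functions modulo p\<close>

lemma sum_lessThan_add: "(\<Sum>k<n + m. f k) = (\<Sum>k<n. f k) + (\<Sum>j<m. f (n + j))"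
  for f :: "nat \<Rightarrow> 'a::comm_monoid_add"
  by (induction m) (simp_all add: add.assoc)

context prime_six
begin

lemma sum_split: "(\<Sum>k=0..p-1. f k) = (\<Sum>k<N. f k) + (\<Sum>j<Suc N. f (N + j))"
  for f :: "nat \<Rightarrow> 'a::comm_monoid_add"
proof -
  have "{0..p-1} = {..<N + Suc N}" using p_N by auto
  then show ?thesis using sum_lessThan_add[of f N "Suc N"] by simp
qed

lemma low_index_less: "low_index < N" and two_h_le: "2 * h \<le> N"
proof -
  show "low_index < N"
  proof (cases "p = 6 * h + 1")
    case True
    then show ?thesis unfolding low_index_sg_eq(1)[OF True] using p_N h_pos by simp
  next
    case False
    then show ?thesis unfolding low_index_sg_eq(3)[OF False] using p_h p_N h_pos by simp
  qed
  show "2 * h \<le> N" using p_h p_N h_pos by presburger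
qed

text \<open>For \<open>r * y = 1\<close> this is the power of \<open>r\<close> with exponent \<open>h\<close> or \<open>- h\<close>, according to \<open>p\<close> modulo \<open>6\<close>.\<close>

definition twist_power :: "complex \<Rightarrow> complex \<Rightarrow> complex" where
  "twist_power r y = (if p = 6 * h + 1 then r ^ h else y ^ h)"

context
  fixes r y z :: complex
  assumes ry: "r * y = 1" and r1: "r \<noteq> 1" and rm1: "r \<noteq> - 1" and z: "z \<in> loc" and r: "r \<in> loc"
    and v: "r + y - 2 = - 432 * z"
begin

lemma y1: "1 - y \<noteq> 0" "1 + y \<noteq> 0" "r - y \<noteq> 0"
proof -
  show a: "1 - y \<noteq> 0" using ry r1 by auto
  show b: "1 + y \<noteq> 0"
  proof
    assume "1 + y = 0"
    then have "y = - 1" by (simp add: add_eq_0_iff)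
    then show False using ry rm1 by (metis minus_equation_iff mult_minus1_right)
  qed
  have "r - y = (r - 1) * (1 + y)" using ry by (simp add: algebra_simps)
  then show "r - y \<noteq> 0" using r1 b by auto
qed

text \<open>For \<open>r = exp (2 i \<theta>)\<close> and \<open>n = low_index\<close> this sum is
  \<open>sin ((2 n + 1) \<theta>) / sin \<theta>\<close>, the next one is
  \<open>cos ((2 n + 1) \<theta>) / cos \<theta>\<close>, and \<open>sum_f\<close> is
  \<open>2 cos (4 h \<theta>)\<close>. Each follows from \<open>Useq_sum\<close> by cancelling a
  factor of \<open>r - y\<close>.\<close>

lemma sum_e: "(\<Sum>k<N. (of_nat (Useq (low_index + 1) k) + of_nat (Useq low_index k)) * (r + y - 2) ^ k) * (r - 1) = r ^ (low_index + 1) - y ^ low_index"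
proof -
  let ?E = "\<Sum>k<N. (of_nat (Useq (low_index + 1) k) + of_nat (Useq low_index k)) * (r + y - 2) ^ k"
  have "?E * (r - y) = (r ^ (low_index + 1) - y ^ (low_index + 1)) + (r ^ low_index - y ^ low_index)"
    using Useq_sum[OF ry, of "low_index + 1" N] Useq_sum[OF ry, of low_index N] low_index_less
    by (simp add: distrib_right sum.distrib)
  moreover have "r - y = (r - 1) * (1 + y)" using ry by (simp add: algebra_simps)
  moreover have "(r ^ (low_index + 1) - y ^ (low_index + 1)) + (r ^ low_index - y ^ low_index) = (r ^ (low_index + 1) - y ^ low_index) * (1 + y)"
  proof -
    have "r ^ (low_index + 1) * y = r ^ low_index" using ry by (simp add: mult.assoc mult.commute[of r])
    then show ?thesis by (simp add: algebra_simps)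
  qed
  ultimately have "?E * (r - 1) * (1 + y) = (r ^ (low_index + 1) - y ^ low_index) * (1 + y)" by (simp add: mult.assoc)
  then show ?thesis using y1(2) by (simp only: mult_cancel_right) blast
qed

lemma sum_g: "(\<Sum>k<N. of_nat ((low_index + k) choose (2 * k)) * (r + y - 2) ^ k) * (r + 1) = r ^ (low_index + 1) + y ^ low_index"
proof -
  let ?E = "\<Sum>k<N. of_nat ((low_index + k) choose (2 * k)) * (r + y - 2) ^ k"
  have "?E * (r - y) = (r ^ (low_index + 1) - y ^ (low_index + 1)) - (r ^ low_index - y ^ low_index)"
    using Useq_sum[OF ry, of "low_index + 1" N] Useq_sum[OF ry, of low_index N] low_index_less
    unfolding Useq_diff by (simp add: left_diff_distrib sum_subtractf)
  moreover have "r - y = (r + 1) * (1 - y)" using ry by (simp add: algebra_simps)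
  moreover have "(r ^ (low_index + 1) - y ^ (low_index + 1)) - (r ^ low_index - y ^ low_index) = (r ^ (low_index + 1) + y ^ low_index) * (1 - y)"
  proof -
    have "r ^ (low_index + 1) * y = r ^ low_index" using ry by (simp add: mult.assoc mult.commute[of r])
    then show ?thesis by (simp add: algebra_simps)
  qed
  ultimately have "?E * (r + 1) * (1 - y) = (r ^ (low_index + 1) + y ^ low_index) * (1 - y)" by (simp add: mult.assoc)
  then show ?thesis using y1(1) by (simp only: mult_cancel_right) blast
qed

lemma sum_f: "(\<Sum>j<Suc N. Vseq (2 * h) j * (r + y - 2) ^ j) = r ^ (2 * h) + y ^ (2 * h)"
proof -
  let ?E = "\<Sum>j<Suc N. Vseq (2 * h) j * (r + y - 2) ^ j"
  obtain m where m: "2 * h = Suc m" using h_pos by (cases "2 * h") auto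
  have "?E * (r - y) = (r ^ (2 * h + 1) - y ^ (2 * h + 1)) - (r ^ (2 * h - 1) - y ^ (2 * h - 1))"
    using Useq_sum[OF ry, of "2 * h + 1" "Suc N"] Useq_sum[OF ry, of "2 * h - 1" "Suc N"] two_h_le
    unfolding Vseq_def left_diff_distrib sum_subtractf by simp
  also have "\<dots> = (r ^ (2 * h) + y ^ (2 * h)) * (r - y)"
  proof -
    have "r ^ Suc m * y = (r * y) * r ^ m" "y ^ Suc m * r = (r * y) * y ^ m"
      by (simp_all add: mult_ac)
    then have "r ^ Suc m * y = r ^ m" "y ^ Suc m * r = y ^ m" by (simp_all only: ry mult_1)
    then have "(r ^ Suc m + y ^ Suc m) * (r - y) = r ^ Suc m * r - r ^ m + y ^ m - y ^ Suc m * y"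
      by (simp only: distrib_right right_diff_distrib) simp
    then show ?thesis unfolding m by (simp add: mult_ac)
  qed
  finally show ?thesis using y1(3) by (simp only: mult_cancel_right) blast
qed

text \<open>Gives both residue classes of \<open>p\<close> one formula. For
  \<open>p = 6 h - 1\<close> the index is \<open>h - 1\<close>, and
  \<open>y ^ (h - 1) = r * y ^ h\<close>; the two powers swap roles and \<open>res_sign\<close>
  corrects the sign.\<close>

lemma twist_facts:
  "of_int res_sign * (r ^ (low_index + 1) - y ^ low_index) = r * twist_power r y - twist_power y r" "r ^ (low_index + 1) + y ^ low_index = r * twist_power r y + twist_power y r"
  "r ^ (2 * h) + y ^ (2 * h) = (twist_power r y)\<^sup>2 + (twist_power y r)\<^sup>2" "of_int res_sign * (r ^ (2 * h) - y ^ (2 * h)) = (twist_power r y)\<^sup>2 - (twist_power y r)\<^sup>2"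
proof -
  obtain h' where h': "h = Suc h'" using h_pos by (cases h) auto
  have "r * y ^ Suc h' = (r * y) * y ^ h'" by (simp add: mult_ac)
  then have y: "r * y ^ h = y ^ (h - 1)" unfolding h' by (simp only: ry mult_1 diff_Suc_1)
  have e: "h - 1 + 1 = h" using h_pos by simp
  have "of_int res_sign * (r ^ (low_index + 1) - y ^ low_index) = r * twist_power r y - twist_power y r \<and> r ^ (low_index + 1) + y ^ low_index = r * twist_power r y + twist_power y r \<and>
    r ^ (2 * h) + y ^ (2 * h) = (twist_power r y)\<^sup>2 + (twist_power y r)\<^sup>2 \<and> of_int res_sign * (r ^ (2 * h) - y ^ (2 * h)) = (twist_power r y)\<^sup>2 - (twist_power y r)\<^sup>2"
  proof (cases "p = 6 * h + 1")
    case True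
    have "twist_power r y = r ^ h" "twist_power y r = y ^ h" unfolding twist_power_def by (rule if_P[OF True])+
    then show ?thesis unfolding low_index_sg_eq(1,2)[OF True]
      by (simp add: power_mult[symmetric] mult.commute)
  next
    case False
    have "twist_power r y = y ^ h" "twist_power y r = r ^ h" unfolding twist_power_def by (rule if_not_P[OF False])+
    then show ?thesis unfolding low_index_sg_eq(3,4)[OF False] e
      by (simp add: y power_mult[symmetric] mult.commute[of h])
  qed
  then show "of_int res_sign * (r ^ (low_index + 1) - y ^ low_index) = r * twist_power r y - twist_power y r" "r ^ (low_index + 1) + y ^ low_index = r * twist_power r y + twist_power y r"
    "r ^ (2 * h) + y ^ (2 * h) = (twist_power r y)\<^sup>2 + (twist_power y r)\<^sup>2" "of_int res_sign * (r ^ (2 * h) - y ^ (2 * h)) = (twist_power r y)\<^sup>2 - (twist_power y r)\<^sup>2"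
    by blast+
qed

lemma power_v: "(- 432) ^ k * z ^ k = (r + y - 2) ^ k"
  by (simp only: v power_mult_distrib)

lemma sum_S:
  "lcong ((r - 1) * (\<Sum>k=0..p-1. of_rat (S k) * z ^ k))
    (3 / 4 * (r * twist_power r y - twist_power y r) - 1 / 8 * z ^ N * (r - 1) * ((twist_power r y)\<^sup>2 + (twist_power y r)\<^sup>2))"
proof -
  let ?e = "\<lambda>k. of_nat (Useq (low_index + 1) k) + of_nat (Useq low_index k) :: complex"
  have zl: "z ^ k \<in> loc" for k using z by auto
  have low: "lcong (\<Sum>k<N. of_rat (S k) * z ^ k) (\<Sum>k<N. 3 / 4 * of_int res_sign * (?e k * (r + y - 2) ^ k))"
  proof (rule lcong_sum)
    fix k assume "k \<in> {..<N}"
    then have "lcong (z ^ k * of_rat (S k)) (z ^ k * (3 / 4 * of_int res_sign * (- 432) ^ k * ?e k))"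
      by (intro lcong_mult_left S_low' zl) simp
    then show "lcong (of_rat (S k) * z ^ k) (3 / 4 * of_int res_sign * (?e k * (r + y - 2) ^ k))"
      unfolding power_v[symmetric] by (simp add: mult_ac)
  qed
  have high: "lcong (\<Sum>j<Suc N. of_rat (S (N + j)) * z ^ (N + j))
      (\<Sum>j<Suc N. - 1 / 8 * z ^ N * (Vseq (2 * h) j * (r + y - 2) ^ j))"
  proof (rule lcong_sum)
    fix j assume "j \<in> {..<Suc N}"
    then have "lcong (z ^ (N + j) * of_rat (S (N + j))) (z ^ (N + j) * (- 1 / 8 * (- 432) ^ j * Vseq (2 * h) j))"
      by (intro lcong_mult_left S_high zl) simp
    then show "lcong (of_rat (S (N + j)) * z ^ (N + j)) (- 1 / 8 * z ^ N * (Vseq (2 * h) j * (r + y - 2) ^ j))"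
      unfolding power_v[symmetric] by (simp add: mult_ac power_add)
  qed
  have "lcong ((r - 1) * (\<Sum>k=0..p-1. of_rat (S k) * z ^ k))
     ((r - 1) * (3 / 4 * of_int res_sign * (\<Sum>k<N. ?e k * (r + y - 2) ^ k)
       + - 1 / 8 * z ^ N * (\<Sum>j<Suc N. Vseq (2 * h) j * (r + y - 2) ^ j)))"
    unfolding sum_split using lcong_add[OF low high] r
    by (intro lcong_mult_left) (auto simp only: sum_distrib_left[symmetric])
  also have "(r - 1) * (3 / 4 * of_int res_sign * (\<Sum>k<N. ?e k * (r + y - 2) ^ k)
       + - 1 / 8 * z ^ N * (\<Sum>j<Suc N. Vseq (2 * h) j * (r + y - 2) ^ j))
     = 3 / 4 * (of_int res_sign * ((\<Sum>k<N. ?e k * (r + y - 2) ^ k) * (r - 1)))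
       - 1 / 8 * z ^ N * (r - 1) * (\<Sum>j<Suc N. Vseq (2 * h) j * (r + y - 2) ^ j)"
    by (simp only: distrib_left mult_ac) simp
  finally show ?thesis unfolding sum_e sum_f twist_facts(1,3) .
qed

lemma sum_odd_S:
  "lcong ((r + 1) * (\<Sum>k=0..p-1. of_nat (2 * k + 1) * of_rat (S k) * z ^ k))
    (1 / 2 * (r * twist_power r y + twist_power y r) + 1 / 12 * z ^ N * (r - 1) * ((twist_power r y)\<^sup>2 - (twist_power y r)\<^sup>2))"
proof -
  let ?g = "\<lambda>k. of_nat ((low_index + k) choose (2 * k)) :: complex"
  let ?U = "\<lambda>k. of_nat (Useq (2 * h) k) :: complex"
  let ?v = "r + y - 2"
  have zl: "z ^ k \<in> loc" for k using z by auto
  have low: "lcong (\<Sum>k<N. of_nat (2 * k + 1) * of_rat (S k) * z ^ k) (\<Sum>k<N. 1 / 2 * (?g k * ?v ^ k))"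
  proof (rule lcong_sum)
    fix k assume "k \<in> {..<N}"
    then have "lcong (z ^ k * (of_nat (2 * k + 1) * of_rat (S k))) (z ^ k * (1 / 2 * (- 432) ^ k * ?g k))"
      by (intro lcong_mult_left S_low zl) simp
    then show "lcong (of_nat (2 * k + 1) * of_rat (S k) * z ^ k) (1 / 2 * (?g k * ?v ^ k))"
      unfolding power_v[symmetric] by (simp only: mult_ac)
  qed
  \<comment> \<open>In the upper block \<open>2 * k + 1\<close> is \<open>2 * j\<close> modulo
    \<open>p\<close>, so the term \<open>j = 0\<close> vanishes and \<open>Vseq_Suc\<close> lowers
    the index by one. The factor becomes \<open>- 6 * h / 12\<close>, which is
    \<open>res_sign / 12\<close> modulo \<open>p\<close>.\<close>
  define H where "H j = (case j of 0 \<Rightarrow> 0 | Suc i \<Rightarrow> 1 / 12 * of_int res_sign * z ^ N * ?v * (?U i * ?v ^ i))" for j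
  have high: "lcong (\<Sum>j<Suc N. of_nat (2 * (N + j) + 1) * of_rat (S (N + j)) * z ^ (N + j)) (\<Sum>j<Suc N. H j)"
  proof (rule lcong_sum)
    fix j assume j: "j \<in> {..<Suc N}"
    let ?R = "- 1 / 8 * (- 432) ^ j * Vseq (2 * h) j"
    have Rl: "?R \<in> loc"
    proof -
      have "1 / 8 * (- ((- 432) ^ j * Vseq (2 * h) j)) \<in> loc"
        by (intro loc_mult loc_uminus loc_power half_quarter_loc Vseq_loc loc_numeral)
      then show ?thesis by simp
    qed
    have c: "[int (2 * (N + j) + 1) = 2 * int j] (mod int p)"
      using p_N by (simp add: cong_iff_dvd_diff)
    have "lcong (of_int (int (2 * (N + j) + 1)) * of_rat (S (N + j))) (of_int (2 * int j) * ?R)"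
      using j by (intro lcong_of_int_mult[OF c _ Rl] S_high) simp
    then have 1: "lcong (z ^ (N + j) * (of_int (int (2 * (N + j) + 1)) * of_rat (S (N + j))))
       (z ^ (N + j) * (of_int (2 * int j) * ?R))" by (intro lcong_mult_left zl)
    have 2: "lcong (z ^ (N + j) * (of_int (2 * int j) * ?R)) (H j)"
    proof (cases j)
      case 0
      then show ?thesis by (simp add: H_def)
    next
      case (Suc i)
      have "of_int (2 * int j) * ?R = - 1 / 4 * (- 432) ^ j * (of_nat (Suc i) * Vseq (2 * h) (Suc i))"
        unfolding Suc by simp
      also have "\<dots> = - 1 / 4 * (- 432) ^ j * (of_nat (2 * h) * ?U i)"
        using h_pos by (subst Vseq_Suc) simp_all
      finally have "z ^ (N + j) * (of_int (2 * int j) * ?R)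
          = (- of_nat (6 * h)) * (1 / 12 * (z ^ N * (((- 432) ^ j * z ^ j) * ?U i)))"
        by (simp add: power_add)
      also have "\<dots> = of_int (- int (6 * h)) * (1 / 12 * (z ^ N * (?v ^ j * ?U i)))"
        unfolding power_v by simp
      also have "lcong \<dots> (of_int res_sign * (1 / 12 * (z ^ N * (?v ^ j * ?U i))))"
      proof (rule lcong_of_int_mult)
        have "- int (6 * h) - res_sign = - int p" using p_h by (auto simp: res_sign_def)
        then show "[- int (6 * h) = res_sign] (mod int p)" by (simp add: cong_iff_dvd_diff)
        show "1 / 12 * (z ^ N * (?v ^ j * ?U i)) \<in> loc"
          unfolding v using z by (intro loc_mult loc_power half_quarter_loc loc_uminus loc_numeral loc_of_nat)
      qed simp
      also have "of_int res_sign * (1 / 12 * (z ^ N * (?v ^ j * ?U i))) = H j"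
        by (simp add: H_def Suc)
      finally show ?thesis .
    qed
    show "lcong (of_nat (2 * (N + j) + 1) * of_rat (S (N + j)) * z ^ (N + j)) (H j)"
      using lcong_trans[OF 1 2] by (simp add: mult_ac)
  qed
  have sumH: "(\<Sum>j<Suc N. H j) = 1 / 12 * of_int res_sign * z ^ N * ?v * (\<Sum>i<N. ?U i * ?v ^ i)"
    by (subst sum.lessThan_Suc_shift) (simp add: H_def sum_distrib_left)
  have "lcong ((r + 1) * (\<Sum>k=0..p-1. of_nat (2 * k + 1) * of_rat (S k) * z ^ k))
     ((r + 1) * (1 / 2 * (\<Sum>k<N. ?g k * ?v ^ k)
       + 1 / 12 * of_int res_sign * z ^ N * ?v * (\<Sum>i<N. ?U i * ?v ^ i)))"
    unfolding sum_split using lcong_add[OF low high] r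
    by (intro lcong_mult_left) (auto simp only: sumH sum_distrib_left[symmetric])
  also have "(r + 1) * (1 / 2 * (\<Sum>k<N. ?g k * ?v ^ k)
       + 1 / 12 * of_int res_sign * z ^ N * ?v * (\<Sum>i<N. ?U i * ?v ^ i))
     = 1 / 2 * ((\<Sum>k<N. ?g k * ?v ^ k) * (r + 1))
       + 1 / 12 * z ^ N * (of_int res_sign * (((r + 1) * ?v) * (\<Sum>i<N. ?U i * ?v ^ i)))"
    by (simp only: distrib_left mult_ac)
  also have "(r + 1) * ?v = (r - 1) * (r - y)"
    using ry by (simp add: algebra_simps)
  also have "of_int res_sign * ((r - 1) * (r - y) * (\<Sum>i<N. ?U i * ?v ^ i))
     = (r - 1) * (of_int res_sign * ((\<Sum>i<N. ?U i * ?v ^ i) * (r - y)))"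
    by (simp only: mult_ac)
  also have "(\<Sum>i<N. ?U i * ?v ^ i) * (r - y) = r ^ (2 * h) - y ^ (2 * h)"
    by (rule Useq_sum[OF ry two_h_le])
  finally show ?thesis unfolding sum_g twist_facts(2,4) by (simp only: mult.assoc)
qed

text \<open>The sign \<open>\<epsilon>\<close> enters the lower block through the twisted powers and
  the upper block through \<open>z ^ N\<close>, where the twisted powers are squared. Multiplying by
  \<open>\<epsilon>\<close> clears it from both. \<open>T\<close> is a proposed value, to be checked
  by an exact identity.\<close>

lemma sum_S_eval:
  assumes eps: "\<epsilon> = 1 \<or> \<epsilon> = (- 1 :: int)" and zN: "lcong (z ^ N) (of_int \<epsilon>)"
    and s: "lcong (twist_power r y) (of_int \<epsilon> * w)" "lcong (twist_power y r) (of_int \<epsilon> * w')"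
    and w: "w \<in> loc" "w' \<in> loc" "w * w = w'" "w' * w' = w"
    and inv: "inverse (r - 1) \<in> loc"
    and T: "(r - 1) * T = 3 / 4 * (r * w - w') - 1 / 8 * (r - 1) * (w + w')"
  shows "T \<in> loc" "lcong (of_int \<epsilon> * (\<Sum>k=0..p-1. of_rat (S k) * z ^ k)) T"
proof -
  have r10: "r - 1 \<noteq> 0" using r1 by simp
  have "(r - 1) * T \<in> loc" unfolding T using r w
    by (intro loc_diff loc_mult loc_add half_quarter_loc loc_numeral)
  then have "inverse (r - 1) * ((r - 1) * T) \<in> loc" using inv by blast
  then show "T \<in> loc" using r10 by (simp add: mult.assoc[symmetric])
  have el: "of_int \<epsilon> \<in> loc" by simp
  let ?F = "\<Sum>k=0..p-1. of_rat (S k) * z ^ k" and ?e = "of_int \<epsilon> :: complex"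
  have "lcong (3 / 4 * (r * twist_power r y - twist_power y r) - 1 / 8 * z ^ N * (r - 1) * ((twist_power r y)\<^sup>2 + (twist_power y r)\<^sup>2))
    (3 / 4 * (r * (?e * w) - ?e * w') - 1 / 8 * ?e * (r - 1) * ((?e * w)\<^sup>2 + (?e * w')\<^sup>2))"
    using r w
    by (intro lcong_diff lcong_mult lcong_add lcong_power s zN lcong_refl loc_diff loc_mult
        loc_add loc_power half_quarter_loc loc_numeral el)
  with sum_S have "lcong ((r - 1) * ?F)
    (3 / 4 * (r * (?e * w) - ?e * w') - 1 / 8 * ?e * (r - 1) * ((?e * w)\<^sup>2 + (?e * w')\<^sup>2))"
    by (rule lcong_trans)
  then have "lcong (?e * ((r - 1) * ?F))
    (?e * (3 / 4 * (r * (?e * w) - ?e * w') - 1 / 8 * ?e * (r - 1) * ((?e * w)\<^sup>2 + (?e * w')\<^sup>2)))"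
    using el by (rule lcong_mult_left)
  also have "?e * (3 / 4 * (r * (?e * w) - ?e * w') - 1 / 8 * ?e * (r - 1) * ((?e * w)\<^sup>2 + (?e * w')\<^sup>2))
     = 3 / 4 * (r * w - w') - 1 / 8 * (r - 1) * (w * w + w' * w')"
    using eps by (elim disjE) (simp_all add: power2_eq_square field_simps)
  also have "\<dots> = (r - 1) * T" unfolding w T by (simp only: add.commute)
  also have "?e * ((r - 1) * ?F) = (r - 1) * (?e * ?F)" by (simp only: mult_ac)
  finally show "lcong (?e * ?F) T" by (rule lcong_cancel[OF _ inv r10])
qed

lemma sum_odd_S_eval:
  assumes eps: "\<epsilon> = 1 \<or> \<epsilon> = (- 1 :: int)" and zN: "lcong (z ^ N) (of_int \<epsilon>)"
    and s: "lcong (twist_power r y) (of_int \<epsilon> * w)" "lcong (twist_power y r) (of_int \<epsilon> * w')"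
    and w: "w \<in> loc" "w' \<in> loc" "w * w = w'" "w' * w' = w"
    and inv: "inverse (r + 1) \<in> loc"
    and T: "(r + 1) * T = 1 / 2 * (r * w + w') + 1 / 12 * (r - 1) * (w' - w)"
  shows "T \<in> loc" "lcong (of_int \<epsilon> * (\<Sum>k=0..p-1. of_nat (2 * k + 1) * of_rat (S k) * z ^ k)) T"
proof -
  have r10: "r + 1 \<noteq> 0" using rm1 by (simp add: add_eq_0_iff2)
  have "(r + 1) * T \<in> loc" unfolding T using r w
    by (intro loc_diff loc_mult loc_add half_quarter_loc loc_numeral)
  then have "inverse (r + 1) * ((r + 1) * T) \<in> loc" using inv by blast
  then show "T \<in> loc" using r10 by (simp add: mult.assoc[symmetric])
  have el: "of_int \<epsilon> \<in> loc" by simp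
  let ?F = "\<Sum>k=0..p-1. of_nat (2 * k + 1) * of_rat (S k) * z ^ k" and ?e = "of_int \<epsilon> :: complex"
  have "lcong (1 / 2 * (r * twist_power r y + twist_power y r) + 1 / 12 * z ^ N * (r - 1) * ((twist_power r y)\<^sup>2 - (twist_power y r)\<^sup>2))
    (1 / 2 * (r * (?e * w) + ?e * w') + 1 / 12 * ?e * (r - 1) * ((?e * w)\<^sup>2 - (?e * w')\<^sup>2))"
    using r w
    by (intro lcong_diff lcong_mult lcong_add lcong_power s zN lcong_refl loc_diff loc_mult
        loc_add loc_power half_quarter_loc loc_numeral el)
  with sum_odd_S have "lcong ((r + 1) * ?F)
    (1 / 2 * (r * (?e * w) + ?e * w') + 1 / 12 * ?e * (r - 1) * ((?e * w)\<^sup>2 - (?e * w')\<^sup>2))"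
    by (rule lcong_trans)
  then have "lcong (?e * ((r + 1) * ?F))
    (?e * (1 / 2 * (r * (?e * w) + ?e * w') + 1 / 12 * ?e * (r - 1) * ((?e * w)\<^sup>2 - (?e * w')\<^sup>2)))"
    using el by (rule lcong_mult_left)
  also have "?e * (1 / 2 * (r * (?e * w) + ?e * w') + 1 / 12 * ?e * (r - 1) * ((?e * w)\<^sup>2 - (?e * w')\<^sup>2))
     = 1 / 2 * (r * w + w') + 1 / 12 * (r - 1) * (w * w - w' * w')"
    using eps by (elim disjE) (simp_all add: power2_eq_square field_simps)
  also have "\<dots> = (r + 1) * T" unfolding w T by (rule refl)
  also have "?e * ((r + 1) * ?F) = (r + 1) * (?e * ?F)" by (simp only: mult_ac)
  finally show "lcong (?e * ?F) T" by (rule lcong_cancel[OF _ inv r10])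
qed

end

text \<open>The squares contribute \<open>1\<close> by Fermat's theorem, and Euler's criterion turns
  \<open>c ^ N\<close> into a sign, which is its own inverse.\<close>

lemma square_quotient_power:
  assumes "\<not> int p dvd a" "\<not> int p dvd b" "\<not> int p dvd c"
  shows "lcong (((of_int a)\<^sup>2 / ((of_int b)\<^sup>2 * of_int c)) ^ N) (of_int (Legendre c (int p)))"
proof -
  let ?e = "Legendre c (int p)" and ?z = "(of_int a)\<^sup>2 / ((of_int b)\<^sup>2 * of_int c) :: complex"
  have f: "[x ^ (2 * N) = 1] (mod int p)" if "\<not> int p dvd x" for x
    using fermat_theorem_int[OF prime_p that] p_N by simp
  have e2: "?e * ?e = 1" using assms(3) by (auto simp: Legendre_def cong_0_iff)
  have nz: "of_int b \<noteq> (0 :: complex)" "of_int c \<noteq> (0 :: complex)" using assms by auto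
  have eq: "of_int (b ^ (2 * N) * c ^ N) * ?z ^ N = of_int (a ^ (2 * N))"
    using nz by (simp add: power_divide power_mult_distrib power_mult[symmetric])
  have "[a ^ (2 * N) = 1] (mod int p)" by (rule f[OF assms(1)])
  also have "1 = 1 * ?e * ?e" using e2 by simp
  also have "[1 * ?e * ?e = b ^ (2 * N) * c ^ N * ?e] (mod int p)"
    by (intro cong_mult cong_refl euler_criterion_int[OF prime_p p_N] cong_sym[OF f[OF assms(2)]])
  finally have "lcong (of_int (a ^ (2 * N))) (of_int (b ^ (2 * N) * c ^ N * ?e))" by (rule lcong_of_int)
  then have "lcong (of_int (b ^ (2 * N) * c ^ N) * ?z ^ N) (of_int (b ^ (2 * N) * c ^ N) * of_int ?e)"
    unfolding eq by simp
  then show ?thesis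
    by (rule lcong_cancel_of_int) (intro not_p_dvd_mult not_p_dvd_power assms)
qed

end

subsection \<open>The congruences\<close>

lemma rat_cong_imp_dvd:
  assumes "prime q" "rat_cong a b (int q)" "of_int d * (a - b) = of_int n"
  shows "int q dvd n"
proof -
  obtain u v where uv: "quotient_of (a - b) = (u, v)" by (cases "quotient_of (a - b)")
  have v: "v > 0" "coprime u v" using quotient_of_denom_pos[OF uv] quotient_of_coprime[OF uv] .
  have qu: "int q dvd u" using assms(2) uv by (simp add: rat_cong_def)
  have "of_int v * (a - b) = of_int u" using quotient_of_div[OF uv] v(1) by simp
  then have "(of_int (d * u) :: rat) = of_int v * (of_int d * (a - b))" by (simp add: mult_ac)
  then have "(of_int (d * u) :: rat) = of_int (n * v)" by (simp add: assms(3))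
  then have "d * u = n * v" by (simp only: of_int_eq_iff)
  then have "int q dvd n * v" using qu by (metis dvd_mult)
  moreover have "\<not> int q dvd v"
    using qu v(2) assms(1) by (metis coprime_common_divisor not_prime_unit prime_nat_int_transfer)
  ultimately show ?thesis using assms(1) by (simp add: prime_dvd_mult_iff)
qed

text \<open>\<open>t_eq\<close> says that \<open>t\<close> is \<open>(- 1 - L / (3 M)) / 2\<close>
  modulo \<open>q\<close>: the residue of \<open>\<omega>\<close> at which
  \<open>(L + 3 M sqrt (-3)) / 2\<close> vanishes.\<close>

locale cubic_sums = cubic_character q t + prime_six p N h for q t p N h +
  fixes L M :: int
  assumes LM: "4 * int q = L\<^sup>2 + 27 * M\<^sup>2" and L_mod_3: "[L = 1] (mod 3)"
    and t_eq: "int q dvd 6 * M * t + L + 3 * M"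
    and p_neq_q: "p \<noteq> q" and not_p_dvd_L: "\<not> int p dvd L" and not_p_dvd_M: "\<not> int p dvd M"
begin

lemma L_nz: "L \<noteq> 0" and M_nz: "M \<noteq> 0"
  using not_p_dvd_L not_p_dvd_M by auto

lemma not_p_dvd_q: "\<not> int p dvd int q"
  using p_neq_q prime_p prime_q by (metis int_dvd_int_iff primes_dvd_imp_eq)

definition theta :: complex where "theta = 2 * omega + 1"

lemma theta_square: "theta * theta = - 3"
proof -
  have "theta * theta = 4 * omega\<^sup>2 + 4 * omega + 1" by (simp add: theta_def power2_eq_square algebra_simps)
  then show ?thesis by (simp add: omega_square)
qed

lemma theta_loc: "theta \<in> loc"
  using loc_eis_complex[of "Eis 1 2"] by (simp add: theta_def eis_complex_def algebra_simps)

definition alpha :: complex where "alpha = eis_complex jac"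
definition beta :: complex where "beta = eis_complex (eis_cnj jac)"

lemma alpha_eq: "2 * alpha = of_int L + 3 * of_int M * theta" and beta_eq: "2 * beta = of_int L - 3 * of_int M * theta"
proof -
  have j: "eis_om jac = 3 * M" "2 * eis_re jac - eis_om jac = L"
    using jac_eq[OF LM L_mod_3 L_nz t_eq] by blast+
  then have "2 * eis_re jac = L + 3 * M" by simp
  then have "2 * (of_int (eis_re jac) :: complex) = of_int (L + 3 * M)"
    by (metis of_int_mult of_int_numeral)
  then show "2 * alpha = of_int L + 3 * of_int M * theta" "2 * beta = of_int L - 3 * of_int M * theta"
    using j(1) by (simp_all add: alpha_def beta_def eis_complex_def theta_def algebra_simps)
qed

lemma alpha_times_beta: "alpha * beta = of_nat q"
  using arg_cong[OF jac_norm, of eis_complex] by (simp add: alpha_def beta_def)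

lemma alpha_nz: "alpha \<noteq> 0" and beta_nz: "beta \<noteq> 0"
  using alpha_times_beta q_gt_3 by auto

lemma alpha_loc: "alpha \<in> loc" and beta_loc: "beta \<in> loc"
  by (simp_all add: alpha_def beta_def)

lemma inverse_q_loc: "inverse (of_nat q) \<in> loc"
  using loc_inverse_of_int[OF not_p_dvd_q] by simp

lemma inverse_al_loc: "inverse alpha \<in> loc" and inverse_be_loc: "inverse beta \<in> loc"
proof -
  have "inverse alpha = beta * inverse (of_nat q)" "inverse beta = alpha * inverse (of_nat q)"
    using alpha_nz beta_nz by (simp_all add: alpha_times_beta[symmetric])
  then show "inverse alpha \<in> loc" "inverse beta \<in> loc"
    using alpha_loc beta_loc inverse_q_loc by (simp_all add: loc_mult)
qed

lemma alpha_diff: "alpha - beta = 3 * of_int M * theta" and alpha_sum: "alpha + beta = of_int L"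
proof -
  have "2 * (alpha - beta) = 2 * (3 * of_int M * theta)" "2 * (alpha + beta) = 2 * of_int L"
    unfolding right_diff_distrib distrib_left alpha_eq beta_eq by simp_all
  then show "alpha - beta = 3 * of_int M * theta" "alpha + beta = of_int L"
    by (simp_all only: mult_cancel_left) simp_all
qed

lemma alpha_diff_nz: "alpha - beta \<noteq> 0" and alpha_sum_nz: "alpha + beta \<noteq> 0"
  unfolding alpha_diff alpha_sum using M_nz L_nz theta_square by auto

lemma inverse_al_diff_loc: "inverse (alpha - beta) \<in> loc"
proof -
  \<comment> \<open>Because \<open>theta * theta = - 3\<close>, the inverse of
    \<open>3 M theta\<close> is \<open>- theta / (9 M)\<close>.\<close>
  have "inverse (alpha - beta) = - (theta * inverse (of_int (3 * 3 * M)))"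
  proof (rule inverse_unique)
    have "(alpha - beta) * - (theta * inverse (of_int (3 * 3 * M)))
        = - (theta * theta) * (3 * of_int M) * inverse (of_int (3 * 3 * M))"
      unfolding alpha_diff by (simp only: mult_ac mult_minus_left mult_minus_right)
    then show "(alpha - beta) * - (theta * inverse (of_int (3 * 3 * M))) = 1"
      unfolding theta_square using M_nz by simp
  qed
  moreover have "- (theta * inverse (of_int (3 * 3 * M))) \<in> loc"
    by (intro loc_uminus loc_mult theta_loc loc_inverse_of_int not_p_dvd_mult not_p_dvd_3 not_p_dvd_M)
  ultimately show ?thesis by simp
qed

lemma inverse_al_sum_loc: "inverse (alpha + beta) \<in> loc"
  unfolding alpha_sum by (rule loc_inverse_of_int[OF not_p_dvd_L])

definition chi_p2 :: complex where "chi_p2 = eis_complex (chi (int p) ^ 2)"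
definition chi_p :: complex where "chi_p = eis_complex (chi (int p))"

lemma chi_p_facts: "chi_p2 \<in> loc" "chi_p \<in> loc" "chi_p2 * chi_p2 = chi_p" "chi_p * chi_p = chi_p2"
proof -
  have "chi (int p) ^ 2 * chi (int p) ^ 2 = chi (int p)"
    using chi_power4[of "int p"] by (simp flip: power_add)
  then show "chi_p2 * chi_p2 = chi_p" unfolding chi_p2_def chi_p_def by (metis eis_complex_mult)
  show "chi_p * chi_p = chi_p2" unfolding chi_p2_def chi_p_def by (simp add: power2_eq_square)
qed (simp_all add: chi_p2_def chi_p_def del: eis_complex_power)

definition leg_q :: int where "leg_q = Legendre (int q) (int p)"

lemma leg_q_cases: "leg_q = 1 \<or> leg_q = - 1"
  using not_p_dvd_q by (auto simp: leg_q_def Legendre_def cong_0_iff)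

lemma power_quotients:
  "lcong ((alpha / beta) ^ h) (of_int leg_q * (if p = 6 * h + 1 then chi_p2 else chi_p))"
  "lcong ((beta / alpha) ^ h) (of_int leg_q * (if p = 6 * h + 1 then chi_p else chi_p2))"
proof -
  let ?c = "if p = 6 * h + 1 then chi (int p) ^ 2 else chi (int p)"
  have *: "rng_cong (of_nat p) (jac ^ h) (of_int leg_q * ?c * eis_cnj jac ^ h)"
    unfolding leg_q_def by (rule jac_power_mod[OF prime_p p_neq_q p_h])
  have w: "eis_complex (chi (int p) ^ 2) = chi_p2" "eis_complex (chi (int p)) = chi_p"
    "eis_complex (eis_cnj (chi (int p) ^ 2)) = chi_p" "eis_complex (eis_cnj (chi (int p))) = chi_p2"
    using chi_power4[of "int p"]
    by (simp_all add: chi_p2_def chi_p_def eis_cnj_chi flip: power_mult eis_complex_power)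
  have c: "eis_complex ?c = (if p = 6 * h + 1 then chi_p2 else chi_p)"
    "eis_complex (eis_cnj ?c) = (if p = 6 * h + 1 then chi_p else chi_p2)"
    unfolding if_distrib[of eis_complex] if_distrib[of eis_cnj] w by (rule refl)+
  from lcong_eis_complex[OF *]
  have 1: "lcong (alpha ^ h) (of_int leg_q * (if p = 6 * h + 1 then chi_p2 else chi_p) * beta ^ h)"
    unfolding eis_complex_mult c by (simp add: alpha_def beta_def)
  from lcong_eis_complex[OF rng_cong_cnj[OF *]]
  have 2: "lcong (beta ^ h) (of_int leg_q * (if p = 6 * h + 1 then chi_p else chi_p2) * alpha ^ h)"
    unfolding eis_complex_mult eis_cnj_hom c by (simp add: alpha_def beta_def)
  have "lcong (inverse beta ^ h * alpha ^ h) (inverse beta ^ h * (of_int leg_q * (if p = 6 * h + 1 then chi_p2 else chi_p) * beta ^ h))"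
    by (intro lcong_mult_left 1 loc_power inverse_be_loc)
  moreover have "inverse beta ^ h * (x * beta ^ h) = x" for x
    using beta_nz by (simp add: power_inverse)
  ultimately show "lcong ((alpha / beta) ^ h) (of_int leg_q * (if p = 6 * h + 1 then chi_p2 else chi_p))"
    by (simp only: divide_inverse power_mult_distrib mult.commute[of "inverse beta ^ h" "alpha ^ h"])
  have "lcong (inverse alpha ^ h * beta ^ h) (inverse alpha ^ h * (of_int leg_q * (if p = 6 * h + 1 then chi_p else chi_p2) * alpha ^ h))"
    by (intro lcong_mult_left 2 loc_power inverse_al_loc)
  moreover have "inverse alpha ^ h * (x * alpha ^ h) = x" for x
    using alpha_nz by (simp add: power_inverse)
  ultimately show "lcong ((beta / alpha) ^ h) (of_int leg_q * (if p = 6 * h + 1 then chi_p else chi_p2))"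
    by (simp only: divide_inverse power_mult_distrib mult.commute[of "inverse alpha ^ h" "beta ^ h"])
qed

lemma twist_pos:
  "lcong (twist_power (alpha / beta) (beta / alpha)) (of_int leg_q * chi_p2)" "lcong (twist_power (beta / alpha) (alpha / beta)) (of_int leg_q * chi_p)"
proof -
  have "lcong (twist_power (alpha / beta) (beta / alpha)) (of_int leg_q * chi_p2) \<and> lcong (twist_power (beta / alpha) (alpha / beta)) (of_int leg_q * chi_p)"
  proof (cases "p = 6 * h + 1")
    case True
    show ?thesis using power_quotients unfolding twist_power_def if_P[OF True] by blast
  next
    case False
    show ?thesis using power_quotients unfolding twist_power_def if_not_P[OF False] by blast
  qed
  then show "lcong (twist_power (alpha / beta) (beta / alpha)) (of_int leg_q * chi_p2)" "lcong (twist_power (beta / alpha) (alpha / beta)) (of_int leg_q * chi_p)"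
    by blast+
qed

text \<open>Negating the quotient costs \<open>(-1) ^ h\<close>. By \<open>three_power_half\<close>
  this is the Legendre symbol of \<open>3\<close>, which is why \<open>3 * q\<close> accompanies the
  sums in \<open>L\<close>.\<close>

lemma twist_neg:
  "lcong (twist_power (- (alpha / beta)) (- (beta / alpha))) (of_int ((-1) ^ h * leg_q) * chi_p2)"
  "lcong (twist_power (- (beta / alpha)) (- (alpha / beta))) (of_int ((-1) ^ h * leg_q) * chi_p)"
proof -
  have twist_minus: "twist_power (- a) (- b) = (-1) ^ h * twist_power a b" for a b
    unfolding twist_power_def power_minus[of a] power_minus[of b] by (rule if_distrib[symmetric])
  have m: "lcong ((-1) ^ h * x) (of_int ((-1) ^ h * leg_q) * y)" if "lcong x (of_int leg_q * y)" for x y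
  proof -
    have "(-1) ^ h \<in> loc" by (intro loc_power loc_uminus loc_numeral)
    from lcong_mult_left[OF that this] show ?thesis by (simp add: mult.assoc)
  qed
  show "lcong (twist_power (- (alpha / beta)) (- (beta / alpha))) (of_int ((-1) ^ h * leg_q) * chi_p2)"
    "lcong (twist_power (- (beta / alpha)) (- (alpha / beta))) (of_int ((-1) ^ h * leg_q) * chi_p)"
    unfolding twist_minus by (rule m[OF twist_pos(1)], rule m[OF twist_pos(2)])
qed

lemma alpha_square: "(alpha - beta) * (alpha - beta) = - 27 * of_int M * of_int M"
proof -
  have "(alpha - beta) * (alpha - beta) = 9 * of_int M * of_int M * (theta * theta)"
    unfolding alpha_diff by simp
  then show ?thesis by (simp add: theta_square)
qed

text \<open>The origin of the arguments: \<open>(alpha - beta)\<^sup>2 / (alpha * beta)\<close> is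
  \<open>- 27 M\<^sup>2 / q = - 432 * M\<^sup>2 / (16 q)\<close>, and
  \<open>- (alpha + beta)\<^sup>2 / (alpha * beta)\<close> is
  \<open>- L\<^sup>2 / q = - 432 * L\<^sup>2 / (432 q)\<close>.\<close>

lemma quotient_facts:
  "alpha / beta * (beta / alpha) = 1" "alpha / beta \<noteq> 1" "alpha / beta \<noteq> - 1" "alpha / beta \<in> loc"
  "alpha / beta + beta / alpha - 2 = - 432 * ((of_int M)\<^sup>2 / ((of_int 4)\<^sup>2 * of_int (int q)))"
  "- (alpha / beta) * - (beta / alpha) = 1" "- (alpha / beta) \<noteq> 1" "- (alpha / beta) \<noteq> - 1" "- (alpha / beta) \<in> loc"
  "- (alpha / beta) + - (beta / alpha) - 2 = - 432 * ((of_int L)\<^sup>2 / ((of_int 12)\<^sup>2 * of_int (3 * int q)))"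
proof -
  show 1: "alpha / beta * (beta / alpha) = 1" using alpha_nz beta_nz by simp
  then show "- (alpha / beta) * - (beta / alpha) = 1" by simp
  show 2: "alpha / beta \<noteq> 1" using alpha_diff_nz beta_nz by auto
  show 3: "alpha / beta \<noteq> - 1" using alpha_sum_nz beta_nz by (auto simp: field_simps)
  show "- (alpha / beta) \<noteq> 1" using 3 by (metis minus_equation_iff)
  show "- (alpha / beta) \<noteq> - 1" using 2 by simp
  show 4: "alpha / beta \<in> loc" unfolding divide_inverse by (intro loc_mult alpha_loc inverse_be_loc)
  then show "- (alpha / beta) \<in> loc" by blast
  have "alpha / beta + beta / alpha - 2 = (alpha - beta) * (alpha - beta) / (alpha * beta)"
    using alpha_nz beta_nz by (simp add: field_simps)
  then show "alpha / beta + beta / alpha - 2 = - 432 * ((of_int M)\<^sup>2 / ((of_int 4)\<^sup>2 * of_int (int q)))"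
    unfolding alpha_square alpha_times_beta by (simp add: power2_eq_square)
  have "- (alpha / beta) + - (beta / alpha) - 2 = - ((alpha + beta) * (alpha + beta)) / (alpha * beta)"
    using alpha_nz beta_nz by (simp add: field_simps)
  then show "- (alpha / beta) + - (beta / alpha) - 2 = - 432 * ((of_int L)\<^sup>2 / ((of_int 12)\<^sup>2 * of_int (3 * int q)))"
    unfolding alpha_sum alpha_times_beta by (simp add: power2_eq_square)
qed

lemma inverse_quotient_loc:
  "inverse (alpha / beta - 1) \<in> loc" "inverse (alpha / beta + 1) \<in> loc"
  "inverse (- (alpha / beta) - 1) \<in> loc" "inverse (- (alpha / beta) + 1) \<in> loc"
proof -
  have e: "alpha / beta - 1 = (alpha - beta) * inverse beta" "alpha / beta + 1 = (alpha + beta) * inverse beta"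
    using beta_nz by (simp_all add: field_simps)
  show 1: "inverse (alpha / beta - 1) \<in> loc" "inverse (alpha / beta + 1) \<in> loc"
    unfolding e inverse_mult_distrib inverse_inverse_eq
    by (intro loc_mult inverse_al_diff_loc inverse_al_sum_loc beta_loc)+
  have "- (alpha / beta) - 1 = - (alpha / beta + 1)" "- (alpha / beta) + 1 = - (alpha / beta - 1)" by simp_all
  then show "inverse (- (alpha / beta) - 1) \<in> loc" "inverse (- (alpha / beta) + 1) \<in> loc"
    unfolding inverse_minus_eq using 1 by (simp_all only: inverse_minus_eq loc_uminus)
qed

text \<open>The denominators \<open>16 q\<close> and \<open>432 q\<close> are split as
  \<open>4\<^sup>2 * q\<close> and \<open>12\<^sup>2 * (3 q)\<close> to fit
  \<open>square_quotient_power\<close>.\<close>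

definition zM :: complex where "zM = (of_int M)\<^sup>2 / ((of_int 4)\<^sup>2 * of_int (int q))"
definition zL :: complex where "zL = (of_int L)\<^sup>2 / ((of_int 12)\<^sup>2 * of_int (3 * int q))"

lemma z_loc: "zM \<in> loc" "zL \<in> loc"
proof -
  have "(of_int (M\<^sup>2) :: complex) / of_int (4\<^sup>2 * int q) \<in> loc"
    by (intro loc_divide_of_int loc_of_int not_p_dvd_mult not_p_dvd_power not_p_dvd_4 not_p_dvd_q)
  then show "zM \<in> loc" by (simp add: zM_def)
  have "(of_int (L\<^sup>2) :: complex) / of_int (12\<^sup>2 * (3 * int q)) \<in> loc"
    by (intro loc_divide_of_int loc_of_int not_p_dvd_mult not_p_dvd_power not_p_dvd_12 not_p_dvd_3 not_p_dvd_q)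
  then show "zL \<in> loc" by (simp add: zL_def)
qed

lemma Legendre_3q: "[Legendre (3 * int q) (int p) = (-1) ^ h * leg_q] (mod int p)"
proof -
  have "[Legendre (3 * int q) (int p) = 3 ^ N * int q ^ N] (mod int p)"
    using euler_criterion_int[OF prime_p p_N, of "3 * int q"] by (simp add: power_mult_distrib)
  also have "[3 ^ N * int q ^ N = (-1) ^ h * leg_q] (mod int p)"
    unfolding leg_q_def
    by (intro cong_mult three_power_half[OF prime_p p_N p_h] cong_sym[OF euler_criterion_int[OF prime_p p_N]])
  finally show ?thesis .
qed

lemma zM_power: "lcong (zM ^ N) (of_int leg_q)"
  unfolding zM_def leg_q_def
  by (rule square_quotient_power[OF not_p_dvd_M not_p_dvd_4 not_p_dvd_q])

lemma zL_power: "lcong (zL ^ N) (of_int ((-1) ^ h * leg_q))"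
  unfolding zL_def
  by (rule lcong_trans[OF square_quotient_power[OF not_p_dvd_L not_p_dvd_12
          not_p_dvd_mult[OF not_p_dvd_3 not_p_dvd_q]] lcong_of_int[OF Legendre_3q]])

lemma sign_ep_cases: "(-1) ^ h * leg_q = 1 \<or> (-1) ^ h * leg_q = - 1"
  using leg_q_cases by (cases "even h") auto

text \<open>\<open>Legendre_3q\<close> compares the two signs only modulo \<open>p\<close>, so
  exchanging them in front of a sum requires its terms to be \<open>p\<close>-integral.\<close>

lemma S_loc: "k \<le> p - 1 \<Longrightarrow> of_rat (S k) \<in> loc"
proof (cases "k < N")
  case True
  then show ?thesis
    by (intro lcong_loc[OF S_low'] loc_mult loc_add loc_power loc_uminus half_quarter_loc) auto
next
  case False
  assume "k \<le> p - 1"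
  then obtain j where j: "k = N + j" "j \<le> N" using False p_N by (metis add_diff_cancel_right' le_add_diff_inverse
        mult_2 nat_add_left_cancel_le not_less)
  have "1 / 8 * (- ((- 432) ^ j * Vseq (2 * h) j)) \<in> loc"
    by (intro loc_mult loc_uminus loc_power half_quarter_loc Vseq_loc loc_numeral)
  then show ?thesis unfolding j(1) using j(2) by (intro lcong_loc[OF S_high]) simp_all
qed

section \<open>The four sums in terms of alpha, beta and the cubic character of p\<close>

lemma of_rat_term:
  "of_rat (of_int M ^ (2 * k) / (16 * of_nat q) ^ k) = zM ^ k"
  "of_rat (of_int L ^ (2 * k) / (432 * of_nat q) ^ k) = zL ^ k"
  by (simp_all add: zM_def zL_def of_rat_divide of_rat_power of_rat_mult power_divide power_mult)

text \<open>The hypothesis on \<open>T\<close> is that of \<open>sum_S_eval\<close> with the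
  denominator of \<open>alpha / beta\<close> cleared.\<close>

lemma sum_M:
  assumes "(alpha - beta) * of_rat T = 3 / 4 * (alpha * chi_p2 - beta * chi_p) - 1 / 8 * (alpha - beta) * (chi_p2 + chi_p)"
  shows "rat_cong (of_int (Legendre (int q) (int p)) *
    (\<Sum>k=0..p-1. S k * (of_int M ^ (2 * k) / (16 * of_nat q) ^ k))) T (int p)"
proof -
  obtain r where r: "alpha / beta = r" "alpha = r * beta" using that[of "alpha / beta"] beta_nz by simp
  have "beta * ((r - 1) * of_rat T) = beta * (3 / 4 * (r * chi_p2 - chi_p) - 1 / 8 * (r - 1) * (chi_p2 + chi_p))"
    using assms unfolding r(2) by (simp add: field_simps)
  then have T: "(alpha / beta - 1) * of_rat T = 3 / 4 * (alpha / beta * chi_p2 - chi_p) - 1 / 8 * (alpha / beta - 1) * (chi_p2 + chi_p)"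
    unfolding r(1) mult_left_cancel[OF beta_nz] .
  note E = sum_S_eval[OF quotient_facts(1,2,3) z_loc(1) quotient_facts(4,5)[folded zM_def] leg_q_cases zM_power
      twist_pos chi_p_facts inverse_quotient_loc(1) T]
  show ?thesis
    using E(2) by (intro rat_cong_if_lcong[OF _ E(1)])
      (simp only: of_rat_mult of_rat_sum of_rat_of_int_eq of_rat_term leg_q_def)
qed

lemma sum_odd_M:
  assumes "(alpha + beta) * of_rat T = 1 / 2 * (alpha * chi_p2 + beta * chi_p) + 1 / 12 * (alpha - beta) * (chi_p - chi_p2)"
  shows "rat_cong (of_int (Legendre (int q) (int p)) *
    (\<Sum>k=0..p-1. of_nat (2 * k + 1) * S k * (of_int M ^ (2 * k) / (16 * of_nat q) ^ k))) T (int p)"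
proof -
  obtain r where r: "alpha / beta = r" "alpha = r * beta" using that[of "alpha / beta"] beta_nz by simp
  have "beta * ((r + 1) * of_rat T) = beta * (1 / 2 * (r * chi_p2 + chi_p) + 1 / 12 * (r - 1) * (chi_p - chi_p2))"
    using assms unfolding r(2) by (simp add: field_simps)
  then have T: "(alpha / beta + 1) * of_rat T = 1 / 2 * (alpha / beta * chi_p2 + chi_p) + 1 / 12 * (alpha / beta - 1) * (chi_p - chi_p2)"
    unfolding r(1) mult_left_cancel[OF beta_nz] .
  note E = sum_odd_S_eval[OF quotient_facts(1,2,3) z_loc(1) quotient_facts(4,5)[folded zM_def] leg_q_cases zM_power
      twist_pos chi_p_facts inverse_quotient_loc(2) T]
  show ?thesis
    using E(2) by (intro rat_cong_if_lcong[OF _ E(1)])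
      (simp only: of_rat_mult of_rat_sum of_rat_of_int_eq of_rat_of_nat_eq of_rat_term leg_q_def)
qed

lemma sum_L:
  assumes "(alpha + beta) * of_rat T = 3 / 4 * (alpha * chi_p2 + beta * chi_p) - 1 / 8 * (alpha + beta) * (chi_p2 + chi_p)"
  shows "rat_cong (of_int (Legendre (3 * int q) (int p)) *
    (\<Sum>k=0..p-1. S k * (of_int L ^ (2 * k) / (432 * of_nat q) ^ k))) T (int p)"
proof -
  obtain r where r: "alpha / beta = r" "alpha = r * beta" using that[of "alpha / beta"] beta_nz by simp
  have "beta * ((- (r) - 1) * of_rat T) = beta * (3 / 4 * (- (r) * chi_p2 - chi_p) - 1 / 8 * (- (r) - 1) * (chi_p2 + chi_p))"
    using assms unfolding r(2) by (simp add: field_simps)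
  then have T: "(- (alpha / beta) - 1) * of_rat T
      = 3 / 4 * (- (alpha / beta) * chi_p2 - chi_p) - 1 / 8 * (- (alpha / beta) - 1) * (chi_p2 + chi_p)"
    unfolding r(1) mult_left_cancel[OF beta_nz] .
  note E = sum_S_eval[OF quotient_facts(6,7,8) z_loc(2) quotient_facts(9,10)[folded zL_def] sign_ep_cases zL_power
      twist_neg chi_p_facts inverse_quotient_loc(3) T]
  have "(\<Sum>k=0..p-1. of_rat (S k) * zL ^ k) \<in> loc"
    by (intro loc_sum loc_mult S_loc loc_power z_loc) simp
  then have "lcong (of_int (Legendre (3 * int q) (int p)) * (\<Sum>k=0..p-1. of_rat (S k) * zL ^ k)) (of_rat T)"
    by (intro lcong_trans[OF lcong_of_int_mult[OF Legendre_3q lcong_refl] E(2)])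
  then show ?thesis
    by (intro rat_cong_if_lcong[OF _ E(1)])
      (simp only: of_rat_mult of_rat_sum of_rat_of_int_eq of_rat_term)
qed

lemma sum_odd_L:
  assumes "(beta - alpha) * of_rat T = 1 / 2 * (beta * chi_p - alpha * chi_p2) - 1 / 12 * (alpha + beta) * (chi_p - chi_p2)"
  shows "rat_cong (of_int (Legendre (3 * int q) (int p)) *
    (\<Sum>k=0..p-1. of_nat (2 * k + 1) * S k * (of_int L ^ (2 * k) / (432 * of_nat q) ^ k))) T (int p)"
proof -
  obtain r where r: "alpha / beta = r" "alpha = r * beta" using that[of "alpha / beta"] beta_nz by simp
  have "beta * ((- (r) + 1) * of_rat T) = beta * (1 / 2 * (- (r) * chi_p2 + chi_p) + 1 / 12 * (- (r) - 1) * (chi_p - chi_p2))"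
    using assms unfolding r(2) by (simp add: field_simps)
  then have T: "(- (alpha / beta) + 1) * of_rat T
      = 1 / 2 * (- (alpha / beta) * chi_p2 + chi_p) + 1 / 12 * (- (alpha / beta) - 1) * (chi_p - chi_p2)"
    unfolding r(1) mult_left_cancel[OF beta_nz] .
  note E = sum_odd_S_eval[OF quotient_facts(6,7,8) z_loc(2) quotient_facts(9,10)[folded zL_def] sign_ep_cases zL_power
      twist_neg chi_p_facts inverse_quotient_loc(4) T]
  have "(\<Sum>k=0..p-1. of_nat (2 * k + 1) * of_rat (S k) * zL ^ k) \<in> loc"
    by (intro loc_sum loc_mult S_loc loc_power z_loc loc_of_nat) simp
  then have "lcong (of_int (Legendre (3 * int q) (int p)) * (\<Sum>k=0..p-1. of_nat (2 * k + 1) * of_rat (S k) * zL ^ k)) (of_rat T)"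
    by (intro lcong_trans[OF lcong_of_int_mult[OF Legendre_3q lcong_refl] E(2)])
  then show ?thesis
    by (intro rat_cong_if_lcong[OF _ E(1)])
      (simp only: of_rat_mult of_rat_sum of_rat_of_int_eq of_rat_of_nat_eq of_rat_term)
qed


lemma alpha_beta_half: "alpha = (of_int L + 3 * of_int M * theta) / 2" "beta = (of_int L - 3 * of_int M * theta) / 2"
  using alpha_eq beta_eq by (simp_all add: field_simps)

lemma trivial_character_values:
  assumes "chi (int p) = 1"
  shows "rat_cong (of_int (Legendre (int q) (int p)) *
      (\<Sum>k=0..p-1. S k * (of_int M ^ (2 * k) / (16 * of_nat q) ^ k))) (1 / 2) (int p)"
    "rat_cong (of_int (Legendre (3 * int q) (int p)) *
      (\<Sum>k=0..p-1. S k * (of_int L ^ (2 * k) / (432 * of_nat q) ^ k))) (1 / 2) (int p)"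
    "rat_cong (of_int (Legendre (int q) (int p)) *
      (\<Sum>k=0..p-1. of_nat (2 * k + 1) * S k * (of_int M ^ (2 * k) / (16 * of_nat q) ^ k))) (1 / 2) (int p)"
    "rat_cong (of_int (Legendre (3 * int q) (int p)) *
      (\<Sum>k=0..p-1. of_nat (2 * k + 1) * S k * (of_int L ^ (2 * k) / (432 * of_nat q) ^ k))) (1 / 2) (int p)"
proof -
  have w: "chi_p2 = 1" "chi_p = 1" using assms by (simp_all add: chi_p2_def chi_p_def)
  have half: "(of_rat (1 / 2) :: complex) = 1 / 2" by (simp add: of_rat_divide)
  show "rat_cong (of_int (Legendre (int q) (int p)) *
      (\<Sum>k=0..p-1. S k * (of_int M ^ (2 * k) / (16 * of_nat q) ^ k))) (1 / 2) (int p)"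
    by (rule sum_M) (simp add: w half field_simps)
  show "rat_cong (of_int (Legendre (3 * int q) (int p)) *
      (\<Sum>k=0..p-1. S k * (of_int L ^ (2 * k) / (432 * of_nat q) ^ k))) (1 / 2) (int p)"
    by (rule sum_L) (simp add: w half field_simps)
  show "rat_cong (of_int (Legendre (int q) (int p)) *
      (\<Sum>k=0..p-1. of_nat (2 * k + 1) * S k * (of_int M ^ (2 * k) / (16 * of_nat q) ^ k))) (1 / 2) (int p)"
    by (rule sum_odd_M) (simp add: w half field_simps)
  show "rat_cong (of_int (Legendre (3 * int q) (int p)) *
      (\<Sum>k=0..p-1. of_nat (2 * k + 1) * S k * (of_int L ^ (2 * k) / (432 * of_nat q) ^ k))) (1 / 2) (int p)"
    by (rule sum_odd_L) (simp add: w half field_simps)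
qed

text \<open>The sign \<open>e\<close> is the one with \<open>chi_p2 = (- 1 + e * theta) / 2\<close>.
  In each of the four identities \<open>theta\<close> cancels or occurs squared, so the values are
  rational.\<close>

lemma nontrivial_character_values:
  fixes e :: rat
  assumes "chi (int p) = eis_w \<and> e = - 1 \<or> chi (int p) = eis_w\<^sup>2 \<and> e = 1"
  defines "l \<equiv> of_int L" and "m \<equiv> of_int M"
  shows "rat_cong (of_int (Legendre (int q) (int p)) *
      (\<Sum>k=0..p-1. S k * (of_int M ^ (2 * k) / (16 * of_nat q) ^ k)))
      ((e * l - 2 * m) / (8 * m)) (int p)"
    "rat_cong (of_int (Legendre (3 * int q) (int p)) *
      (\<Sum>k=0..p-1. S k * (of_int L ^ (2 * k) / (432 * of_nat q) ^ k)))
      ((- e * (27 * m) - 2 * l) / (8 * l)) (int p)"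
    "rat_cong (of_int (Legendre (int q) (int p)) *
      (\<Sum>k=0..p-1. of_nat (2 * k + 1) * S k * (of_int M ^ (2 * k) / (16 * of_nat q) ^ k)))
      ((- e * (6 * m) - l) / (4 * l)) (int p)"
    "rat_cong (of_int (Legendre (3 * int q) (int p)) *
      (\<Sum>k=0..p-1. of_nat (2 * k + 1) * S k * (of_int L ^ (2 * k) / (432 * of_nat q) ^ k)))
      ((e * (2 * l) - 9 * m) / (36 * m)) (int p)"
proof -
  define a b c where "a = (of_int L :: complex)" and "b = (of_int M :: complex)" and "c = (of_rat e :: complex)"
  have ab: "a \<noteq> 0" "b \<noteq> 0" using L_nz M_nz by (simp_all add: a_def b_def)
  have om: "eis_complex eis_w = omega" by (simp add: eis_complex_def)
  have om2: "omega = (- 1 + theta) / 2" "omega\<^sup>2 = (- 1 - theta) / 2"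
    by (simp_all add: omega_square theta_def field_simps)
  have w: "chi_p2 = (- 1 + c * theta) / 2" "chi_p = (- 1 - c * theta) / 2"
  proof -
    have "eis_w ^ 4 = eis_w ^ 3 * eis_w" by (simp add: eval_nat_numeral)
    then have "eis_w ^ 4 = eis_w" by simp
    from arg_cong[OF this, of eis_complex] have "omega ^ 4 = omega" by (simp add: om)
    then show "chi_p2 = (- 1 + c * theta) / 2" "chi_p = (- 1 - c * theta) / 2"
      using assms(1) om om2 unfolding chi_p2_def chi_p_def c_def
      by (auto simp flip: power_mult)
  qed
  have alpha: "alpha = (a + 3 * b * theta) / 2" and beta: "beta = (a - 3 * b * theta) / 2"
    unfolding a_def b_def by (rule alpha_beta_half)+
  have diff: "alpha - beta = 3 * b * theta" and add: "alpha + beta = a" and diff': "beta - alpha = - (3 * b * theta)"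
    by (simp_all add: alpha beta field_simps)
  have wadd: "chi_p2 + chi_p = - 1" and wdiff: "chi_p - chi_p2 = - (c * theta)" by (simp_all add: w field_simps)
  have P: "alpha * chi_p2 - beta * chi_p = theta * (c * a - 3 * b) / 2"
    by (simp add: alpha beta w field_simps)
  have "alpha * chi_p2 + beta * chi_p = (- a + 3 * b * c * (theta * theta)) / 2"
    by (simp add: alpha beta w field_simps)
  then have Q: "alpha * chi_p2 + beta * chi_p = (- a - 9 * b * c) / 2" by (simp add: theta_square)
  have T: "of_rat ((e * l - 2 * m) / (8 * m)) = (c * a - 2 * b) / (8 * b)"
    "of_rat ((- e * (27 * m) - 2 * l) / (8 * l)) = (- c * (27 * b) - 2 * a) / (8 * a)"
    "of_rat ((- e * (6 * m) - l) / (4 * l)) = (- c * (6 * b) - a) / (4 * a)"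
    "of_rat ((e * (2 * l) - 9 * m) / (36 * m)) = (c * (2 * a) - 9 * b) / (36 * b)"
    by (simp_all add: l_def m_def a_def b_def c_def of_rat_divide of_rat_mult of_rat_diff of_rat_minus)
  show "rat_cong (of_int (Legendre (int q) (int p)) *
      (\<Sum>k=0..p-1. S k * (of_int M ^ (2 * k) / (16 * of_nat q) ^ k)))
      ((e * l - 2 * m) / (8 * m)) (int p)"
    by (rule sum_M) (unfold T diff P wadd, use ab in \<open>simp add: field_simps\<close>)
  show "rat_cong (of_int (Legendre (3 * int q) (int p)) *
      (\<Sum>k=0..p-1. S k * (of_int L ^ (2 * k) / (432 * of_nat q) ^ k)))
      ((- e * (27 * m) - 2 * l) / (8 * l)) (int p)"
    by (rule sum_L) (unfold T add Q wadd, use ab in \<open>simp add: field_simps\<close>)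
  have "1 / 12 * (3 * b * theta) * - (c * theta) = - (b * c / 4) * (theta * theta)" by simp
  then have R: "1 / 12 * (3 * b * theta) * - (c * theta) = 3 * b * c / 4" by (simp add: theta_square)
  show "rat_cong (of_int (Legendre (int q) (int p)) *
      (\<Sum>k=0..p-1. of_nat (2 * k + 1) * S k * (of_int M ^ (2 * k) / (16 * of_nat q) ^ k)))
      ((- e * (6 * m) - l) / (4 * l)) (int p)"
    by (rule sum_odd_M) (unfold T add diff Q wdiff R, use ab in \<open>simp add: field_simps\<close>)
  have P': "beta * chi_p - alpha * chi_p2 = - (theta * (c * a - 3 * b) / 2)"
    unfolding P[symmetric] by simp
  show "rat_cong (of_int (Legendre (3 * int q) (int p)) *
      (\<Sum>k=0..p-1. of_nat (2 * k + 1) * S k * (of_int L ^ (2 * k) / (432 * of_nat q) ^ k)))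
      ((e * (2 * l) - 9 * m) / (36 * m)) (int p)"
    by (rule sum_odd_L) (unfold T add diff' P' wdiff, use ab in \<open>simp add: field_simps\<close>)
qed

end

theorem theorem38:
  fixes p q :: nat and L M :: int
  assumes "prime q" and "[q = 1] (mod 3)"
    and "4 * int q = L\<^sup>2 + 27 * M\<^sup>2" and "[L = 1] (mod 3)"
    and "prime p" and "p \<noteq> 2" and "p \<noteq> 3" and "p \<noteq> q"
    and "\<not> int p dvd L * M"
  defines "A \<equiv> (of_int (Legendre (int q) (int p)) *
            (\<Sum>k=0..p-1. S k * (of_int M ^ (2 * k) / (16 * of_nat q) ^ k)) :: rat)"
    and "B \<equiv> (of_int (Legendre (3 * int q) (int p)) *
            (\<Sum>k=0..p-1. S k * (of_int L ^ (2 * k) / (432 * of_nat q) ^ k)) :: rat)"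
    and "C \<equiv> (of_int (Legendre (int q) (int p)) *
            (\<Sum>k=0..p-1. of_nat (2 * k + 1) * S k *
               (of_int M ^ (2 * k) / (16 * of_nat q) ^ k)) :: rat)"
    and "D \<equiv> (of_int (Legendre (3 * int q) (int p)) *
            (\<Sum>k=0..p-1. of_nat (2 * k + 1) * S k *
               (of_int L ^ (2 * k) / (432 * of_nat q) ^ k)) :: rat)"
    and "x \<equiv> (of_nat p ^ ((q - 1) div 3) :: rat)"
    and "l \<equiv> (of_int L :: rat)" and "m \<equiv> (of_int M :: rat)"
  shows "(rat_cong x 1 (int q) \<longrightarrow> rat_cong A (1 / 2) (int p)) \<and>
         (\<forall>e \<in> {1, -1}. rat_cong x ((-1 + e * (l / (3 * m))) / 2) (int q) \<longrightarrow>
            rat_cong A ((e * l - 2 * m) / (8 * m)) (int p)) \<and>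
         (rat_cong x 1 (int q) \<longrightarrow> rat_cong B (1 / 2) (int p)) \<and>
         (\<forall>e \<in> {1, -1}. rat_cong x ((-1 + e * (9 * m / l)) / 2) (int q) \<longrightarrow>
            rat_cong B ((e * (27 * m) - 2 * l) / (8 * l)) (int p)) \<and>
         (rat_cong x 1 (int q) \<longrightarrow> rat_cong C (1 / 2) (int p)) \<and>
         (\<forall>e \<in> {1, -1}. rat_cong x ((-1 + e * (9 * m / l)) / 2) (int q) \<longrightarrow>
            rat_cong C ((e * (6 * m) - l) / (4 * l)) (int p)) \<and>
         (rat_cong x 1 (int q) \<longrightarrow> rat_cong D (1 / 2) (int p)) \<and>
         (\<forall>e \<in> {1, -1}. rat_cong x ((-1 + e * (l / (3 * m))) / 2) (int q) \<longrightarrow>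
            rat_cong D ((e * (2 * l) - 9 * m) / (36 * m)) (int p))"
proof -
  have q_mod: "q mod 3 = 1" using assms(2) by (simp add: cong_def)
  have q_neq: "q \<noteq> 2" "q \<noteq> 3" using q_mod by auto
  have pq: "prime (int q)" using assms(1) by simp
  have q23: "\<not> int q dvd 2" "\<not> int q dvd 3"
  proof -
    have "\<not> q dvd 2" "\<not> q dvd 3"
      using q_neq primes_dvd_imp_eq[OF assms(1) two_is_prime_nat] primes_dvd_imp_eq[OF assms(1), of 3]
      by auto
    then show "\<not> int q dvd 2" "\<not> int q dvd 3"
      using int_dvd_int_iff[of q 2] int_dvd_int_iff[of q 3] by simp_all
  qed
  have q6: "\<not> int q dvd 2 * 3" using q23 pq prime_dvd_mult_iff by blast
  have q27: "\<not> int q dvd 3 ^ 3" using q23(2) prime_dvd_power[OF pq] by blast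
  have qLM: "int q dvd L\<^sup>2 + 27 * M\<^sup>2" unfolding assms(3)[symmetric] by simp
  have LM_iff: "int q dvd L \<longleftrightarrow> int q dvd M"
  proof
    assume "int q dvd L"
    then have "int q dvd L\<^sup>2" by (simp add: power2_eq_square)
    then have "int q dvd 3 ^ 3 * M\<^sup>2" using qLM by (simp add: dvd_add_right_iff)
    then show "int q dvd M" using q27 pq prime_dvd_power by (metis prime_dvd_mult_iff)
  next
    assume "int q dvd M"
    then have "int q dvd 27 * M\<^sup>2" by (simp add: power2_eq_square)
    then have "int q dvd L\<^sup>2" using qLM by (simp add: dvd_add_left_iff)
    then show "int q dvd L" using pq prime_dvd_power by blast
  qed
  have qM: "\<not> int q dvd M"
  proof
    assume M: "int q dvd M"
    then have "int q dvd L" using LM_iff by blast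
    have "int q * int q dvd L\<^sup>2" "int q * int q dvd 27 * M\<^sup>2"
      unfolding power2_eq_square
      using mult_dvd_mono[OF \<open>int q dvd L\<close> \<open>int q dvd L\<close>] dvd_mult[OF mult_dvd_mono[OF M M]] by blast+
    \<comment> \<open>A common divisor \<open>q\<close> of \<open>L\<close> and \<open>M\<close>
      would make \<open>q\<^sup>2\<close> divide \<open>4 q\<close>.\<close>
    then have "int q * int q dvd int q * 4" using assms(3) by (metis dvd_add mult.commute)
    then have "int q dvd 2 * 2" using assms(1) by (simp add: prime_gt_0_nat)
    then show False using q23(1) pq prime_dvd_mult_iff by blast
  qed
  have qL: "\<not> int q dvd L" using LM_iff qM by blast
  have q6M: "\<not> int q dvd 2 * 3 * M" using q6 qM pq prime_dvd_mult_iff by blast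
  then have "coprime (2 * 3 * M) (int q)" using pq by (metis coprime_commute prime_imp_coprime)
  then obtain u where u: "[2 * 3 * M * u = 1] (mod int q)" using cong_solve_coprime_int by blast
  define t where "t = u * (- L - 3 * M)"
  have t: "int q dvd 6 * M * t + L + 3 * M"
  proof -
    have "6 * M * t + L + 3 * M = (2 * 3 * M * u - 1) * (- L - 3 * M)"
      by (simp add: t_def algebra_simps)
    then show ?thesis using u by (simp add: cong_iff_dvd_diff)
  qed
  have "int q dvd t\<^sup>2 + t + 1"
  proof -
    \<comment> \<open>Completing the square: \<open>36 M\<^sup>2 (t\<^sup>2 + t + 1) = (6 M t + 3
      M)\<^sup>2 + 27 M\<^sup>2\<close>, where \<open>6 M t + 3 M\<close> is \<open>- L\<close>
      modulo \<open>q\<close>.\<close>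
    have "(2 * 3 * M) * ((2 * 3 * M) * (t\<^sup>2 + t + 1))
        = (6 * M * t + L + 3 * M) * (6 * M * t + 3 * M - L) + (L\<^sup>2 + 27 * M\<^sup>2)"
      by (simp add: algebra_simps power2_eq_square)
    then have "int q dvd (2 * 3 * M) * ((2 * 3 * M) * (t\<^sup>2 + t + 1))"
      using t qLM by (metis dvd_add dvd_mult2)
    then show ?thesis using q6M pq by (simp only: prime_dvd_mult_iff simp_thms)
  qed
  then interpret cubic_character q t
    using assms(1,2) by unfold_locales
  \<comment> \<open>This rounding gives the right \<open>h\<close> for \<open>p = 6 h + 1\<close>
    and for \<open>p = 6 h - 1\<close> alike.\<close>
  define N h where "N = (p - 1) div 2" and "h = (p + 1) div 6"
  have "\<not> 2 dvd p" "\<not> 3 dvd p"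
    using assms(5-7) primes_dvd_imp_eq[OF two_is_prime_nat assms(5)] primes_dvd_imp_eq[of 3 p] by auto
  then have "p = 2 * N + 1" "p = 6 * h + 1 \<or> p + 1 = 6 * h"
    unfolding N_def h_def by presburger+
  moreover have pLM: "\<not> int p dvd L" "\<not> int p dvd M" using assms(9) by auto
  ultimately interpret cubic_sums q t p N h L M
    using assms(3-8) t by unfold_locales
  define X where "X = int p ^ ((q - 1) div 3)"
  have x: "x = of_int X" by (simp add: x_def X_def)
  have lm: "l \<noteq> 0" "m \<noteq> 0" using L_nz M_nz by (simp_all add: l_def m_def)
  have qp: "\<not> int q dvd int p" using assms(1,5,8) by (metis int_dvd_int_iff primes_dvd_imp_eq)
  have chi1: "chi (int p) = 1" if "rat_cong x 1 (int q)"
  proof (rule chi_eqI[OF qp])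
    have "int q dvd X - 1" using rat_cong_imp_dvd[OF assms(1) that, of 1 "X - 1"] by (simp add: x)
    then show "[eis_eval t 1 = int p ^ ((q - 1) div 3)] (mod int q)"
      by (simp add: X_def cong_iff_dvd_diff dvd_diff_commute)
  qed simp
  \<comment> \<open>The number \<open>(- 1 + e L / (3 M)) / 2\<close> is \<open>t\<close> for
    \<open>e = - 1\<close> and \<open>- 1 - t\<close> for \<open>e = 1\<close>, the residues of
    \<open>\<omega>\<close> and its square. \<open>E\<close> is the integer form of
    \<open>e\<close>.\<close>
  have chiL: "chi (int p) = eis_w \<and> e = - 1 \<or> chi (int p) = eis_w\<^sup>2 \<and> e = 1"
    if e: "e = 1 \<or> e = - 1" and d: "int q dvd 6 * M * X + 3 * M - E * L" "of_int E = e"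
    for e :: rat and E
    using e
  proof
    assume e1: "e = 1"
    then have "E = 1" using d(2) by (metis of_int_eq_1_iff)
    then have "int q dvd (6 * M * X + 3 * M - L) + (6 * M * t + L + 3 * M)"
      using dvd_add[OF d(1) t] by (simp only: mult_1)
    also have "\<dots> = (2 * 3 * M) * (X - (- 1 - t))" by (simp add: algebra_simps)
    finally have "int q dvd X - (- 1 - t)" using q6M pq by (simp only: prime_dvd_mult_iff simp_thms)
    then have "[eis_eval t (eis_w\<^sup>2) = int p ^ ((q - 1) div 3)] (mod int q)"
      unfolding eis_eval_w2 X_def[symmetric] by (metis cong_iff_dvd_diff cong_sym)
    then have "chi (int p) = eis_w\<^sup>2" by (intro chi_eqI[OF qp]) simp_all
    then show ?thesis using e1 by simp
  next
    assume e1: "e = - 1"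
    then have "E = - 1" using d(2) by (metis of_int_eq_iff of_int_minus of_int_1)
    then have "int q dvd (6 * M * X + 3 * M + L) - (6 * M * t + L + 3 * M)" 
      using dvd_diff[OF d(1) t] by (simp only: mult_minus1 diff_minus_eq_add)
    also have "\<dots> = (2 * 3 * M) * (X - t)" by (simp add: algebra_simps)
    finally have "int q dvd X - t" using q6M pq by (simp only: prime_dvd_mult_iff simp_thms)
    then have "[eis_eval t eis_w = int p ^ ((q - 1) div 3)] (mod int q)"
      unfolding eis_eval_simps X_def[symmetric] by (metis cong_iff_dvd_diff cong_sym)
    then have "chi (int p) = eis_w" by (intro chi_eqI[OF qp]) simp_all
    then show ?thesis using e1 by simp
  qed
  have dL: "int q dvd 6 * M * X + 3 * M - E * L"
    if r: "rat_cong x ((-1 + e * (l / (3 * m))) / 2) (int q)" and E: "of_int E = e" for e E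
    by (rule rat_cong_imp_dvd[OF assms(1) r, of "6 * M"])
      (use lm in \<open>simp add: x l_def m_def E[symmetric] field_simps\<close>)
  \<comment> \<open>As \<open>L\<^sup>2\<close> is \<open>- 27 M\<^sup>2\<close> modulo
    \<open>q\<close>, the quotient \<open>9 M / L\<close> is \<open>- L / (3 M)\<close>. So this
    condition is the previous one with the opposite sign.\<close>
  have dM: "int q dvd 6 * M * X + 3 * M - (- E) * L"
    if r: "rat_cong x ((-1 + e * (9 * m / l)) / 2) (int q)" and E: "of_int E = e" "E * E = 1" for e E
  proof -
    have "int q dvd L * (2 * X + 1) - 9 * E * M"
      by (rule rat_cong_imp_dvd[OF assms(1) r, of "2 * L"])
        (use lm in \<open>simp add: x l_def m_def E(1)[symmetric] field_simps\<close>)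
    from dvd_add[OF dvd_mult[OF this, of "3 * M"] dvd_mult[OF qLM, of E]]
    have "int q dvd 3 * M * (L * (2 * X + 1) - 9 * E * M) + E * (L\<^sup>2 + 27 * M\<^sup>2)" .
    also have "\<dots> = L * (6 * M * X + 3 * M - (- E) * L)"
      by (simp add: algebra_simps power2_eq_square)
    finally show ?thesis using qL pq by (simp only: prime_dvd_mult_iff simp_thms)
  qed
  have signs: "\<exists>E. of_int E = e \<and> E * E = 1 \<and> (e = 1 \<or> e = - 1)" if "e \<in> {1, - 1 :: rat}" for e
    using that by (auto intro: exI[of _ 1] exI[of _ "- 1"])
  have posL: "chi (int p) = eis_w \<and> e = - 1 \<or> chi (int p) = eis_w\<^sup>2 \<and> e = 1"
    if "e \<in> {1, - 1}" "rat_cong x ((-1 + e * (l / (3 * m))) / 2) (int q)" for e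
    using signs[OF that(1)] chiL dL[OF that(2)] by blast
  have posM: "chi (int p) = eis_w \<and> - e = - 1 \<or> chi (int p) = eis_w\<^sup>2 \<and> - e = 1"
    if e: "e \<in> {1, - 1}" and r: "rat_cong x ((-1 + e * (9 * m / l)) / 2) (int q)" for e
  proof -
    obtain E where E: "of_int E = e" "E * E = 1" "e = 1 \<or> e = - 1" using signs[OF e] by blast
    show ?thesis
      by (rule chiL[OF _ dM[OF r E(1,2)]]) (use E in auto)
  qed
  show ?thesis
    unfolding A_def B_def C_def D_def
    using trivial_character_values[OF chi1] nontrivial_character_values(1,4)[OF posL]
      nontrivial_character_values(2,3)[OF posM]
    unfolding l_def[symmetric] m_def[symmetric] minus_minus
    by (intro conjI impI ballI) simp_all
qed

end
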